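(* Let $M$ be a connected orientable hypersurface of $\mathbb{H}^2\times\mathbb{H}^2$ with unit normal $N$ having three distinct constant principal curvatures. If $V=PN-\langle PN,N\rangle N$ is a principal curvature vector field on $M$ (i.e. an eigenvector field of the shape operator), then, up to an isometry of $\mathbb{H}^2\times\mathbb{H}^2$, $M$ is an open part of $M^c_{1,-1}$ for some $c\in(0,\tfrac12)\cup(\tfrac12,1)$, or an open part of $M^c_{1,1}$ for some $c\in(0,1)$, or an open part of $M_\tau$ for some $\tau<-1$.
   Context: $\mathbb{R}^3_1$ denotes $\mathbb{R}^3$ with the Lorentzian inner product $\langle x,y\rangle=-x_1y_1+x_2y_2+x_3y_3$, and $\mathbb{H}^2=\{x\in\mathbb{R}^3_1:\langle x,x\rangle=-1,\ x_1>0\}$. $\mathbb{H}^2\times\mathbb{H}^2$ carries the Riemannian product metric; $P(v_1,v_2)=(v_1,-v_2)$ is its product structure. For $0<c<1$, put $\gamma(r)=(\tfrac{2+r^2}{2},r,\tfrac{r^2}{2})$ and $N(r)=(-\tfrac{r^2}{2},-r,\tfrac{2-r^2}{2})$; $M^c_{1,-1}$ is the image of $(t,r,s)\mapsto\big(\cosh(\sqrt c\,t)\gamma(r)+\sinh(\sqrt c\,t)N(r),\ \cosh(\sqrt{1-c}\,t)\gamma(s)+\sinh(\sqrt{1-c}\,t)\tilde N(s)\big)$ with $\tilde N(s)=(\tfrac{s^2}{2},s,\tfrac{s^2-2}{2})$, and $M^c_{1,1}$ is the image of the same map with $\tilde N(s)=(-\tfrac{s^2}{2},-s,\tfrac{2-s^2}{2})$.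 For $\tau<-1$, $M_\tau=\{(p,q)\in\mathbb{H}^2\times\mathbb{H}^2:\langle p,q\rangle=\tau\}$ (Lorentzian inner product of $\mathbb{R}^3_1$). *)

theory Defs
  imports "HOL-Analysis.Analysis"
begin

type_synonym pt = "(real^3) \<times> (real^3)"

definition lor :: "real^3 \<Rightarrow> real^3 \<Rightarrow> real" where
  "lor x y = - (x$1 * y$1) + x$2 * y$2 + x$3 * y$3"

definition H2 :: "(real^3) set" where
  "H2 = {x. lor x x = -1 \<and> x$1 > 0}"

definition HH :: "pt set" where
  "HH = H2 \<times> H2"

text \<open>Product metric (restricted to tangent vectors it is the Riemannian metric of H2 x H2).\<close>
definition gprod :: "pt \<Rightarrow> pt \<Rightarrow> real" where
  "gprod v w = lor (fst v) (fst w) + lor (snd v) (snd w)"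

definition tangent_HH :: "pt \<Rightarrow> pt set" where
  "tangent_HH x = {v. lor (fst v) (fst x) = 0 \<and> lor (snd v) (snd x) = 0}"

definition tproj :: "pt \<Rightarrow> pt \<Rightarrow> pt" where
  "tproj x w = (fst w + lor (fst w) (fst x) *\<^sub>R fst x, snd w + lor (snd w) (snd x) *\<^sub>R snd x)"

definition Pstr :: "pt \<Rightarrow> pt" where
  "Pstr v = (fst v, - snd v)"

text \<open>C^k and C^infinity maps on a set (intended: open set).\<close>
fun Ck_on :: "nat \<Rightarrow> ('a::real_normed_vector \<Rightarrow> 'b::real_normed_vector) \<Rightarrow> 'a set \<Rightarrow> bool" where
  "Ck_on 0 f U = continuous_on U f"
| "Ck_on (Suc k) f U = ((\<forall>x\<in>U. f differentiable (at x)) \<and>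
      (\<forall>v. Ck_on k (\<lambda>x. frechet_derivative f (at x) v) U))"

definition smooth_on :: "('a::real_normed_vector \<Rightarrow> 'b::real_normed_vector) \<Rightarrow> 'a set \<Rightarrow> bool" where
  "smooth_on f U = (\<forall>k. Ck_on k f U)"

definition is_chart :: "pt set \<Rightarrow> (real^3 \<Rightarrow> pt) \<Rightarrow> (real^3) set \<Rightarrow> pt set \<Rightarrow> bool" where
  "is_chart M \<phi> U W = (open U \<and> open W \<and> smooth_on \<phi> U \<and>
      (\<forall>u\<in>U. inj (frechet_derivative \<phi> (at u))) \<and>
      (\<exists>\<psi>. homeomorphism U (M \<inter> W) \<phi> \<psi>))"

definition hypersurface :: "pt set \<Rightarrow> bool" where
  "hypersurface M = (M \<subseteq> HH \<and> (\<forall>x\<in>M. \<exists>\<phi> U W. is_chart M \<phi> U W \<and> x \<in> W))"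

definition tangent_space :: "pt set \<Rightarrow> pt \<Rightarrow> pt set" where
  "tangent_space M x = {v. \<exists>\<phi> U W u. is_chart M \<phi> U W \<and> u \<in> U \<and> \<phi> u = x \<and>
      v \<in> range (frechet_derivative \<phi> (at u))}"

definition unit_normal :: "pt set \<Rightarrow> (pt \<Rightarrow> pt) \<Rightarrow> bool" where
  "unit_normal M N = ((\<forall>x\<in>M. N x \<in> tangent_HH x \<and> gprod (N x) (N x) = 1 \<and>
        (\<forall>v\<in>tangent_space M x. gprod (N x) v = 0)) \<and>
      (\<forall>\<phi> U W. is_chart M \<phi> U W \<longrightarrow> smooth_on (N \<circ> \<phi>) U))"

text \<open>Shape operator A X = - (Levi-Civita derivative of N along X), the Levi-Civita
  connection of H2 x H2 being the tangential part of the flat derivative.\<close>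
definition shape_op :: "pt set \<Rightarrow> (pt \<Rightarrow> pt) \<Rightarrow> pt \<Rightarrow> pt \<Rightarrow> pt" where
  "shape_op M N x v = - tproj x (frechet_derivative N (at x within M) v)"

definition principal_curvatures :: "pt set \<Rightarrow> (pt \<Rightarrow> pt) \<Rightarrow> pt \<Rightarrow> real set" where
  "principal_curvatures M N x =
     {k. \<exists>v\<in>tangent_space M x. v \<noteq> 0 \<and> shape_op M N x v = k *\<^sub>R v}"

definition Vfield :: "(pt \<Rightarrow> pt) \<Rightarrow> pt \<Rightarrow> pt" where
  "Vfield N x = Pstr (N x) - gprod (Pstr (N x)) (N x) *\<^sub>R N x"

definition hdist :: "real^3 \<Rightarrow> real^3 \<Rightarrow> real" where
  "hdist p q = arcosh (- lor p q)"

definition pdist :: "pt \<Rightarrow> pt \<Rightarrow> real" where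
  "pdist x y = sqrt ((hdist (fst x) (fst y))\<^sup>2 + (hdist (snd x) (snd y))\<^sup>2)"

definition isometry_HH :: "(pt \<Rightarrow> pt) \<Rightarrow> bool" where
  "isometry_HH \<Phi> = (bij_betw \<Phi> HH HH \<and> (\<forall>x\<in>HH. \<forall>y\<in>HH. pdist (\<Phi> x) (\<Phi> y) = pdist x y))"

definition vec3 :: "real \<Rightarrow> real \<Rightarrow> real \<Rightarrow> real^3" where
  "vec3 a b c = (\<chi> i. if i = 1 then a else if i = 2 then b else c)"

definition gam :: "real \<Rightarrow> real^3" where
  "gam r = vec3 ((2 + r\<^sup>2) / 2) r (r\<^sup>2 / 2)"

definition Nvec :: "real \<Rightarrow> real^3" where
  "Nvec r = vec3 (- (r\<^sup>2 / 2)) (- r) ((2 - r\<^sup>2) / 2)"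

definition Nminus :: "real \<Rightarrow> real^3" where
  "Nminus s = vec3 (s\<^sup>2 / 2) s ((s\<^sup>2 - 2) / 2)"

definition Mc :: "real \<Rightarrow> (real \<Rightarrow> real^3) \<Rightarrow> pt set" where
  "Mc c Nt = (\<lambda>(t, r, s). (cosh (sqrt c * t) *\<^sub>R gam r + sinh (sqrt c * t) *\<^sub>R Nvec r,
        cosh (sqrt (1 - c) * t) *\<^sub>R gam s + sinh (sqrt (1 - c) * t) *\<^sub>R Nt s)) ` UNIV"

definition M1m1 :: "real \<Rightarrow> pt set" where "M1m1 c = Mc c Nminus"
definition M11 :: "real \<Rightarrow> pt set" where "M11 c = Mc c Nvec"

definition Mtau :: "real \<Rightarrow> pt set" where
  "Mtau \<tau> = {x \<in> HH. lor (fst x) (snd x) = \<tau>}"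

definition open_part_upto_isometry :: "pt set \<Rightarrow> pt set \<Rightarrow> bool" where
  "open_part_upto_isometry M S = (\<exists>\<Phi>. isometry_HH \<Phi> \<and> \<Phi> ` M \<subseteq> S \<and>
      openin (top_of_set S) (\<Phi> ` M))"

end

theory Submission
  imports Defs
begin

text \<open>
  Write the unit normal as \<open>N = (m, n)\<close> and put \<open>f = |m|\<^sup>2\<close>, so that \<open>\<langle>PN, N\<rangle> = 2 f - 1\<close> and
  \<open>A V = \<mu> V\<close> says that \<open>f\<close> has gradient \<open>- \<mu> V\<close>. If \<open>\<mu> \<noteq> 0\<close>, then \<open>V\<close> is closed, the shape operator is
  diagonal in the frame given by the two factors, and the Codazzi equation expresses \<open>f\<close> through the
  constant principal curvatures, so that \<open>\<mu> V = 0\<close> after all. Hence \<open>\<mu> = 0\<close> and \<open>f\<close> is constant.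
  The Codazzi equations along \<open>V\<close>, together with the constancy of trace and determinant, then leave
  two possibilities for the remaining symmetric 2 by 2 block with constant entries. If it is diagonal,
  both factors are foliated by horocycles with fixed points at infinity, and the two Busemann functions
  are linearly related. If not, \<open>f = 1/2\<close> and the moving frames of the two factors differ by a
  constant Lorentz transformation \<open>L\<close>, for which \<open>\<langle>p, L q\<rangle>\<close> is constant.
  In both cases openness in the model is invariance of domain.
\<close>

subsection \<open>Symmetry of second derivatives\<close>

text \<open>The obstacle is regularity and degeneration. The principal curvatures are prescribed
  only as a set at each point, so neither \<mu> nor the block entries come with any continuity. Both
  are recovered as quotients of differentiable forms evaluated on fixed coordinate vectors; a
  continuous quotient with values in a finite set, as for \<mu>, is locally constant. The lengths
  |m| and |n| may vanish a priori, so the frames stay unnormalised and the structure equations are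
  multiplied by \<open>f\<close> instead of divided. Vanishing can be excluded only once
  \<open>f\<close> is constant: M would then locally be a product of a curve with a hyperbolic
  plane, which has at most one nonzero principal curvature. All Gauss and Codazzi equations rest on
  one fact, the symmetry of second derivatives, applied to the two factors of the chart and of the
  normal.\<close>

lemma second_difference_estimate:
  fixes f :: "'a::real_normed_vector \<Rightarrow> real"
  assumes "open U" "x \<in> U"
    and f': "\<And>u. u \<in> U \<Longrightarrow> (f has_derivative f' u) (at u)"
    and L: "((\<lambda>u. f' u w) has_derivative L) (at x)"
    and "e > 0"
  shows "\<exists>d>0. \<forall>t. 0 < t \<and> t < d \<longrightarrow>
    \<bar>f (x + t *\<^sub>R v + t *\<^sub>R w) - f (x + t *\<^sub>R v) - f (x + t *\<^sub>R w) + f x - t\<^sup>2 * L v\<bar> \<le> e * t\<^sup>2"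
proof -
  define K where "K = norm v + norm w + 1"
  have K: "K > 0" unfolding K_def by (simp add: add_nonneg_pos)
  interpret L: bounded_linear L using L by (rule has_derivative_bounded_linear)
  have "e / (2*K) > 0" using K \<open>e > 0\<close> by simp
  then obtain d0 where d0: "d0 > 0" and est: "\<And>y. norm (y - x) < d0 \<Longrightarrow>
      norm (f' y w - f' x w - L (y - x)) \<le> e / (2*K) * norm (y - x)"
    using L unfolding has_derivative_at_alt by blast
  obtain r where r: "r > 0" "ball x r \<subseteq> U" using assms(1,2) open_contains_ball by blast
  define d where "d = min d0 r / K"
  have "\<bar>f (x + t *\<^sub>R v + t *\<^sub>R w) - f (x + t *\<^sub>R v) - f (x + t *\<^sub>R w) + f x - t\<^sup>2 * L v\<bar> \<le> e * t\<^sup>2"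
    if t: "0 < t" "t < d" for t
  proof -
    have tK: "t * K < d0" "t * K < r" using t K unfolding d_def by (auto simp: field_simps)
    have n1: "norm (t *\<^sub>R v + (\<theta> * t) *\<^sub>R w) \<le> t * K" "norm ((\<theta> * t) *\<^sub>R w) \<le> t * K"
      if \<theta>: "0 \<le> \<theta>" "\<theta> \<le> 1" for \<theta>
    proof -
      have a: "norm ((\<theta> * t) *\<^sub>R w) \<le> t * norm w"
        using \<theta> t by (simp add: abs_mult mult_right_mono mult_left_le_one_le)
      have "norm (t *\<^sub>R v + (\<theta> * t) *\<^sub>R w) \<le> t * norm v + t * norm w"
        using norm_triangle_ineq[of "t *\<^sub>R v" "(\<theta> * t) *\<^sub>R w"] a t by simp
      with t show "norm (t *\<^sub>R v + (\<theta> * t) *\<^sub>R w) \<le> t * K" by (simp add: K_def algebra_simps)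
      have "t * norm w \<le> t * K" using t by (intro mult_left_mono) (auto simp: K_def)
      with a show "norm ((\<theta> * t) *\<^sub>R w) \<le> t * K" by linarith
    qed
    have inU: "x + t *\<^sub>R v + (\<theta> * t) *\<^sub>R w \<in> U" "x + (\<theta> * t) *\<^sub>R w \<in> U" if "0 \<le> \<theta>" "\<theta> \<le> 1" for \<theta>
      using n1[OF that] tK(2) r(2) by (auto simp: subset_iff dist_norm add.assoc norm_minus_commute)
    \<comment> \<open>The second difference is the increment of \<open>G\<close> over [0, 1], so one
      use of the mean value theorem reduces it to \<open>f'\<close> at two points. The expansion of
      \<open>f' _ w\<close> at \<open>x\<close> then finishes, with an error of at most
      \<open>e * t / 2\<close> at each point.\<close>
    define G where "G = (\<lambda>\<theta>. f (x + t *\<^sub>R v + (\<theta> * t) *\<^sub>R w) - f (x + (\<theta> * t) *\<^sub>R w))"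
    have G': "(G has_derivative (\<lambda>h. f' (x + t *\<^sub>R v + (\<theta> * t) *\<^sub>R w) ((h * t) *\<^sub>R w)
        - f' (x + (\<theta> * t) *\<^sub>R w) ((h * t) *\<^sub>R w))) (at \<theta>)" if "0 \<le> \<theta>" "\<theta> \<le> 1" for \<theta>
    proof -
      have 1: "((\<lambda>\<theta>. x + t *\<^sub>R v + (\<theta> * t) *\<^sub>R w) has_derivative (\<lambda>h. (h * t) *\<^sub>R w)) (at \<theta>)"
        and 2: "((\<lambda>\<theta>. x + (\<theta> * t) *\<^sub>R w) has_derivative (\<lambda>h. (h * t) *\<^sub>R w)) (at \<theta>)"
        by (auto intro!: derivative_eq_intros)
      show ?thesis unfolding G_def
        using has_derivative_diff[OF has_derivative_compose[OF 1, of f "f' (x + t *\<^sub>R v + (\<theta> * t) *\<^sub>R w)"]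
            has_derivative_compose[OF 2, of f "f' (x + (\<theta> * t) *\<^sub>R w)"]] f' inU[OF that] by blast
    qed
    have "\<exists>\<theta>\<in>{0<..<1}. G 1 - G 0 = (\<lambda>h. f' (x + t *\<^sub>R v + (\<theta> * t) *\<^sub>R w) ((h * t) *\<^sub>R w)
        - f' (x + (\<theta> * t) *\<^sub>R w) ((h * t) *\<^sub>R w)) (1 - 0)"
      by (rule mvt_simple) (auto intro: has_derivative_at_withinI G')
    then obtain \<theta> where \<theta>: "0 < \<theta>" "\<theta> < 1"
      and eq: "G 1 - G 0 = f' (x + t *\<^sub>R v + (\<theta> * t) *\<^sub>R w) (t *\<^sub>R w) - f' (x + (\<theta> * t) *\<^sub>R w) (t *\<^sub>R w)"
      by auto
    let ?y = "x + t *\<^sub>R v + (\<theta> * t) *\<^sub>R w" and ?z = "x + (\<theta> * t) *\<^sub>R w"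
    have lin: "f' u (t *\<^sub>R w) = t * f' u w" if "u \<in> U" for u
      using has_derivative_bounded_linear[OF f'[OF that]] by (simp add: bounded_linear.linear linear_cmul)
    have eq2: "G 1 - G 0 = t * (f' ?y w - f' ?z w)"
      using eq lin inU[of \<theta>] \<theta> by (simp add: right_diff_distrib)
    have b1: "\<bar>f' ?y w - f' x w - L (?y - x)\<bar> \<le> e / (2*K) * (t * K)"
    proof -
      have ny: "norm (?y - x) \<le> t * K" using n1(1)[of \<theta>] \<theta> by (simp add: add.assoc)
      have "\<bar>f' ?y w - f' x w - L (?y - x)\<bar> \<le> e / (2*K) * norm (?y - x)"
        using est[of ?y] ny tK by simp
      also have "\<dots> \<le> e / (2*K) * (t * K)" using ny K \<open>e > 0\<close> by (intro mult_left_mono) auto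
      finally show ?thesis .
    qed
    have b2: "\<bar>f' ?z w - f' x w - L (?z - x)\<bar> \<le> e / (2*K) * (t * K)"
    proof -
      have nz: "norm (?z - x) \<le> t * K" using n1(2)[of \<theta>] \<theta> by simp
      have "\<bar>f' ?z w - f' x w - L (?z - x)\<bar> \<le> e / (2*K) * norm (?z - x)"
        using est[of ?z] nz tK by simp
      also have "\<dots> \<le> e / (2*K) * (t * K)" using nz K \<open>e > 0\<close> by (intro mult_left_mono) auto
      finally show ?thesis .
    qed
    have half: "e / (2*K) * (t * K) = e * t / 2" using K by simp
    have "L (?y - x) - L (?z - x) = t * L v"
      by (simp add: L.add L.scaleR add.assoc)
    then have "\<bar>f' ?y w - f' ?z w - t * L v\<bar> \<le> e * t"
      using b1 b2 half unfolding abs_le_iff by linarith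
    then have "t * \<bar>f' ?y w - f' ?z w - t * L v\<bar> \<le> t * (e * t)"
      using t by (intro mult_left_mono) auto
    then have "\<bar>t * (f' ?y w - f' ?z w - t * L v)\<bar> \<le> e * t\<^sup>2"
      using t by (simp add: abs_mult power2_eq_square mult_ac)
    moreover have "f (x + t *\<^sub>R v + t *\<^sub>R w) - f (x + t *\<^sub>R v) - f (x + t *\<^sub>R w) + f x = G 1 - G 0"
      by (simp add: G_def)
    ultimately show ?thesis unfolding eq2 by (simp add: algebra_simps power2_eq_square)
  qed
  moreover have "d > 0" using d0 r K by (simp add: d_def)
  ultimately show ?thesis by blast
qed

text \<open>The second difference is symmetric in \<open>v\<close> and \<open>w\<close>, while
  divided by \<open>t\<^sup>2\<close> it approximates both \<open>Lw v\<close> and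
  \<open>Lv w\<close>; an error of a third of their distance on each side is contradictory.\<close>

lemma second_derivative_symmetric_real:
  fixes f :: "'a::real_normed_vector \<Rightarrow> real"
  assumes "open U" "x \<in> U"
    and f': "\<And>u. u \<in> U \<Longrightarrow> (f has_derivative f' u) (at u)"
    and Lw: "((\<lambda>u. f' u w) has_derivative Lw) (at x)"
    and Lv: "((\<lambda>u. f' u v) has_derivative Lv) (at x)"
  shows "Lw v = Lv w"
proof (rule ccontr)
  assume ne: "Lw v \<noteq> Lv w"
  define e where "e = \<bar>Lw v - Lv w\<bar> / 3"
  have e: "e > 0" using ne by (simp add: e_def)
  obtain d1 where d1: "d1 > 0" "\<And>t. 0 < t \<Longrightarrow> t < d1 \<Longrightarrow>
    \<bar>f (x + t *\<^sub>R v + t *\<^sub>R w) - f (x + t *\<^sub>R v) - f (x + t *\<^sub>R w) + f x - t\<^sup>2 * Lw v\<bar> \<le> e * t\<^sup>2"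
    using second_difference_estimate[OF assms(1,2) f' Lw e, of v] by blast
  obtain d2 where d2: "d2 > 0" "\<And>t. 0 < t \<Longrightarrow> t < d2 \<Longrightarrow>
    \<bar>f (x + t *\<^sub>R w + t *\<^sub>R v) - f (x + t *\<^sub>R w) - f (x + t *\<^sub>R v) + f x - t\<^sup>2 * Lv w\<bar> \<le> e * t\<^sup>2"
    using second_difference_estimate[OF assms(1,2) f' Lv e, of w] by blast
  define t where "t = min d1 d2 / 2"
  have t: "0 < t" "t < d1" "t < d2" using d1(1) d2(1) by (auto simp: t_def)
  have "x + t *\<^sub>R w + t *\<^sub>R v = x + t *\<^sub>R v + t *\<^sub>R w" by (simp add: ac_simps)
  then have "\<bar>t\<^sup>2 * Lw v - t\<^sup>2 * Lv w\<bar> \<le> 2 * (e * t\<^sup>2)"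
    using d1(2)[OF t(1,2)] d2(2)[OF t(1,3)] unfolding abs_le_iff by (simp only:) linarith
  then have "t\<^sup>2 * \<bar>Lw v - Lv w\<bar> \<le> t\<^sup>2 * (2 * e)"
    by (simp only: abs_mult right_diff_distrib[symmetric]) (simp add: mult_ac)
  then have "\<bar>Lw v - Lv w\<bar> \<le> 2 * e" using t by simp
  then show False using e unfolding e_def by simp
qed

lemma second_derivative_symmetric:
  fixes f :: "'a::real_normed_vector \<Rightarrow> 'b::euclidean_space"
  assumes "open U" "x \<in> U"
    and f': "\<And>u. u \<in> U \<Longrightarrow> (f has_derivative f' u) (at u)"
    and Lw: "((\<lambda>u. f' u w) has_derivative Lw) (at x)"
    and Lv: "((\<lambda>u. f' u v) has_derivative Lv) (at x)"
  shows "Lw v = Lv w"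
proof (rule euclidean_eqI)
  fix b :: 'b
  show "Lw v \<bullet> b = Lv w \<bullet> b"
    by (rule second_derivative_symmetric_real[OF assms(1,2), of "\<lambda>u. f u \<bullet> b" "\<lambda>u z. f' u z \<bullet> b"
          w "\<lambda>z. Lw z \<bullet> b" v "\<lambda>z. Lv z \<bullet> b"])
      (use f' Lw Lv in \<open>auto intro: has_derivative_inner_left\<close>)
qed

lemma has_derivative_transform_nhds:
  assumes "eventually (\<lambda>y. f y = g y) (nhds x)" "(f has_derivative D) (at x)"
  shows "(g has_derivative D) (at x)"
proof (rule has_derivative_transform_eventually[OF assms(2)])
  show "eventually (\<lambda>y. f y = g y) (at x)"
    using assms(1) by (simp add: eventually_at_filter eventually_mono)
  show "f x = g x" using assms(1) by (rule eventually_nhds_x_imp_x)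
qed simp

subsection \<open>Charts\<close>

lemma chart_has_derivative:
  assumes "is_chart M \<phi> U W" "u \<in> U"
  shows "(\<phi> has_derivative frechet_derivative \<phi> (at u)) (at u)"
proof -
  have "Ck_on (Suc 0) \<phi> U" using assms unfolding is_chart_def smooth_on_def by blast
  then show ?thesis using assms(2) frechet_derivative_works by auto
qed

lemma chart_openin:
  assumes c: "is_chart M \<phi> U W" and "open T" "T \<subseteq> U"
  shows "openin (top_of_set M) (\<phi> ` T)"
proof -
  obtain \<psi> where h: "homeomorphism U (M \<inter> W) \<phi> \<psi>" and "open W"
    using c unfolding is_chart_def by blast
  have "openin (top_of_set U) T" using assms(2,3) by (simp add: open_openin_trans openin_open_eq c[unfolded is_chart_def])
  then have "openin (top_of_set (M \<inter> W)) (\<phi> ` T)"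
    using homeomorphism_imp_open_map[OF h] by blast
  moreover have "openin (top_of_set M) (M \<inter> W)" using \<open>open W\<close> by blast
  ultimately show ?thesis by (rule openin_trans)
qed

text \<open>Images of balls in chart domains are relatively open, so \<open>F\<close> is locally
  constant. Every quantity found constant in charts becomes a global constant through this lemma:
  the shape coefficients, the null directions, the relation between the Busemann functions, the
  transformation L.\<close>

lemma zero_derivative_in_charts_imp_constant:
  fixes F :: "pt \<Rightarrow> 'b::real_normed_vector"
  assumes M: "hypersurface M" "connected M"
    and F: "\<And>\<phi> U W u. is_chart M \<phi> U W \<Longrightarrow> u \<in> U \<Longrightarrow> ((\<lambda>u. F (\<phi> u)) has_derivative (\<lambda>w. 0)) (at u)"
    and "x \<in> M" "y \<in> M"
  shows "F x = F y"
proof -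
  have "F constant_on M"
  proof (rule locally_constant_imp_constant[OF M(2)])
    fix x assume x: "x \<in> M"
    obtain \<phi> U W where c: "is_chart M \<phi> U W" and "x \<in> W" using M(1) x unfolding hypersurface_def by blast
    then obtain u where u: "u \<in> U" "\<phi> u = x" using x unfolding is_chart_def homeomorphism_def by blast
    obtain r where r: "r > 0" "ball u r \<subseteq> U" using c u(1) open_contains_ball unfolding is_chart_def by blast
    have "\<exists>k. \<forall>v\<in>ball u r. F (\<phi> v) = k"
      by (rule has_derivative_zero_constant[where f = "\<lambda>u. F (\<phi> u)"])
        (use r in \<open>auto intro!: has_derivative_at_withinI F[OF c]\<close>)
    then have "\<forall>y\<in>\<phi> ` ball u r. F y = F x" using u(2) r(1) by force
    then show "\<exists>T. openin (top_of_set M) T \<and> x \<in> T \<and> (\<forall>y\<in>T. F y = F x)"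
      using chart_openin[OF c open_ball r(2)] u r(1) by (intro exI[of _ "\<phi> ` ball u r"]) auto
  qed
  then show ?thesis using assms(4,5) by (metis constant_on_def)
qed

text \<open>\<open>shape_op\<close> differentiates within \<open>M\<close>, so charts have to be
  inverted there. The injective derivative has a linear left inverse, and this is the derivative of
  \<psi> because \<psi> is continuous.\<close>

lemma chart_inverse_has_derivative:
  assumes c: "is_chart M \<phi> U W" and u: "u \<in> U"
  obtains \<psi> B where "(\<psi> has_derivative B) (at (\<phi> u) within M)" "B \<circ> frechet_derivative \<phi> (at u) = id"
    "\<And>y. y \<in> M \<Longrightarrow> y \<in> W \<Longrightarrow> \<psi> y \<in> U \<and> \<phi> (\<psi> y) = y" "\<psi> (\<phi> u) = u"
proof -
  obtain \<psi> where h: "homeomorphism U (M \<inter> W) \<phi> \<psi>" and "open W" "open U"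
    and inj: "inj (frechet_derivative \<phi> (at u))"
    using c u unfolding is_chart_def by blast
  note d = chart_has_derivative[OF c u]
  obtain B where B: "linear B" "B \<circ> frechet_derivative \<phi> (at u) = id"
    using linear_injective_left_inverse[OF has_derivative_linear[OF d] inj] by blast
  have im: "\<phi> ` U = M \<inter> W" using h by (rule homeomorphism_image1)
  have "(\<psi> has_derivative B) (at (\<phi> u) within \<phi> ` U)"
  proof (rule has_derivative_inverse_within[OF has_derivative_at_withinI[OF d] _ u B])
    show "continuous (at (\<phi> u) within \<phi> ` U) \<psi>"
      using homeomorphism_cont2[OF h] u im by (metis continuous_on_eq_continuous_within image_eqI)
    show "\<And>x. x \<in> U \<Longrightarrow> \<psi> (\<phi> x) = x" using homeomorphism_apply1[OF h] .
  qed
  moreover have "at (\<phi> u) within \<phi> ` U = at (\<phi> u) within M"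
    unfolding im using \<open>open W\<close> u im by (intro at_within_nhd[of _ W]) auto
  ultimately show thesis
    using that B(2) homeomorphism_apply1[OF h u] homeomorphism_apply2[OF h] homeomorphism_image2[OF h] by force
qed

text \<open>\<open>tangent_space\<close> collects vectors from all charts through the point. Near it
  another chart factors as \<open>\<phi> \<circ> \<psi> \<circ> \<phi>2\<close>, so the chain rule
  puts the range of its derivative inside that of \<phi>.\<close>

lemma tangent_space_chart:
  assumes c: "is_chart M \<phi> U W" and u: "u \<in> U"
  shows "tangent_space M (\<phi> u) = range (frechet_derivative \<phi> (at u))"
proof
  show "range (frechet_derivative \<phi> (at u)) \<subseteq> tangent_space M (\<phi> u)"
    using assms unfolding tangent_space_def by blast
  show "tangent_space M (\<phi> u) \<subseteq> range (frechet_derivative \<phi> (at u))"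
  proof
    fix v assume "v \<in> tangent_space M (\<phi> u)"
    then obtain \<phi>2 U2 W2 u2 w where c2: "is_chart M \<phi>2 U2 W2" and u2: "u2 \<in> U2" "\<phi>2 u2 = \<phi> u"
      and v: "v = frechet_derivative \<phi>2 (at u2) w" unfolding tangent_space_def by blast
    obtain \<psi> B where \<psi>: "(\<psi> has_derivative B) (at (\<phi> u) within M)"
      "\<And>y. y \<in> M \<Longrightarrow> y \<in> W \<Longrightarrow> \<psi> y \<in> U \<and> \<phi> (\<psi> y) = y" "\<psi> (\<phi> u) = u"
      using chart_inverse_has_derivative[OF c u] by blast
    note d2 = chart_has_derivative[OF c2 u2(1)]
    have "\<phi>2 ` U2 \<subseteq> M" "open U2" using c2 unfolding is_chart_def homeomorphism_def by auto
    have "\<phi> u \<in> W" "open W" using c u unfolding is_chart_def homeomorphism_def by auto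
    have "((\<lambda>y. \<psi> (\<phi>2 y)) has_derivative (\<lambda>w. B (frechet_derivative \<phi>2 (at u2) w))) (at u2 within U2)"
      using \<psi>(1) u2 \<open>\<phi>2 ` U2 \<subseteq> M\<close>
      by (intro has_derivative_in_compose[where f = \<phi>2 and g = \<psi>] has_derivative_at_withinI[OF d2])
        (simp add: has_derivative_subset)
    then have "((\<lambda>y. \<phi> (\<psi> (\<phi>2 y))) has_derivative (\<lambda>w. frechet_derivative \<phi> (at u) (B (frechet_derivative \<phi>2 (at u2) w)))) (at u2 within U2)"
      by (rule has_derivative_compose) (use chart_has_derivative[OF c u] u2 \<psi>(3) in simp)
    then have D: "((\<lambda>y. \<phi> (\<psi> (\<phi>2 y))) has_derivative (\<lambda>w. frechet_derivative \<phi> (at u) (B (frechet_derivative \<phi>2 (at u2) w)))) (at u2)"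
      by (simp add: at_within_open[OF u2(1) \<open>open U2\<close>])
    have "continuous (at u2) \<phi>2" using d2 by (rule has_derivative_continuous)
    then have "eventually (\<lambda>y. \<phi>2 y \<in> W) (nhds u2)"
      using \<open>open W\<close> \<open>\<phi> u \<in> W\<close> u2(2) by (simp add: continuous_at_open eventually_nhds)
    moreover have "eventually (\<lambda>y. y \<in> U2) (nhds u2)"
      using \<open>open U2\<close> u2 eventually_nhds_in_open by blast
    ultimately have "eventually (\<lambda>y. \<phi> (\<psi> (\<phi>2 y)) = \<phi>2 y) (nhds u2)"
      by eventually_elim (use \<psi>(2) \<open>\<phi>2 ` U2 \<subseteq> M\<close> in blast)
    then have "(\<phi>2 has_derivative (\<lambda>w. frechet_derivative \<phi> (at u) (B (frechet_derivative \<phi>2 (at u2) w)))) (at u2)"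
      using D by (rule has_derivative_transform_nhds)
    then have "frechet_derivative \<phi>2 (at u2) = (\<lambda>w. frechet_derivative \<phi> (at u) (B (frechet_derivative \<phi>2 (at u2) w)))"
      by (metis frechet_derivative_at)
    then show "v \<in> range (frechet_derivative \<phi> (at u))" unfolding v by (metis rangeI)
  qed
qed

text \<open>A derivative within \<open>M\<close> is determined only on tangent vectors, and
  \<open>frechet_derivative\<close> picks one of many. Factoring \<open>F\<close> locally as
  \<open>(F \<circ> \<phi>) \<circ> \<psi>\<close> gives existence; composing with \<phi> gives the
  forced values.\<close>

lemma frechet_derivative_within_chart:
  fixes F :: "pt \<Rightarrow> pt"
  assumes c: "is_chart M \<phi> U W" and u: "u \<in> U"
    and G: "((F \<circ> \<phi>) has_derivative G) (at u)"
  shows "frechet_derivative F (at (\<phi> u) within M) (frechet_derivative \<phi> (at u) w) = G w"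
proof -
  have "\<phi> ` U \<subseteq> M" "open U" "open W" "\<phi> u \<in> W" using c u unfolding is_chart_def homeomorphism_def by auto
  obtain \<psi> B where \<psi>: "(\<psi> has_derivative B) (at (\<phi> u) within M)"
      "\<And>y. y \<in> M \<Longrightarrow> y \<in> W \<Longrightarrow> \<psi> y \<in> U \<and> \<phi> (\<psi> y) = y" "\<psi> (\<phi> u) = u"
    using chart_inverse_has_derivative[OF c u] by blast
  have G2: "(F \<circ> \<phi> has_derivative G) (at (\<psi> (\<phi> u)))" using G \<psi>(3) by simp
  have "((\<lambda>y. (F \<circ> \<phi>) (\<psi> y)) has_derivative (\<lambda>v. G (B v))) (at (\<phi> u) within M)"
    by (rule has_derivative_compose[OF \<psi>(1) G2])
  moreover have "\<forall>\<^sub>F y in at (\<phi> u) within M. (F \<circ> \<phi>) (\<psi> y) = F y"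
    unfolding eventually_at_topological using \<open>open W\<close> \<open>\<phi> u \<in> W\<close> \<psi>(2) by (intro exI[of _ W]) auto
  moreover have "(F \<circ> \<phi>) (\<psi> (\<phi> u)) = F (\<phi> u)" by (simp add: \<psi>(3))
  moreover have "\<phi> u \<in> M" using \<open>\<phi> ` U \<subseteq> M\<close> u by auto
  ultimately have "(F has_derivative (\<lambda>v. G (B v))) (at (\<phi> u) within M)"
    using has_derivative_transform_eventually by blast
  then have "F differentiable (at (\<phi> u) within M)" by (auto simp: differentiable_def)
  then have "(F has_derivative frechet_derivative F (at (\<phi> u) within M)) (at (\<phi> u) within M)"
    using frechet_derivative_works by blast
  then have "((\<lambda>y. F (\<phi> y)) has_derivative (\<lambda>w. frechet_derivative F (at (\<phi> u) within M) (frechet_derivative \<phi> (at u) w))) (at u within U)"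
    using \<open>\<phi> ` U \<subseteq> M\<close>
    by (intro has_derivative_in_compose[where f = \<phi> and g = F] has_derivative_at_withinI[OF chart_has_derivative[OF c u]])
      (simp add: has_derivative_subset)
  then have "((F \<circ> \<phi>) has_derivative (\<lambda>w. frechet_derivative F (at (\<phi> u) within M) (frechet_derivative \<phi> (at u) w))) (at u)"
    by (simp add: at_within_open[OF u \<open>open U\<close>] comp_def)
  from has_derivative_unique[OF this G] show ?thesis by meson
qed

subsection \<open>Lorentzian linear algebra\<close>

text \<open>Lorentzian cross product: \<open>lor (lcross x y) z\<close> is the determinant of
  \<open>x\<close>, \<open>y\<close>, \<open>z\<close>, which explains the sign of the first
  component.\<close>

definition lcross :: "real^3 \<Rightarrow> real^3 \<Rightarrow> real^3" where
  "lcross x y = vec3 (x$3 * y$2 - x$2 * y$3) (x$3 * y$1 - x$1 * y$3) (x$1 * y$2 - x$2 * y$1)"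

lemma vec3_nth [simp]: "vec3 a b c $ 1 = a" "vec3 a b c $ 2 = b" "vec3 a b c $ 3 = c"
  by (simp_all add: vec3_def)

lemma lor_bounded_bilinear: "bounded_bilinear lor"
  by (simp add: bilinear_conv_bounded_bilinear[symmetric] bilinear_def linear_iff lor_def algebra_simps)

lemma lcross_bounded_bilinear: "bounded_bilinear lcross"
  by (simp add: bilinear_conv_bounded_bilinear[symmetric] bilinear_def linear_iff lcross_def vec_eq_iff
      forall_3 algebra_simps)

interpretation lor: bounded_bilinear lor by (rule lor_bounded_bilinear)
interpretation lcross: bounded_bilinear lcross by (rule lcross_bounded_bilinear)

lemmas lor_simps = lor.add_left lor.add_right lor.diff_left lor.diff_right lor.minus_left lor.minus_right
  lor.scaleR_left lor.scaleR_right lor.zero_left lor.zero_right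

lemma lor_commute: "lor x y = lor y x"
  by (simp add: lor_def)

lemma lor_lcross_self [simp]: "lor (lcross x y) x = 0" "lor (lcross x y) y = 0"
  "lor x (lcross x y) = 0" "lor y (lcross x y) = 0"
  by (simp_all add: lor_def lcross_def algebra_simps)

lemma lcross_lcross: "lcross (lcross x y) z = lor y z *\<^sub>R x - lor x z *\<^sub>R y"
  by (simp add: lor_def lcross_def vec_eq_iff forall_3 algebra_simps)

lemma lcross_commute: "lcross x y = - lcross y x"
  by (simp add: lcross_def vec_eq_iff forall_3)

lemma lor_lcross_lcross: "lor (lcross x y) (lcross z w) = lor x w * lor y z - lor x z * lor y w"
  by (simp add: lor_def lcross_def algebra_simps)

text \<open>The orthogonal complement of a timelike vector is positive definite, by Cauchy-Schwarz
  in the two spacelike coordinates. Hence \<open>f = 0\<close> forces \<open>m = 0\<close>, the only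
  way in which a frame can degenerate.\<close>

lemma lorentz_nonneg:
  assumes "lor p p = -1" "lor p m = 0"
  shows "lor m m \<ge> 0" and "lor m m = 0 \<Longrightarrow> m = 0"
proof -
  have p: "(p$1)\<^sup>2 = 1 + (p$2)\<^sup>2 + (p$3)\<^sup>2" and pm: "p$1 * m$1 = p$2 * m$2 + p$3 * m$3"
    using assms by (auto simp: lor_def power2_eq_square)
  have cs: "(p$2 * m$2 + p$3 * m$3)\<^sup>2 \<le> ((p$2)\<^sup>2 + (p$3)\<^sup>2) * ((m$2)\<^sup>2 + (m$3)\<^sup>2)"
    using zero_le_power2[of "p$2 * m$3 - p$3 * m$2"] by (simp add: power2_eq_square algebra_simps)
  have key: "(p$1)\<^sup>2 * (m$1)\<^sup>2 \<le> ((p$1)\<^sup>2 - 1) * ((m$2)\<^sup>2 + (m$3)\<^sup>2)"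
    using cs unfolding pm[symmetric] by (simp add: p power_mult_distrib)
  have lm: "lor m m = - (m$1)\<^sup>2 + ((m$2)\<^sup>2 + (m$3)\<^sup>2)" by (simp add: lor_def power2_eq_square)
  have p0: "(p$1)\<^sup>2 \<ge> 1" using p by (simp add: add_nonneg_nonneg)
  have *: "m = 0" if "lor m m \<le> 0"
  proof -
    have "(m$2)\<^sup>2 + (m$3)\<^sup>2 \<le> (m$1)\<^sup>2" using that lm by simp
    then have "((p$1)\<^sup>2 - 1) * ((m$2)\<^sup>2 + (m$3)\<^sup>2) \<le> ((p$1)\<^sup>2 - 1) * (m$1)\<^sup>2"
      using p0 by (intro mult_left_mono) auto
    with key have "(m$1)\<^sup>2 \<le> 0" by (simp only: left_diff_distrib)
    then have "m$1 = 0" by simp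
    then have "(m$2)\<^sup>2 + (m$3)\<^sup>2 \<le> 0" using that lm by simp
    then have "m$2 = 0" "m$3 = 0"
      by (smt (verit) zero_le_power2 power2_less_eq_zero_iff)+
    with \<open>m$1 = 0\<close> show ?thesis by (simp add: vec_eq_iff forall_3)
  qed
  show "lor m m \<ge> 0" using * by (metis linorder_le_cases lor.zero_left)
  show "lor m m = 0 \<Longrightarrow> m = 0" using * by simp
qed

lemma lorentz_frame:
  assumes "lor p p = -1" "lor p m = 0"
  shows "lor (lcross p m) (lcross p m) = lor m m"
    and "lcross (lcross p m) m = lor m m *\<^sub>R p"
    and "lcross p (lcross p m) = - m"
  using assms by (simp_all add: lor_lcross_lcross lcross_lcross lcross_commute[of p "lcross p m"] lor_commute[of m p])

text \<open>Triple product expansion of \<open>lcross (lcross e v) e\<close> with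
  \<open>e = lcross p m\<close>. Multiplying by \<open>lor m m\<close> rather than dividing keeps
  the formula true for \<open>m = 0\<close>.\<close>

lemma lorentz_expand:
  assumes "lor p p = -1" "lor p m = 0"
  shows "lor m m *\<^sub>R v = - (lor m m * lor p v) *\<^sub>R p + lor m v *\<^sub>R m + lor (lcross p m) v *\<^sub>R lcross p m"
proof -
  let ?e = "lcross p m"
  have 1: "lcross (lcross ?e v) ?e = lor v ?e *\<^sub>R ?e - lor ?e ?e *\<^sub>R v" by (rule lcross_lcross)
  have 2: "lcross ?e v = lor m v *\<^sub>R p - lor p v *\<^sub>R m" by (rule lcross_lcross)
  have 3: "lcross m ?e = - (lor m m *\<^sub>R p)" by (subst lcross_commute) (simp add: lorentz_frame(2)[OF assms])
  show ?thesis
    using 1 unfolding 2 lcross.diff_left lcross.scaleR_left 3 lorentz_frame(1,3)[OF assms]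
    by (simp add: algebra_simps lor_commute[of v])
qed

lemma lorentz_parseval:
  assumes "lor p p = -1" "lor p m = 0"
  shows "lor m m * lor v w = - lor m m * lor p v * lor p w + lor m v * lor m w
      + lor (lcross p m) v * lor (lcross p m) w"
  using arg_cong[OF lorentz_expand[OF assms, of v], of "\<lambda>y. lor y w"] by (simp add: lor_simps)

section \<open>The upper sheet of the hyperboloid and isometries given by orthonormal frames\<close>

lemma H2_lor_le:
  assumes "x \<in> H2" "y \<in> H2"
  shows "lor x y \<le> -1"
proof -
  have x: "(x$1)\<^sup>2 = 1 + ((x$2)\<^sup>2 + (x$3)\<^sup>2)" "x$1 > 0" and y: "(y$1)\<^sup>2 = 1 + ((y$2)\<^sup>2 + (y$3)\<^sup>2)" "y$1 > 0"
    using assms by (auto simp: H2_def lor_def power2_eq_square)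
  let ?s = "x$2 * y$2 + x$3 * y$3"
  have "(1 + ?s)\<^sup>2 \<le> (1 + ((x$2)\<^sup>2 + (x$3)\<^sup>2)) * (1 + ((y$2)\<^sup>2 + (y$3)\<^sup>2))"
    using zero_le_power2[of "x$2 * y$3 - x$3 * y$2"] zero_le_power2[of "x$2 - y$2"] zero_le_power2[of "x$3 - y$3"]
    by (simp add: power2_eq_square algebra_simps)
  also have "\<dots> = (x$1 * y$1)\<^sup>2" by (simp add: x y power_mult_distrib)
  finally have "1 + ?s \<le> x$1 * y$1" using x(2) y(2) power2_le_imp_le[of "1 + ?s" "x$1 * y$1"] by simp
  then show ?thesis by (simp add: lor_def)
qed

lemma H2_if_lor_neg:
  assumes "x \<in> H2" "lor y y = -1" "lor x y < 0"
  shows "y \<in> H2"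
proof (rule ccontr)
  assume n: "y \<notin> H2"
  have "y$1 \<noteq> 0" using assms(2) by (auto simp: lor_def) (smt (verit) zero_le_square)
  with n assms(2) have "- y \<in> H2" by (auto simp: H2_def lor_simps)
  from H2_lor_le[OF assms(1) this] assms(3) show False by (simp add: lor_simps)
qed

text \<open>Coordinates in the frame \<open>p\<close>, \<open>lcross p m\<close>, \<open>m\<close>:
  \<open>p\<close> goes to (1, 0, 0) and a unit vector \<open>m\<close> to (0, 0, 1), which are
  \<open>gam 0\<close> and \<open>Nvec 0\<close>. The sign \<epsilon> switches the orientation, as
  the tube case requires.\<close>

definition frame_map :: "real \<Rightarrow> real^3 \<Rightarrow> real^3 \<Rightarrow> real^3 \<Rightarrow> real^3" where
  "frame_map \<epsilon> p m y = vec3 (- lor p y) (\<epsilon> * lor (lcross p m) y) (lor m y)"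

lemma frame_map_linear: "linear (frame_map \<epsilon> p m)"
  by (simp add: linear_iff frame_map_def vec_eq_iff forall_3 lor_simps algebra_simps)

lemma frame_map_lor:
  assumes "lor p p = -1" "lor p m = 0" "lor m m = 1" "\<epsilon>\<^sup>2 = 1"
  shows "lor (frame_map \<epsilon> p m x) (frame_map \<epsilon> p m y) = lor x y"
proof -
  have "\<epsilon> * \<epsilon> = 1" using assms(4) by (simp add: power2_eq_square)
  then have "(\<epsilon> * s) * (\<epsilon> * t) = s * t" for s t :: real
    by (metis mult.assoc mult.left_commute mult.right_neutral)
  then show ?thesis
    using lorentz_parseval[OF assms(1,2), of x y]
    unfolding lor_def[of "frame_map \<epsilon> p m x"] by (simp add: frame_map_def assms)
qed

lemma frame_map_bij:
  assumes "p \<in> H2" "lor p m = 0" "lor m m = 1" "\<epsilon>\<^sup>2 = 1"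
  shows "bij_betw (frame_map \<epsilon> p m) H2 H2"
proof -
  have pp: "lor p p = -1" using assms by (simp add: H2_def)
  note L = frame_map_lor[OF pp assms(2-4)]
  have inj: "inj (frame_map \<epsilon> p m)"
  proof (rule linear_injective_0[THEN iffD2, OF frame_map_linear, rule_format])
    fix x assume "frame_map \<epsilon> p m x = 0"
    then have "lor x y = 0" for y using L[of x y] by (simp add: lor_simps)
    from this[of "vec3 1 0 0"] this[of "vec3 0 1 0"] this[of "vec3 0 0 1"]
    show "x = 0" by (simp add: lor_def vec_eq_iff forall_3)
  qed
  then have surj: "surj (frame_map \<epsilon> p m)" by (rule linear_injective_imp_surjective[OF frame_map_linear]) simp
  have "frame_map \<epsilon> p m ` H2 = H2"
  proof
    show "frame_map \<epsilon> p m ` H2 \<subseteq> H2"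
      using L H2_lor_le[OF assms(1)] by (force simp: H2_def frame_map_def)
    show "H2 \<subseteq> frame_map \<epsilon> p m ` H2"
    proof
      fix y assume y: "y \<in> H2"
      obtain x where x: "y = frame_map \<epsilon> p m x" using surj by blast
      have "lor p x < 0" using y by (simp add: x H2_def frame_map_def)
      moreover have "lor x x = -1" using y L[of x x] by (simp add: x H2_def)
      ultimately show "y \<in> frame_map \<epsilon> p m ` H2" using H2_if_lor_neg[OF assms(1)] x by blast
    qed
  qed
  then show ?thesis using inj by (auto simp: bij_betw_def intro: inj_on_subset)
qed

lemma isometry_map_prod:
  assumes "bij_betw F H2 H2" "bij_betw G H2 H2" "\<And>x y. lor (F x) (F y) = lor x y" "\<And>x y. lor (G x) (G y) = lor x y"
  shows "isometry_HH (map_prod F G)"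
  unfolding isometry_HH_def HH_def pdist_def hdist_def
  using assms by (auto intro: bij_betw_map_prod)

subsection \<open>Moving frames\<close>

definition C2_map :: "'a::real_normed_vector set \<Rightarrow> ('a \<Rightarrow> 'b::real_normed_vector) \<Rightarrow> ('a \<Rightarrow> 'a \<Rightarrow> 'b) \<Rightarrow> bool" where
  "C2_map U f f' \<longleftrightarrow> open U \<and> (\<forall>u\<in>U. (f has_derivative f' u) (at u)) \<and>
     (\<forall>u\<in>U. \<forall>w. (\<lambda>v. f' v w) differentiable (at u))"

text \<open>\<open>D w z\<close> differentiates the form \<open>lor (Y _) (X' _ w)\<close> in
  direction \<open>z\<close>. The second derivatives of \<open>X\<close> are symmetric and drop out
  of the antisymmetrisation, leaving the wedge of dY with dX; every structure equation is an
  instance.\<close>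

lemma lor_form_derivative:
  assumes X: "C2_map U X X'" and u: "u \<in> U" and Y: "(Y has_derivative Y') (at u)"
  shows "\<exists>D. (\<forall>w. ((\<lambda>v. lor (Y v) (X' v w)) has_derivative D w) (at u)) \<and>
    (\<forall>z w. D w z - D z w = lor (Y' z) (X' u w) - lor (Y' w) (X' u z))"
proof -
  have "\<forall>w. \<exists>L. ((\<lambda>v. X' v w) has_derivative L) (at u)"
    using X u by (auto simp: C2_map_def differentiable_def)
  then obtain L where L: "\<And>w. ((\<lambda>v. X' v w) has_derivative L w) (at u)" by metis
  have sym: "L w z = L z w" for w z
    by (rule second_derivative_symmetric[OF _ u _ L L, of X]) (use X in \<open>auto simp: C2_map_def\<close>)
  show ?thesis
    by (rule exI[of _ "\<lambda>w z. lor (Y u) (L w z) + lor (Y' z) (X' u w)"])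
      (auto simp: sym intro!: lor.FDERIV Y L)
qed

text \<open>\<open>m\<close> is one factor of a unit normal and may vanish, so neither it nor
  \<open>e\<close> is normalised. \<open>om\<close> and \<open>be\<close> are the components of dp
  along \<open>m\<close> and \<open>e\<close>, \<open>ka\<close> is the connection form scaled by
  \<open>f\<close>, and \<open>nu\<close> is half of df.\<close>

locale moving_frame =
  fixes U :: "(real^3) set" and p :: "real^3 \<Rightarrow> real^3" and p' and m :: "real^3 \<Rightarrow> real^3" and m'
  assumes p_C2: "C2_map U p p'" and m_C2: "C2_map U m m'"
    and pp: "u \<in> U \<Longrightarrow> lor (p u) (p u) = -1" and pm: "u \<in> U \<Longrightarrow> lor (p u) (m u) = 0"
begin

definition "e u = lcross (p u) (m u)"
definition "f u = lor (m u) (m u)"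
definition "om u w = lor (m u) (p' u w)"
definition "be u w = lor (e u) (p' u w)"
definition "ka u w = lor (e u) (m' u w)"
definition "nu u w = lor (m u) (m' u w)"

lemma open_U: "open U" using p_C2 by (simp add: C2_map_def)

lemma p_deriv: "u \<in> U \<Longrightarrow> (p has_derivative p' u) (at u)"
  and m_deriv: "u \<in> U \<Longrightarrow> (m has_derivative m' u) (at u)"
  using p_C2 m_C2 by (auto simp: C2_map_def)

lemma p'_linear: "u \<in> U \<Longrightarrow> linear (p' u)" and m'_linear: "u \<in> U \<Longrightarrow> linear (m' u)"
  using p_deriv m_deriv has_derivative_linear by blast+

lemma constant_derivative_0:
  assumes "u \<in> U" "(F has_derivative D) (at u)" "\<And>v. v \<in> U \<Longrightarrow> F v = c"
  shows "D w = 0"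
proof -
  have "(F has_derivative (\<lambda>w. 0)) (at u)"
    by (rule has_derivative_transform_within_open[OF has_derivative_const[of c] open_U assms(1)]) (simp add: assms)
  from has_derivative_unique[OF assms(2) this] show ?thesis by meson
qed

lemma lor_p_p': assumes "u \<in> U" shows "lor (p u) (p' u w) = 0"
  using constant_derivative_0[OF assms lor.FDERIV[OF p_deriv[OF assms] p_deriv[OF assms]] pp, of w]
  by (simp add: lor_commute)

lemma lor_p_m': assumes "u \<in> U" shows "lor (p u) (m' u w) = - om u w"
  using constant_derivative_0[OF assms lor.FDERIV[OF p_deriv[OF assms] m_deriv[OF assms]] pm, of w]
  by (simp add: lor_commute om_def)

lemma f_deriv: assumes "u \<in> U" shows "(f has_derivative (\<lambda>w. 2 * nu u w)) (at u)"
  using lor.FDERIV[OF m_deriv[OF assms] m_deriv[OF assms]]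
  by (simp add: f_def[abs_def] nu_def lor_commute)

lemma e_deriv0: assumes "u \<in> U"
  shows "(e has_derivative (\<lambda>w. lcross (p u) (m' u w) + lcross (p' u w) (m u))) (at u)"
  unfolding e_def[abs_def] by (rule lcross.FDERIV[OF p_deriv[OF assms] m_deriv[OF assms]])

lemma frame_products:
  assumes "u \<in> U"
  shows "lor (e u) (e u) = f u" "lor (p u) (e u) = 0" "lor (m u) (e u) = 0" "lor (e u) (p u) = 0" "lor (e u) (m u) = 0"
    "lor (m u) (p u) = 0"
  using lorentz_frame(1)[OF pp[OF assms] pm[OF assms]] pm[OF assms]
  by (simp_all add: e_def f_def lor_commute[of "m u" "p u"])

lemma p'_expand: assumes "u \<in> U" shows "f u *\<^sub>R p' u w = om u w *\<^sub>R m u + be u w *\<^sub>R e u"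
  using lorentz_expand[OF pp[OF assms] pm[OF assms], of "p' u w"]
  by (simp add: lor_p_p'[OF assms] f_def om_def be_def e_def)

lemma m'_expand: assumes "u \<in> U" shows "f u *\<^sub>R m' u w = (f u * om u w) *\<^sub>R p u + nu u w *\<^sub>R m u + ka u w *\<^sub>R e u"
  using lorentz_expand[OF pp[OF assms] pm[OF assms], of "m' u w"]
  by (simp add: lor_p_m'[OF assms] f_def nu_def ka_def e_def)

lemma e'_expand: assumes "u \<in> U"
  shows "f u *\<^sub>R (lcross (p u) (m' u w) + lcross (p' u w) (m u))
    = (f u * be u w) *\<^sub>R p u - ka u w *\<^sub>R m u + nu u w *\<^sub>R e u"
proof -
  have "f u *\<^sub>R (lcross (p u) (m' u w) + lcross (p' u w) (m u))
    = lcross (p u) (f u *\<^sub>R m' u w) + lcross (f u *\<^sub>R p' u w) (m u)"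
    by (simp add: lcross.scaleR_left lcross.scaleR_right scaleR_add_right)
  also have "\<dots> = nu u w *\<^sub>R lcross (p u) (m u) + ka u w *\<^sub>R lcross (p u) (e u) + be u w *\<^sub>R lcross (e u) (m u)"
  proof -
    have "lcross x x = 0" for x by (simp add: lcross_def vec_eq_iff forall_3)
    then show ?thesis unfolding p'_expand[OF assms] m'_expand[OF assms]
      by (simp add: lcross.scaleR_left lcross.scaleR_right lcross.add_left lcross.add_right)
  qed
  also have "\<dots> = (f u * be u w) *\<^sub>R p u - ka u w *\<^sub>R m u + nu u w *\<^sub>R e u"
    using lorentz_frame(2,3)[OF pp[OF assms] pm[OF assms]] by (simp add: e_def f_def)
  finally show ?thesis .
qed

text \<open>Cartan's structure equations: \<open>D w z - D z w\<close> is the exterior derivative of the form, evaluated at \<open>(z, w)\<close>.\<close>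

lemma om_derivative:
  assumes u: "u \<in> U" and f: "f u \<noteq> 0"
  shows "\<exists>D. (\<forall>w. ((\<lambda>v. om v w) has_derivative D w) (at u)) \<and>
    (\<forall>z w. f u * (D w z - D z w) = ka u z * be u w - ka u w * be u z + nu u z * om u w - nu u w * om u z)"
proof -
  obtain D where D: "\<And>w. ((\<lambda>v. lor (m v) (p' v w)) has_derivative D w) (at u)"
    and A: "\<And>z w. D w z - D z w = lor (m' u z) (p' u w) - lor (m' u w) (p' u z)"
    using lor_form_derivative[OF p_C2 u m_deriv[OF u]] by blast
  have "f u * lor (m' u z) (p' u w) = nu u z * om u w + ka u z * be u w" for z w
    using arg_cong[OF m'_expand[OF u, of z], of "\<lambda>x. lor x (p' u w)"]
    by (simp add: lor_simps lor_p_p'[OF u] om_def be_def)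
  then have "f u * (D w z - D z w) = ka u z * be u w - ka u w * be u z + nu u z * om u w - nu u w * om u z" for z w
    unfolding A right_diff_distrib by simp
  then show ?thesis using D unfolding om_def by blast
qed

lemma be_derivative:
  assumes u: "u \<in> U" and f: "f u \<noteq> 0"
  shows "\<exists>D. (\<forall>w. ((\<lambda>v. be v w) has_derivative D w) (at u)) \<and>
    (\<forall>z w. f u * (D w z - D z w) = om u z * ka u w - om u w * ka u z + nu u z * be u w - nu u w * be u z)"
proof -
  obtain D where D: "\<And>w. ((\<lambda>v. lor (e v) (p' v w)) has_derivative D w) (at u)"
    and A: "\<And>z w. D w z - D z w = lor (lcross (p u) (m' u z) + lcross (p' u z) (m u)) (p' u w)
        - lor (lcross (p u) (m' u w) + lcross (p' u w) (m u)) (p' u z)"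
    using lor_form_derivative[OF p_C2 u e_deriv0[OF u]] by blast
  have "f u * lor (lcross (p u) (m' u z) + lcross (p' u z) (m u)) (p' u w) = - ka u z * om u w + nu u z * be u w" for z w
    using arg_cong[OF e'_expand[OF u, of z], of "\<lambda>x. lor x (p' u w)"]
    by (simp only: lor_simps lor_p_p'[OF u] om_def[symmetric] be_def[symmetric]) simp
  then have "f u * (D w z - D z w) = om u z * ka u w - om u w * ka u z + nu u z * be u w - nu u w * be u z" for z w
    unfolding A right_diff_distrib by simp
  then show ?thesis using D unfolding be_def by blast
qed

text \<open>The wedge of \<open>om\<close> and \<open>be\<close> is the Gauss equation: here the
  curvature -1 of the hyperbolic plane enters, through the \<open>p\<close> components of de and dm.
  The factor 2 at \<open>nu\<close> is df, because \<open>ka\<close> is \<open>f\<close> times the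
  normalised connection form.\<close>

lemma ka_derivative:
  assumes u: "u \<in> U" and f: "f u \<noteq> 0"
  shows "\<exists>D. (\<forall>w. ((\<lambda>v. ka v w) has_derivative D w) (at u)) \<and>
    (\<forall>z w. f u * (D w z - D z w) = f u * (om u z * be u w - om u w * be u z) + 2 * (nu u z * ka u w - nu u w * ka u z))"
proof -
  obtain D where D: "\<And>w. ((\<lambda>v. lor (e v) (m' v w)) has_derivative D w) (at u)"
    and A: "\<And>z w. D w z - D z w = lor (lcross (p u) (m' u z) + lcross (p' u z) (m u)) (m' u w)
        - lor (lcross (p u) (m' u w) + lcross (p' u w) (m u)) (m' u z)"
    using lor_form_derivative[OF m_C2 u e_deriv0[OF u]] by blast
  have H: "f u * lor (lcross (p u) (m' u z) + lcross (p' u z) (m u)) (m' u w)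
      = - f u * be u z * om u w - ka u z * nu u w + nu u z * ka u w" for z w
    using arg_cong[OF e'_expand[OF u, of z], of "\<lambda>x. lor x (m' u w)"]
    by (simp only: lor_simps lor_p_m'[OF u] nu_def[symmetric] ka_def[symmetric]) simp
  have "f u * (D w z - D z w)
      = f u * (om u z * be u w - om u w * be u z) + 2 * (nu u z * ka u w - nu u w * ka u z)" for z w
    unfolding A right_diff_distrib H by (simp add: algebra_simps)
  then show ?thesis using D unfolding ka_def by blast
qed

end

subsection \<open>The second fundamental form in a chart\<close>

lemma finite_range_imp_locally_constant:
  fixes h :: "'a::t2_space \<Rightarrow> 'b::metric_space"
  assumes "isCont h x" "finite K" "eventually (\<lambda>y. h y \<in> K) (nhds x)"
  shows "eventually (\<lambda>y. h y = h x) (nhds x)"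
proof -
  have "open (- (K - {h x}))" using assms(2) by (intro open_Compl finite_imp_closed) auto
  moreover have "(h \<longlongrightarrow> h x) (nhds x)" using assms(1) by (simp add: continuous_at tendsto_nhds_iff)
  ultimately have "eventually (\<lambda>y. h y \<in> - (K - {h x})) (nhds x)"
    by (intro topological_tendstoD[of h "h x" "nhds x"]) auto
  with assms(3) show ?thesis by eventually_elim auto
qed

text \<open>An eigenvalue is known only pointwise as an element of \<open>K\<close>; as a quotient
  of differentiable functions it is continuous, and so locally constant.\<close>

lemma quotient_locally_constant:
  fixes h1 h2 :: "'a::real_normed_vector \<Rightarrow> real"
  assumes "finite K" "h1 differentiable (at u)" "h2 differentiable (at u)" "h2 u \<noteq> 0"
    and "eventually (\<lambda>v. \<exists>k\<in>K. h1 v = k * h2 v) (nhds u)"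
  shows "eventually (\<lambda>v. h1 v = (h1 u / h2 u) * h2 v \<and> h2 v \<noteq> 0) (nhds u)"
proof -
  have c: "isCont h1 u" "isCont h2 u" using assms(2,3) differentiable_imp_continuous_within by blast+
  then have "(h2 \<longlongrightarrow> h2 u) (nhds u)" by (simp add: continuous_at tendsto_nhds_iff)
  then have nz: "eventually (\<lambda>v. h2 v \<noteq> 0) (nhds u)" using assms(4) by (rule tendsto_imp_eventually_ne)
  have "eventually (\<lambda>v. h1 v / h2 v \<in> K) (nhds u)"
    using assms(5) nz by eventually_elim auto
  then have "eventually (\<lambda>v. h1 v / h2 v = h1 u / h2 u) (nhds u)"
    by (intro finite_range_imp_locally_constant[where K = K]) (use c assms(1,4) in \<open>auto intro: continuous_divide\<close>)
  with nz show ?thesis by eventually_elim (simp add: field_simps)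
qed

lemma derivative_unique_on_open:
  assumes "open T" "u \<in> T" "\<And>v. v \<in> T \<Longrightarrow> h v = h' v"
    "(h has_derivative D) (at u)" "(h' has_derivative D') (at u)"
  shows "D z = D' z"
proof -
  have "(h has_derivative D') (at u)"
    by (rule has_derivative_transform_within_open[OF assms(5,1,2)]) (simp add: assms(3))
  from has_derivative_unique[OF assms(4) this] show ?thesis by simp
qed

text \<open>
  In a chart \<open>(p, q)\<close> of the hypersurface the unit normal is \<open>(m, n)\<close>. The frame vectors
  \<open>F.e = p \<times> m\<close> and \<open>G.e = q \<times> n\<close> (Lorentzian cross products) are not normalised: their squared
  lengths are \<open>F.f = \<langle>m, m\<rangle>\<close> and \<open>G.f = \<langle>n, n\<rangle>\<close>. The shape operator maps \<open>(F.e, 0)\<close> to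
  \<open>a (F.e, 0) + F.f B (0, G.e)\<close> and \<open>(0, G.e)\<close> to \<open>G.f B (F.e, 0) + d (0, G.e)\<close>.
\<close>

locale hyper_chart = F: moving_frame U p p' m m' + G: moving_frame U q q' n n'
  for U p p' m m' q q' n n' +
  fixes k1 k2 k3 :: real and a B d :: "real^3 \<Rightarrow> real"
  assumes unit: "u \<in> U \<Longrightarrow> F.f u + G.f u = 1"
    and tang: "u \<in> U \<Longrightarrow> F.om u w + G.om u w = 0"
    and inj: "u \<in> U \<Longrightarrow> p' u w = 0 \<Longrightarrow> q' u w = 0 \<Longrightarrow> w = 0"
    and distinct: "k1 \<noteq> k2" "k1 \<noteq> k3" "k2 \<noteq> k3"
    and eig: "u \<in> U \<Longrightarrow> k \<in> {k1, k2, k3} \<longleftrightarrow> (\<exists>w. w \<noteq> 0 \<and>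
      F.om u w *\<^sub>R p u - m' u w = k *\<^sub>R p' u w \<and> G.om u w *\<^sub>R q u - n' u w = k *\<^sub>R q' u w)"
    and V_principal: "u \<in> U \<Longrightarrow> p' u w = (2 * G.f u) *\<^sub>R m u \<Longrightarrow> q' u w = - (2 * F.f u) *\<^sub>R n u \<Longrightarrow>
      \<exists>\<mu>. F.om u w *\<^sub>R p u - m' u w = \<mu> *\<^sub>R p' u w \<and> G.om u w *\<^sub>R q u - n' u w = \<mu> *\<^sub>R q' u w"
    and aB: "u \<in> U \<Longrightarrow> p' u w = F.e u \<Longrightarrow> q' u w = 0 \<Longrightarrow>
      F.ka u w = - F.f u * a u \<and> G.ka u w = - F.f u * G.f u * B u"
    and dd: "u \<in> U \<Longrightarrow> p' u w = 0 \<Longrightarrow> q' u w = G.e u \<Longrightarrow> G.ka u w = - G.f u * d u"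
begin

abbreviation "f \<equiv> F.f" abbreviation "g \<equiv> G.f"
abbreviation "om \<equiv> F.om" abbreviation "be \<equiv> F.be" abbreviation "xi \<equiv> G.be"

lemma G_om: "u \<in> U \<Longrightarrow> G.om u w = - om u w"
  using tang[of u w] by linarith

lemma G_nu: assumes u: "u \<in> U" shows "G.nu u w = - F.nu u w"
proof -
  have "2 * F.nu u w + 2 * G.nu u w = 0"
    by (rule F.constant_derivative_0[OF u has_derivative_add[OF F.f_deriv[OF u] G.f_deriv[OF u]] unit])
  then show ?thesis by simp
qed

lemma f_nonneg: "u \<in> U \<Longrightarrow> 0 \<le> f u" and g_nonneg: "u \<in> U \<Longrightarrow> 0 \<le> g u"
  unfolding F.f_def G.f_def using lorentz_nonneg(1) F.pp F.pm G.pp G.pm by blast+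

lemma form_linear:
  assumes "u \<in> U"
  shows "linear (om u)" "linear (be u)" "linear (xi u)" "linear (F.ka u)" "linear (G.ka u)" "linear (F.nu u)"
  using F.p'_linear[OF assms] F.m'_linear[OF assms] G.p'_linear[OF assms] G.m'_linear[OF assms]
  by (simp_all add: linear_iff F.om_def F.be_def G.be_def F.ka_def G.ka_def F.nu_def lor_simps)

text \<open>Coordinate vectors dual to the coframe \<open>om\<close>, \<open>be\<close>,
  \<open>xi\<close>. Where \<open>f\<close> and \<open>g\<close> are positive, the chart maps them
  to V / (2 f g), \<open>(F.e, 0)\<close> / f and \<open>(0, G.e)\<close> / g.\<close>

definition dual_basis :: "real^3 \<Rightarrow> real^3 \<Rightarrow> real^3 \<Rightarrow> real^3 \<Rightarrow> bool" where
  "dual_basis u z0 z2 z3 \<longleftrightarrow> om u z0 = 1 \<and> be u z0 = 0 \<and> xi u z0 = 0 \<and> om u z2 = 0 \<and> be u z2 = 1 \<and> xi u z2 = 0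
    \<and> om u z3 = 0 \<and> be u z3 = 0 \<and> xi u z3 = 1"

lemma coframe_injective:
  assumes u: "u \<in> U" "f u > 0" "g u > 0" and "om u w = 0" "be u w = 0" "xi u w = 0"
  shows "w = 0"
  using F.p'_expand[OF u(1), of w] G.p'_expand[OF u(1), of w] assms G_om[OF u(1), of w] inj by simp

lemma dual_basis_exists:
  assumes u: "u \<in> U" "f u > 0" "g u > 0"
  obtains z0 z2 z3 where "dual_basis u z0 z2 z3"
proof -
  let ?T = "\<lambda>w. vec3 (om u w) (be u w) (xi u w)"
  note lin = form_linear[OF u(1)]
  have T: "linear ?T"
    using lin by (simp add: linear_iff vec_eq_iff forall_3)
  have "w = 0" if "?T w = 0" for w
    using that coframe_injective[OF u, of w] by (simp add: vec_eq_iff forall_3)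
  then have injT: "inj ?T" using linear_injective_0[OF T] by blast
  then have surj: "surj ?T" by (rule linear_injective_imp_surjective[OF T]) simp
  obtain z0 where "vec3 1 0 0 = ?T z0" using surj by (rule surjE)
  moreover obtain z2 where "vec3 0 1 0 = ?T z2" using surj by (rule surjE)
  moreover obtain z3 where "vec3 0 0 1 = ?T z3" using surj by (rule surjE)
  ultimately show thesis using that[of z0 z2 z3] by (simp add: dual_basis_def vec_eq_iff forall_3)
qed

lemma expand_in_dual_basis:
  assumes u: "u \<in> U" "f u > 0" "g u > 0" and h: "linear h" and z: "dual_basis u z0 z2 z3"
  shows "h w = om u w *\<^sub>R h z0 + be u w *\<^sub>R h z2 + xi u w *\<^sub>R h z3"
proof -
  note lin = form_linear[OF u(1)]
  have "w - (om u w *\<^sub>R z0 + be u w *\<^sub>R z2 + xi u w *\<^sub>R z3) = 0"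
    by (rule coframe_injective[OF u]) (use z in \<open>simp_all add: dual_basis_def
      linear_diff[OF lin(1)] linear_diff[OF lin(2)] linear_diff[OF lin(3)]
      linear_add[OF lin(1)] linear_add[OF lin(2)] linear_add[OF lin(3)]
      linear_cmul[OF lin(1)] linear_cmul[OF lin(2)] linear_cmul[OF lin(3)]\<close>)
  then have "h w = h (om u w *\<^sub>R z0 + be u w *\<^sub>R z2 + xi u w *\<^sub>R z3)" by simp
  then show ?thesis by (simp add: linear_add[OF h] linear_cmul[OF h])
qed

text \<open>The form \<open>om + G.om\<close> pairs the unit normal with tangent vectors, hence is
  zero. Its exterior derivative, computed from the structure equations of both factors, is the
  symmetry of the second fundamental form.\<close>

lemma shape_symmetric:
  assumes u: "u \<in> U" "f u > 0" "g u > 0"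
  shows "g u * (F.ka u z * be u w - F.ka u w * be u z) + f u * (G.ka u z * xi u w - G.ka u w * xi u z)
    + (F.nu u z * om u w - F.nu u w * om u z) = 0"
proof -
  obtain D where D: "\<And>w. ((\<lambda>v. om v w) has_derivative D w) (at u)"
    and DA: "\<And>z w. f u * (D w z - D z w) = F.ka u z * be u w - F.ka u w * be u z + F.nu u z * om u w - F.nu u w * om u z"
    using F.om_derivative u by (metis less_irrefl)
  obtain E where E: "\<And>w. ((\<lambda>v. G.om v w) has_derivative E w) (at u)"
    and EA: "\<And>z w. g u * (E w z - E z w) = G.ka u z * xi u w - G.ka u w * xi u z + G.nu u z * G.om u w - G.nu u w * G.om u z"
    using G.om_derivative u by (metis less_irrefl)
  have "D w z + E w z = 0" for w z
    by (rule F.constant_derivative_0[OF u(1) has_derivative_add[OF D E] tang])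
  then have ED: "E w z = - D w z" for w z by (simp add: eq_neg_iff_add_eq_0 add.commute)
  have 1: "g u * (f u * (D w z - D z w)) + f u * (g u * (E w z - E z w)) = 0" by (simp add: ED algebra_simps)
  have "F.nu u z * om u w - F.nu u w * om u z = (f u + g u) * (F.nu u z * om u w - F.nu u w * om u z)"
    using unit[OF u(1)] by simp
  then show ?thesis using 1 unfolding DA EA G_om[OF u(1)] G_nu[OF u(1)] by (simp add: algebra_simps)
qed

definition has_mu :: "real^3 \<Rightarrow> real \<Rightarrow> bool" where
  "has_mu u \<mu> \<longleftrightarrow> (\<forall>w. F.nu u w = - \<mu> * om u w)"

lemma shape_structure:
  assumes u: "u \<in> U" "f u > 0" "g u > 0"
  shows "\<exists>\<mu>. has_mu u \<mu>"
    and "F.ka u w = - (a u * be u w + B u * f u * xi u w)"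
    and "G.ka u w = - (B u * g u * be u w + d u * xi u w)"
proof -
  obtain z0 z2 z3 where z: "dual_basis u z0 z2 z3" using dual_basis_exists[OF u] .
  note lin = form_linear[OF u(1)]
  note zz = z[unfolded dual_basis_def]
  have zw: "p' u z0 = (1 / f u) *\<^sub>R m u" "q' u z0 = - (1 / g u) *\<^sub>R n u"
    "p' u z2 = (1 / f u) *\<^sub>R F.e u" "q' u z2 = 0" "p' u z3 = 0" "q' u z3 = (1 / g u) *\<^sub>R G.e u"
  proof -
    have scale: "x = (1 / c) *\<^sub>R y" if "c *\<^sub>R x = y" "c > 0" for x y :: "real^3" and c :: real
      using that by auto
    have P: "p' u w = (1 / f u) *\<^sub>R (om u w *\<^sub>R m u + be u w *\<^sub>R F.e u)" for w
      by (rule scale[OF F.p'_expand[OF u(1)] u(2)])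
    have Q: "q' u w = (1 / g u) *\<^sub>R (- om u w *\<^sub>R n u + xi u w *\<^sub>R G.e u)" for w
      using scale[OF G.p'_expand[OF u(1), of w] u(3)] G_om[OF u(1), of w] by simp
    show "p' u z0 = (1 / f u) *\<^sub>R m u" "p' u z2 = (1 / f u) *\<^sub>R F.e u" "p' u z3 = 0"
      unfolding P using zz by simp_all
    show "q' u z0 = - (1 / g u) *\<^sub>R n u" "q' u z2 = 0" "q' u z3 = (1 / g u) *\<^sub>R G.e u"
      unfolding Q using zz by simp_all
  qed
  note pl = F.p'_linear[OF u(1)] G.p'_linear[OF u(1)]
  \<comment> \<open>\<open>(2 * f u * g u) *\<^sub>R z0\<close> is the coordinate vector of V, to
    which \<open>V_principal\<close> applies. Pairing the result with \<open>F.e\<close> and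
    \<open>G.e\<close> kills both connection forms on \<open>z0\<close>.\<close>
  obtain \<mu> where mu: "om u (( 2 * f u * g u) *\<^sub>R z0) *\<^sub>R p u - m' u ((2 * f u * g u) *\<^sub>R z0) = \<mu> *\<^sub>R p' u ((2 * f u * g u) *\<^sub>R z0)"
     "G.om u ((2 * f u * g u) *\<^sub>R z0) *\<^sub>R q u - n' u ((2 * f u * g u) *\<^sub>R z0) = \<mu> *\<^sub>R q' u ((2 * f u * g u) *\<^sub>R z0)"
    using V_principal[OF u(1), of "(2 * f u * g u) *\<^sub>R z0"] u
    by (auto simp: linear_cmul[OF pl(1)] linear_cmul[OF pl(2)] zw)
  have c: "2 * f u * g u \<noteq> 0" using u by simp
  have "F.ka u ((2 * f u * g u) *\<^sub>R z0) = 0"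
    using arg_cong[OF mu(1), of "lor (F.e u)"]
    by (simp add: lor_simps linear_cmul[OF pl(1)] zw F.frame_products[OF u(1)] F.ka_def)
  then have k0: "F.ka u z0 = 0" using c by (simp add: linear_cmul[OF lin(4)])
  have "G.ka u ((2 * f u * g u) *\<^sub>R z0) = 0"
    using arg_cong[OF mu(2), of "lor (G.e u)"]
    by (simp add: lor_simps linear_cmul[OF pl(2)] zw G.frame_products[OF u(1)] G.ka_def)
  then have k0': "G.ka u z0 = 0" using c by (simp add: linear_cmul[OF lin(5)])
  have n2: "F.nu u z2 = 0" using shape_symmetric[OF u, of z0 z2] zz k0 k0' by simp
  have n3: "F.nu u z3 = 0" using shape_symmetric[OF u, of z0 z3] zz k0 k0' by simp
  have nu: "F.nu u w = om u w * F.nu u z0" for w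
    using expand_in_dual_basis[OF u lin(6) z, of w] n2 n3 by simp
  have "has_mu u (- F.nu u z0)" unfolding has_mu_def minus_minus by (rule allI, subst nu, rule mult.commute)
  then show "\<exists>\<mu>. has_mu u \<mu>" ..
  have "F.ka u (f u *\<^sub>R z2) = - f u * a u \<and> G.ka u (f u *\<^sub>R z2) = - f u * g u * B u"
    by (rule aB[OF u(1)]) (use u in \<open>simp_all add: linear_cmul[OF pl(1)] linear_cmul[OF pl(2)] zw\<close>)
  then have "f u * F.ka u z2 = f u * (- a u)" "f u * G.ka u z2 = f u * (- g u * B u)"
    by (simp_all add: linear_cmul[OF lin(4)] linear_cmul[OF lin(5)] mult.assoc)
  then have k2: "F.ka u z2 = - a u" "G.ka u z2 = - g u * B u" using u by (simp_all only: mult_cancel_left) simp_all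
  have "G.ka u (g u *\<^sub>R z3) = - g u * d u"
    by (rule dd[OF u(1)]) (use u in \<open>simp_all add: linear_cmul[OF pl(1)] linear_cmul[OF pl(2)] zw\<close>)
  then have "g u * G.ka u z3 = g u * (- d u)" by (simp add: linear_cmul[OF lin(5)])
  then have k3: "G.ka u z3 = - d u" using u by (simp only: mult_cancel_left) simp
  \<comment> \<open>Symmetry on \<open>(z2, z3)\<close> determines the other off-diagonal entry, so
    that a single coefficient \<open>B\<close> serves both connection forms.\<close>
  have "g u * F.ka u z3 = f u * G.ka u z2" using shape_symmetric[OF u, of z2 z3] zz n2 n3 by simp
  then have "g u * F.ka u z3 = g u * (- f u * B u)" using k2 by simp
  then have k3': "F.ka u z3 = - f u * B u" using u by (simp only: mult_cancel_left) simp
  show "F.ka u w = - (a u * be u w + B u * f u * xi u w)"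
    using expand_in_dual_basis[OF u lin(4) z, of w] k0 k2 k3' by (simp add: algebra_simps)
  show "G.ka u w = - (B u * g u * be u w + d u * xi u w)"
    using expand_in_dual_basis[OF u lin(5) z, of w] k0' k2 k3 by (simp add: algebra_simps)
qed

text \<open>In the frame the shape operator is a block matrix: \<mu> on V, and rows
  \<open>(a, f B)\<close>, \<open>(g B, d)\<close> acting on the pair \<open>(be, xi)\<close>. The V
  component shows up in both factors, with the same condition on \<open>om\<close>.\<close>

lemma shape_eigen_iff:
  assumes u: "u \<in> U" "f u > 0" "g u > 0" and mu: "has_mu u \<mu>"
  shows "(om u w *\<^sub>R p u - m' u w = k *\<^sub>R p' u w \<and> G.om u w *\<^sub>R q u - n' u w = k *\<^sub>R q' u w) \<longleftrightarrow>
    (\<mu> - k) * om u w = 0 \<and> a u * be u w + B u * f u * xi u w = k * be u w \<and> B u * g u * be u w + d u * xi u w = k * xi u w"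
    (is "?L1 \<and> ?L2 \<longleftrightarrow> _")
proof -
  have c: "f u \<noteq> 0" "g u \<noteq> 0" using u by auto
  have cancel: "x = y \<longleftrightarrow> s *\<^sub>R x = s *\<^sub>R y" if "s \<noteq> 0" for s :: real and x y :: "real^3" using that by simp
  have comb: "\<alpha> *\<^sub>R m u + \<beta> *\<^sub>R F.e u = 0 \<longleftrightarrow> \<alpha> = 0 \<and> \<beta> = 0" for \<alpha> \<beta>
  proof
    assume "\<alpha> *\<^sub>R m u + \<beta> *\<^sub>R F.e u = 0"
    from arg_cong[OF this, of "lor (m u)"] arg_cong[OF this, of "lor (F.e u)"]
    show "\<alpha> = 0 \<and> \<beta> = 0" using c by (simp add: lor_simps F.frame_products[OF u(1)] F.f_def[symmetric])
  qed simp
  have comb': "\<alpha> *\<^sub>R n u + \<beta> *\<^sub>R G.e u = 0 \<longleftrightarrow> \<alpha> = 0 \<and> \<beta> = 0" for \<alpha> \<beta>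
  proof
    assume "\<alpha> *\<^sub>R n u + \<beta> *\<^sub>R G.e u = 0"
    from arg_cong[OF this, of "lor (n u)"] arg_cong[OF this, of "lor (G.e u)"]
    show "\<alpha> = 0 \<and> \<beta> = 0" using c by (simp add: lor_simps G.frame_products[OF u(1)] G.f_def[symmetric])
  qed simp
  have "?L1 \<longleftrightarrow> f u *\<^sub>R (om u w *\<^sub>R p u - m' u w) = k *\<^sub>R (f u *\<^sub>R p' u w)"
    using c by (subst cancel[OF c(1)]) (simp add: mult.commute)
  also have "\<dots> \<longleftrightarrow> (- F.nu u w - k * om u w) *\<^sub>R m u + (- F.ka u w - k * be u w) *\<^sub>R F.e u = 0"
    unfolding scaleR_diff_right F.m'_expand[OF u(1)] F.p'_expand[OF u(1)] by (simp add: algebra_simps)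
  also have "\<dots> \<longleftrightarrow> (\<mu> - k) * om u w = 0 \<and> a u * be u w + B u * f u * xi u w = k * be u w"
    unfolding comb using shape_structure(2)[OF u, of w] mu by (simp add: has_mu_def left_diff_distrib add.commute)
  finally have 1: "?L1 \<longleftrightarrow> (\<mu> - k) * om u w = 0 \<and> a u * be u w + B u * f u * xi u w = k * be u w" .
  have "?L2 \<longleftrightarrow> g u *\<^sub>R (G.om u w *\<^sub>R q u - n' u w) = k *\<^sub>R (g u *\<^sub>R q' u w)"
    using c by (subst cancel[OF c(2)]) (simp add: mult.commute)
  also have "\<dots> \<longleftrightarrow> (- G.nu u w - k * G.om u w) *\<^sub>R n u + (- G.ka u w - k * xi u w) *\<^sub>R G.e u = 0"
    unfolding scaleR_diff_right G.m'_expand[OF u(1)] G.p'_expand[OF u(1)] by (simp add: algebra_simps)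
  also have "\<dots> \<longleftrightarrow> (\<mu> - k) * om u w = 0 \<and> B u * g u * be u w + d u * xi u w = k * xi u w"
    unfolding comb' using shape_structure(3)[OF u, of w] mu
    by (auto simp: has_mu_def left_diff_distrib G_om[OF u(1)] G_nu[OF u(1)] add.commute)
  finally show ?thesis using 1 by blast
qed

text \<open>Two of the prescribed curvatures differ from \<mu> and are distinct roots of the
  characteristic polynomial of the block, so Vieta gives its trace and determinant. The conclusions
  are symmetric in \<open>k1\<close>, \<open>k2\<close>, \<open>k3\<close> because it is not known
  which of them \<mu> is.\<close>

lemma characteristic_polynomial:
  assumes u: "u \<in> U" "f u > 0" "g u > 0" and mu: "has_mu u \<mu>"
  shows "\<mu> \<in> {k1, k2, k3}"
    and "a u + d u + \<mu> = k1 + k2 + k3"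
    and "\<mu> * (a u + d u) + (a u * d u - f u * g u * (B u)\<^sup>2) = k1 * k2 + k1 * k3 + k2 * k3"
proof -
  obtain z0 z2 z3 where z: "dual_basis u z0 z2 z3" using dual_basis_exists[OF u] .
  have z00: "z0 \<noteq> 0" using z linear_0[OF form_linear(1)[OF u(1)]] by (auto simp: dual_basis_def)
  show K: "\<mu> \<in> {k1, k2, k3}"
    unfolding eig[OF u(1)] shape_eigen_iff[OF u mu] using z00 z by (auto simp: dual_basis_def)
  have root: "(a u - k) * (d u - k) = f u * g u * (B u)\<^sup>2" if k: "k \<in> {k1,k2,k3}" "k \<noteq> \<mu>" for k
  proof -
    obtain w where w: "w \<noteq> 0" and e: "(\<mu> - k) * om u w = 0" "a u * be u w + B u * f u * xi u w = k * be u w"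
       "B u * g u * be u w + d u * xi u w = k * xi u w"
      using k(1) unfolding eig[OF u(1)] shape_eigen_iff[OF u mu] by blast
    have nz: "be u w \<noteq> 0 \<or> xi u w \<noteq> 0" using coframe_injective[OF u] w e(1) k(2) by auto
    have 1: "(a u - k) * be u w = - B u * f u * xi u w" and 2: "(d u - k) * xi u w = - B u * g u * be u w"
      using e by (simp_all add: algebra_simps)
    have "((a u - k) * (d u - k) - f u * g u * (B u)\<^sup>2) * be u w
       = (d u - k) * ((a u - k) * be u w + B u * f u * xi u w) - B u * f u * ((d u - k) * xi u w + B u * g u * be u w)"
      by (simp add: algebra_simps power2_eq_square)
    moreover have "((a u - k) * (d u - k) - f u * g u * (B u)\<^sup>2) * xi u w
       = (a u - k) * ((d u - k) * xi u w + B u * g u * be u w) - B u * g u * ((a u - k) * be u w + B u * f u * xi u w)"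
      by (simp add: algebra_simps power2_eq_square)
    ultimately show ?thesis using nz unfolding 1 2 by auto
  qed
  define S where "S = a u + d u"
  define P where "P = a u * d u - f u * g u * (B u)\<^sup>2"
  have vieta: "S = x + y" "P = x * y"
    if "x \<noteq> y" "x \<in> {k1,k2,k3}" "y \<in> {k1,k2,k3}" "x \<noteq> \<mu>" "y \<noteq> \<mu>" for x y
  proof -
    have rx: "x * x - S * x + P = 0" and ry: "y * y - S * y + P = 0"
      using root[of x] root[of y] that unfolding S_def P_def by (auto simp: algebra_simps)
    have "(x - y) * (x + y - S) = (x * x - S * x + P) - (y * y - S * y + P)" by (simp add: algebra_simps)
    then show s: "S = x + y" using that(1) rx ry by simp
    show "P = x * y" using rx unfolding s by (simp add: algebra_simps)
  qed
  from K consider "\<mu> = k1" "S = k2 + k3" "P = k2 * k3" | "\<mu> = k2" "S = k1 + k3" "P = k1 * k3"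
    | "\<mu> = k3" "S = k1 + k2" "P = k1 * k2"
    using vieta[of k2 k3] vieta[of k1 k3] vieta[of k1 k2] distinct by auto
  then have "S + \<mu> = k1 + k2 + k3 \<and> \<mu> * S + P = k1 * k2 + k1 * k3 + k2 * k3"
    by cases (simp_all add: algebra_simps)
  then show "a u + d u + \<mu> = k1 + k2 + k3"
    and "\<mu> * (a u + d u) + (a u * d u - f u * g u * (B u)\<^sup>2) = k1 * k2 + k1 * k3 + k2 * k3"
    unfolding S_def P_def by blast+
qed

lemma form_deriv_real:
  assumes "u \<in> U"
  shows "(\<lambda>v. om v w) differentiable (at u)" "(\<lambda>v. be v w) differentiable (at u)" "(\<lambda>v. xi v w) differentiable (at u)"
    "(\<lambda>v. F.ka v w) differentiable (at u)" "(\<lambda>v. G.ka v w) differentiable (at u)" "(\<lambda>v. F.nu v w) differentiable (at u)"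
  using lor_form_derivative[OF F.p_C2 assms F.m_deriv[OF assms]] lor_form_derivative[OF F.p_C2 assms F.e_deriv0[OF assms]]
    lor_form_derivative[OF G.p_C2 assms G.e_deriv0[OF assms]] lor_form_derivative[OF F.m_C2 assms F.e_deriv0[OF assms]]
    lor_form_derivative[OF G.m_C2 assms G.e_deriv0[OF assms]] lor_form_derivative[OF F.m_C2 assms F.m_deriv[OF assms]]
  unfolding F.om_def F.be_def G.be_def F.ka_def G.ka_def F.nu_def differentiable_def by blast+

lemma eventually_generic:
  assumes "u \<in> U" "f u > 0" "g u > 0"
  shows "eventually (\<lambda>v. v \<in> U \<and> f v > 0 \<and> g v > 0) (nhds u)"
proof -
  have "isCont f u" "isCont g u" using F.f_deriv[OF assms(1)] G.f_deriv[OF assms(1)] has_derivative_continuous by blast+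
  then have "(f \<longlongrightarrow> f u) (nhds u)" "(g \<longlongrightarrow> g u) (nhds u)" by (simp_all add: continuous_at tendsto_nhds_iff)
  then have "eventually (\<lambda>v. f v > 0) (nhds u)" "eventually (\<lambda>v. g v > 0) (nhds u)"
    using assms(2,3) by (simp_all add: order_tendstoD)
  moreover have "eventually (\<lambda>v. v \<in> U) (nhds u)" using F.open_U assms(1) by (rule eventually_nhds_in_open)
  ultimately show ?thesis by eventually_elim simp
qed

lemma has_mu_locally:
  assumes u: "u \<in> U" "f u > 0" "g u > 0" and mu: "has_mu u \<mu>"
  shows "eventually (\<lambda>v. has_mu v \<mu>) (nhds u)"
proof -
  obtain z0 z2 z3 where z: "dual_basis u z0 z2 z3" using dual_basis_exists[OF u] .
  have o: "om u z0 = 1" using z by (simp add: dual_basis_def)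
  have ev: "eventually (\<lambda>v. \<exists>\<mu>\<in>{k1,k2,k3}. has_mu v \<mu>) (nhds u)"
    using eventually_generic[OF u]
    by eventually_elim (use shape_structure(1) characteristic_polynomial(1) in blast)
  \<comment> \<open>With \<open>z0\<close> frozen at \<open>u\<close>, the quotient of
    \<open>- F.nu v z0\<close> by \<open>om v z0\<close> is the eigenvalue at \<open>v\<close>:
    continuous, with values in \<open>{k1, k2, k3}\<close>.\<close>
  have "eventually (\<lambda>v. - F.nu v z0 = (- F.nu u z0 / om u z0) * om v z0 \<and> om v z0 \<noteq> 0) (nhds u)"
    by (rule quotient_locally_constant[where K = "{k1,k2,k3}"])
      (use form_deriv_real[OF u(1)] o ev in \<open>auto simp: has_mu_def elim!: eventually_mono\<close>)
  then show ?thesis using ev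
  proof eventually_elim
    case (elim v)
    then obtain \<mu>' where "has_mu v \<mu>'" by blast
    moreover have "- F.nu v z0 = \<mu> * om v z0" using elim mu o by (simp add: has_mu_def)
    ultimately have "\<mu>' = \<mu>" using elim by (simp add: has_mu_def)
    with \<open>has_mu v \<mu>'\<close> show ?case by simp
  qed
qed

text \<open>If \<open>\<mu> \<noteq> 0\<close>, then \<open>V\<close> is a multiple of the gradient of \<open>f\<close>, hence closed, which forces \<open>B = 0\<close>;
  the Codazzi equation then expresses \<open>f\<close> through the constants \<open>a\<close> and \<open>\<mu>\<close>.\<close>

lemma mu_eq_0:
  assumes u0: "u0 \<in> U" "f u0 > 0" "g u0 > 0" and mu: "has_mu u0 \<mu>"
  shows "\<mu> = 0"
proof (rule ccontr)
  assume "\<mu> \<noteq> 0"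
  obtain T where T: "open T" "u0 \<in> T" and TU: "\<And>v. v \<in> T \<Longrightarrow> v \<in> U \<and> f v > 0 \<and> g v > 0 \<and> has_mu v \<mu>"
    using eventually_conj[OF eventually_generic[OF u0] has_mu_locally[OF u0 mu]] unfolding eventually_nhds by blast
  have B0: "B u = 0" if "u \<in> T" for u
  proof -
    have u: "u \<in> U" "f u > 0" "g u > 0" "has_mu u \<mu>" using TU that by auto
    obtain z0 z2 z3 where z: "dual_basis u z0 z2 z3" using dual_basis_exists[OF u(1-3)] .
    obtain D where D: "\<And>w. ((\<lambda>v. om v w) has_derivative D w) (at u)"
      and DA: "\<And>z w. f u * (D w z - D z w) = F.ka u z * be u w - F.ka u w * be u z + F.nu u z * om u w - F.nu u w * om u z"
      using F.om_derivative u by (metis less_irrefl)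
    have fd: "(f has_derivative (\<lambda>w. - 2 * \<mu> * om v w)) (at v)" if "v \<in> T" for v
      using F.f_deriv[of v] TU[OF that] by (simp add: has_mu_def mult.assoc)
    have Dd: "((\<lambda>v. - 2 * \<mu> * om v w) has_derivative (\<lambda>z. - 2 * \<mu> * D w z)) (at u)" for w
      by (rule has_derivative_mult_right[OF D])
    \<comment> \<open>Up to the nonzero constant - 2 \<mu>, \<open>om\<close> is the differential of
      \<open>f\<close>. Its structure equation on \<open>(z2, z3)\<close> therefore leaves only
      \<open>F.ka u z3\<close>, which is \<open>- B u * f u\<close>.\<close>
    have "- 2 * \<mu> * D z2 z3 = - 2 * \<mu> * D z3 z2"
      by (rule second_derivative_symmetric_real[OF T(1) that fd Dd Dd])
    then have "D z3 z2 = D z2 z3" using \<open>\<mu> \<noteq> 0\<close> by simp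
    with DA[of z3 z2] have "F.ka u z3 = 0" using z by (simp add: dual_basis_def)
    then show ?thesis using shape_structure(2)[OF u(1-3), of z3] z u by (simp add: dual_basis_def)
  qed
  have ka: "F.ka u w = - a u * be u w" if "u \<in> T" for u w
    using shape_structure(2)[of u w] TU[OF that] B0[OF that] by simp
  have aK: "a u \<in> {k1,k2,k3}" if "u \<in> T" for u
  proof -
    have u: "u \<in> U" "f u > 0" "g u > 0" "has_mu u \<mu>" using TU that by auto
    obtain z0 z2 z3 where z: "dual_basis u z0 z2 z3" using dual_basis_exists[OF u(1-3)] .
    have "z2 \<noteq> 0" using z linear_0[OF form_linear(2)[OF u(1)]] by (auto simp: dual_basis_def)
    then show ?thesis
      unfolding eig[OF u(1)] shape_eigen_iff[OF u] using B0[OF that] z by (auto simp: dual_basis_def)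
  qed
  obtain z0 z2 z3 where z: "dual_basis u0 z0 z2 z3" using dual_basis_exists[OF u0] .
  have bz: "be u0 z2 = 1" using z by (simp add: dual_basis_def)
  have evT: "eventually (\<lambda>v. v \<in> T) (nhds u0)" using T by (rule eventually_nhds_in_open)
  have "eventually (\<lambda>v. - F.ka v z2 = (- F.ka u0 z2 / be u0 z2) * be v z2 \<and> be v z2 \<noteq> 0) (nhds u0)"
  proof (rule quotient_locally_constant[where K = "{k1,k2,k3}"])
    show "eventually (\<lambda>v. \<exists>k\<in>{k1,k2,k3}. - F.ka v z2 = k * be v z2) (nhds u0)"
      using evT
    proof eventually_elim
      case (elim v)
      show ?case by (rule bexI[OF _ aK[OF elim]]) (simp add: ka[OF elim])
    qed
  qed (use form_deriv_real[OF u0(1)] bz in auto)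
  then have "eventually (\<lambda>v. v \<in> T \<and> a v = a u0) (nhds u0)" using evT
    by eventually_elim (use ka T(2) bz in auto)
  then obtain T' where T': "open T'" "u0 \<in> T'" "\<And>v. v \<in> T' \<Longrightarrow> v \<in> T \<and> a v = a u0"
    unfolding eventually_nhds by blast
  have "f u = a u0 * a u0 - a u0 * \<mu>" if "u \<in> T'" for u
  proof -
    have u: "u \<in> U" "f u > 0" "g u > 0" "has_mu u \<mu>" and uT: "u \<in> T" "a u = a u0" using TU T'(3) that by auto
    obtain z0 z2 z3 where z: "dual_basis u z0 z2 z3" using dual_basis_exists[OF u(1-3)] .
    obtain D where D: "\<And>w. ((\<lambda>v. be v w) has_derivative D w) (at u)"
      and DA: "\<And>z w. f u * (D w z - D z w) = om u z * F.ka u w - om u w * F.ka u z + F.nu u z * be u w - F.nu u w * be u z"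
      using F.be_derivative u by (metis less_irrefl)
    obtain E where E: "\<And>w. ((\<lambda>v. F.ka v w) has_derivative E w) (at u)"
      and EA: "\<And>z w. f u * (E w z - E z w) = f u * (om u z * be u w - om u w * be u z) + 2 * (F.nu u z * F.ka u w - F.nu u w * F.ka u z)"
      using F.ka_derivative u by (metis less_irrefl)
    \<comment> \<open>As \<open>B = 0\<close> and \<open>a\<close> is constant, \<open>ka\<close> is
      a constant multiple of \<open>be\<close>. The structure equations give the exterior
      derivatives of both, and their comparison on \<open>(z0, z2)\<close> is a formula for
      \<open>f\<close>.\<close>
    have ED: "E w z = - a u0 * D w z" for w z
      by (rule derivative_unique_on_open[OF T'(1) that _ E has_derivative_mult_right[OF D]]) (use ka T'(3) in auto)
    have "f u * (E z2 z0 - E z0 z2) = - a u0 * (f u * (D z2 z0 - D z0 z2))"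
      unfolding ED by (simp add: algebra_simps)
    then show ?thesis
      unfolding DA EA using z ka[OF uT(1)] uT(2) u(4) by (simp add: dual_basis_def has_mu_def algebra_simps)
  qed
  then have "2 * F.nu u0 z0 = 0"
    using derivative_unique_on_open[OF T'(1,2) _ F.f_deriv[OF u0(1)] has_derivative_const] by blast
  then show False using mu z \<open>\<mu> \<noteq> 0\<close> by (simp add: has_mu_def dual_basis_def)
qed

text \<open>Points where \<open>f\<close> or \<open>g\<close> vanishes are not excluded yet. There
  \<open>m = 0\<close> or \<open>n = 0\<close>, so the pairing \<open>F.nu\<close> or
  \<open>G.nu\<close> with this vector is zero, and the two are opposite.\<close>

lemma nu_eq_0:
  assumes u: "u \<in> U" shows "F.nu u w = 0"
proof (cases "f u > 0 \<and> g u > 0")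
  case True
  then obtain \<mu> where "has_mu u \<mu>" using shape_structure(1) u by blast
  then show ?thesis using mu_eq_0[OF u] True by (simp add: has_mu_def)
next
  case False
  then consider "f u = 0" | "g u = 0" using f_nonneg[OF u] g_nonneg[OF u] by linarith
  then show ?thesis
  proof cases
    case 1
    then have "m u = 0" using lorentz_nonneg(2)[OF F.pp[OF u] F.pm[OF u]] by (simp add: F.f_def)
    then show ?thesis by (simp add: F.nu_def lor_simps)
  next
    case 2
    then have "n u = 0" using lorentz_nonneg(2)[OF G.pp[OF u] G.pm[OF u]] by (simp add: G.f_def)
    then have "G.nu u w = 0" by (simp add: G.nu_def lor_simps)
    then show ?thesis using G_nu[OF u, of w] by simp
  qed
qed

lemma f_derivative_0: "u \<in> U \<Longrightarrow> (f has_derivative (\<lambda>w. 0)) (at u)"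
  using F.f_deriv nu_eq_0 by fastforce

text \<open>The coefficients are given only pointwise. Cramer's rule on two vectors fixed at the
  base point expresses them through differentiable forms; the determinant \<open>Q\<close> is 1
  there and nonzero nearby.\<close>

lemma shape_coefficients_differentiable:
  assumes u: "u \<in> U" "f u > 0" "g u > 0"
  shows "a differentiable (at u)" "B differentiable (at u)" "d differentiable (at u)"
proof -
  obtain z0 z2 z3 where z: "dual_basis u z0 z2 z3" using dual_basis_exists[OF u] .
  define Q where "Q v = be v z2 * xi v z3 - be v z3 * xi v z2" for v
  have Qd: "Q differentiable (at u)"
    unfolding Q_def[abs_def] by (intro differentiable_diff differentiable_mult form_deriv_real[OF u(1)])
  have Q1: "Q u = 1" using z by (simp add: Q_def dual_basis_def)
  have "isCont Q u" using Qd differentiable_imp_continuous_within by blast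
  then have "(Q \<longlongrightarrow> Q u) (nhds u)" by (simp add: continuous_at tendsto_nhds_iff)
  then have "eventually (\<lambda>v. Q v \<noteq> 0) (nhds u)" by (rule tendsto_imp_eventually_ne) (simp add: Q1)
  with eventually_generic[OF u] have ev: "eventually (\<lambda>v. v \<in> U \<and> f v > 0 \<and> g v > 0 \<and> Q v \<noteq> 0) (nhds u)"
    by eventually_elim simp
  have fd: "f differentiable (at u)" using F.f_deriv[OF u(1)] by (auto simp: differentiable_def)
  have tr: "h differentiable (at u)" if "h' differentiable (at u)" "eventually (\<lambda>v. h' v = h v) (nhds u)"
    for h h' :: "real^3 \<Rightarrow> real"
    using that has_derivative_transform_nhds unfolding differentiable_def by blast
  have "eventually (\<lambda>v. (F.ka v z3 * xi v z2 - F.ka v z2 * xi v z3) / Q v = a v) (nhds u)"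
    using ev
  proof eventually_elim
    case (elim v)
    have "F.ka v z3 * xi v z2 - F.ka v z2 * xi v z3 = a v * Q v"
      unfolding Q_def shape_structure(2)[OF elim[THEN conjunct1] elim[THEN conjunct2, THEN conjunct1] elim[THEN conjunct2, THEN conjunct2, THEN conjunct1]]
      by (simp add: algebra_simps)
    then show ?case using elim by simp
  qed
  then show "a differentiable (at u)"
    by (rule tr[rotated]) (intro differentiable_divide differentiable_diff differentiable_mult form_deriv_real[OF u(1)] Qd, simp add: Q1)
  have "eventually (\<lambda>v. (F.ka v z2 * be v z3 - F.ka v z3 * be v z2) / (f v * Q v) = B v) (nhds u)"
    using ev
  proof eventually_elim
    case (elim v)
    have "F.ka v z2 * be v z3 - F.ka v z3 * be v z2 = B v * (f v * Q v)"
      unfolding Q_def shape_structure(2)[OF elim[THEN conjunct1] elim[THEN conjunct2, THEN conjunct1] elim[THEN conjunct2, THEN conjunct2, THEN conjunct1]]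
      by (simp add: algebra_simps)
    then show ?case using elim by simp
  qed
  then show "B differentiable (at u)"
    by (rule tr[rotated]) (intro differentiable_divide differentiable_diff differentiable_mult form_deriv_real[OF u(1)] Qd fd, use u in \<open>simp add: Q1\<close>)
  have "eventually (\<lambda>v. (G.ka v z2 * be v z3 - G.ka v z3 * be v z2) / Q v = d v) (nhds u)"
    using ev
  proof eventually_elim
    case (elim v)
    have "G.ka v z2 * be v z3 - G.ka v z3 * be v z2 = d v * Q v"
      unfolding Q_def shape_structure(3)[OF elim[THEN conjunct1] elim[THEN conjunct2, THEN conjunct1] elim[THEN conjunct2, THEN conjunct2, THEN conjunct1]]
      by (simp add: algebra_simps)
    then show ?case using elim by simp
  qed
  then show "d differentiable (at u)"
    by (rule tr[rotated]) (intro differentiable_divide differentiable_diff differentiable_mult form_deriv_real[OF u(1)] Qd, simp add: Q1)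
qed

end

subsection \<open>The Codazzi equations\<close>

locale hyper_chart_const = hyper_chart +
  fixes c h :: real
  assumes fc: "u \<in> U \<Longrightarrow> F.f u = c" and c: "0 < c" "0 < h" "c + h = 1"
begin

lemma gc: "u \<in> U \<Longrightarrow> g u = h"
  using unit[of u] fc[of u] c by linarith

lemma generic: "u \<in> U \<Longrightarrow> f u > 0" "u \<in> U \<Longrightarrow> g u > 0"
  using fc gc c by auto

lemma ka: "u \<in> U \<Longrightarrow> F.ka u w = - (a u * be u w + c * B u * xi u w)"
  and G_ka: "u \<in> U \<Longrightarrow> G.ka u w = - (h * B u * be u w + d u * xi u w)"
  using shape_structure(2,3)[of u w] generic[of u] fc[of u] gc[of u] by (simp_all add: mult_ac)

lemma G_nu_eq_0: "u \<in> U \<Longrightarrow> G.nu u w = 0"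
  using G_nu[of u w] nu_eq_0[of u w] by simp

text \<open>The expressions \<open>ka\<close> and \<open>G_ka\<close> of the connection forms
  through \<open>be\<close> and \<open>xi\<close> are differentiated and compared with the Gauss
  equations, which gives the identities \<open>C1\<close> and \<open>C2\<close> of 2-forms. On pairs
  containing \<open>z0\<close> they are Riccati type equations along V; on \<open>(z2, z3)\<close>
  they relate the derivatives inside the block.\<close>

lemma codazzi:
  assumes u: "u \<in> U" and a': "(a has_derivative a') (at u)" and B': "(B has_derivative B') (at u)"
    and d': "(d has_derivative d') (at u)" and z: "dual_basis u z0 z2 z3"
  shows "a' z0 = (a u)\<^sup>2 / c - c * (B u)\<^sup>2 - 1"
    and "B' z0 = B u * (a u / c - d u / h)"
    and "d' z0 = 1 + h * (B u)\<^sup>2 - (d u)\<^sup>2 / h"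
    and "a' z3 = c * B' z2" and "d' z2 = h * B' z3"
proof -
  have nz: "f u \<noteq> 0" "g u \<noteq> 0" using generic[OF u] by auto
  note zz = z[unfolded dual_basis_def]
  obtain D where D: "\<And>w. ((\<lambda>v. be v w) has_derivative D w) (at u)"
    and DA: "\<And>z w. f u * (D w z - D z w) = om u z * F.ka u w - om u w * F.ka u z + F.nu u z * be u w - F.nu u w * be u z"
    using F.be_derivative[OF u nz(1)] by blast
  obtain X where X: "\<And>w. ((\<lambda>v. xi v w) has_derivative X w) (at u)"
    and XA: "\<And>z w. g u * (X w z - X z w) = G.om u z * G.ka u w - G.om u w * G.ka u z + G.nu u z * xi u w - G.nu u w * xi u z"
    using G.be_derivative[OF u nz(2)] by blast
  obtain E where E: "\<And>w. ((\<lambda>v. F.ka v w) has_derivative E w) (at u)"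
    and EA: "\<And>z w. f u * (E w z - E z w) = f u * (om u z * be u w - om u w * be u z) + 2 * (F.nu u z * F.ka u w - F.nu u w * F.ka u z)"
    using F.ka_derivative[OF u nz(1)] by blast
  obtain H where H: "\<And>w. ((\<lambda>v. G.ka v w) has_derivative H w) (at u)"
    and HA: "\<And>z w. g u * (H w z - H z w) = g u * (G.om u z * xi u w - G.om u w * xi u z) + 2 * (G.nu u z * G.ka u w - G.nu u w * G.ka u z)"
    using G.ka_derivative[OF u nz(2)] by blast
  have ch: "c \<noteq> 0" "h \<noteq> 0" using c by auto
  have cancel: "x = y / s" if "s * x = y" "s \<noteq> 0" for s x y :: real using that by (simp add: field_simps)
  have DA': "D w z - D z w = (om u z * F.ka u w - om u w * F.ka u z) / c" for z w
    using cancel[OF DA nz(1)] by (simp add: nu_eq_0[OF u] fc[OF u])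
  have XA': "X w z - X z w = (om u w * G.ka u z - om u z * G.ka u w) / h" for z w
    using cancel[OF XA nz(2)] by (simp add: G_nu_eq_0[OF u] gc[OF u] G_om[OF u])
  have EA': "E w z - E z w = om u z * be u w - om u w * be u z" for z w
    using EA[of w z] nz by (simp add: nu_eq_0[OF u])
  have HA': "H w z - H z w = om u w * xi u z - om u z * xi u w" for z w
    using HA[of w z] nz by (simp add: G_nu_eq_0[OF u] G_om[OF u])
  have Ed: "((\<lambda>v. - (a v * be v w + c * B v * xi v w)) has_derivative
      (\<lambda>z. - (a u * D w z + a' z * be u w + (c * B u * X w z + c * B' z * xi u w)))) (at u)" for w
    by (intro has_derivative_minus has_derivative_add has_derivative_mult has_derivative_mult_right a' B' D X)
  have EE: "E w z = - (a u * D w z + a' z * be u w + (c * B u * X w z + c * B' z * xi u w))" for w z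
    by (rule derivative_unique_on_open[OF F.open_U u _ E Ed]) (simp add: ka)
  have Hd: "((\<lambda>v. - (h * B v * be v w + d v * xi v w)) has_derivative
      (\<lambda>z. - (h * B u * D w z + h * B' z * be u w + (d u * X w z + d' z * xi u w)))) (at u)" for w
    by (intro has_derivative_minus has_derivative_add has_derivative_mult has_derivative_mult_right d' B' D X)
  have HH: "H w z = - (h * B u * D w z + h * B' z * be u w + (d u * X w z + d' z * xi u w))" for w z
    by (rule derivative_unique_on_open[OF F.open_U u _ H Hd]) (simp add: G_ka)
  have C1: "om u w * be u z - om u z * be u w = a u * ((om u z * F.ka u w - om u w * F.ka u z) / c) + (a' z * be u w - a' w * be u z)
      + c * B u * ((om u w * G.ka u z - om u z * G.ka u w) / h) + c * (B' z * xi u w - B' w * xi u z)" for z w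
    using EA'[of w z] unfolding EE DA'[symmetric] XA'[symmetric] by (simp add: algebra_simps)
  have C2: "om u z * xi u w - om u w * xi u z = h * B u * ((om u z * F.ka u w - om u w * F.ka u z) / c) + h * (B' z * be u w - B' w * be u z)
      + d u * ((om u w * G.ka u z - om u z * G.ka u w) / h) + (d' z * xi u w - d' w * xi u z)" for z w
    using HA'[of w z] unfolding HH DA'[symmetric] XA'[symmetric] by (simp add: algebra_simps)
  have k: "F.ka u z2 = - a u" "F.ka u z3 = - (c * B u)" "F.ka u z0 = 0" "G.ka u z2 = - (h * B u)" "G.ka u z3 = - d u" "G.ka u z0 = 0"
    unfolding ka[OF u] G_ka[OF u] using zz by simp_all
  show "a' z0 = (a u)\<^sup>2 / c - c * (B u)\<^sup>2 - 1"
    using C1[where z = z0 and w = z2] zz k ch by (simp add: power2_eq_square)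
  show "d' z0 = 1 + h * (B u)\<^sup>2 - (d u)\<^sup>2 / h"
    using C2[where z = z0 and w = z3] zz k ch by (simp add: power2_eq_square)
  show "a' z3 = c * B' z2"
    using C1[where z = z2 and w = z3] zz k ch by simp
  show "d' z2 = h * B' z3"
    using C2[where z = z2 and w = z3] zz k ch by simp
  have "B u * a u = c * B' z0 + c * (B u * d u) / h"
    using C1[where z = z0 and w = z3] zz k ch by (simp add: algebra_simps)
  then have "B' z0 = (B u * a u - c * (B u * d u) / h) / c" using ch by simp
  then show "B' z0 = B u * (a u / c - d u / h)" using ch by (simp add: diff_divide_distrib right_diff_distrib)
qed

section \<open>Constancy of trace and determinant of the block\<close>

definition "e1 = k1 + k2 + k3"
definition "e2 = k1 * k2 + k1 * k3 + k2 * k3"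

text \<open>As \<mu> = 0 is itself one of the curvatures, \<open>e1\<close> and \<open>e2\<close>
  are the sum and product of the other two. Those are nonzero and distinct, so neither their product
  nor their discriminant vanishes.\<close>

lemma symmetric_functions:
  assumes u: "u \<in> U"
  shows "d u = e1 - a u" "c * h * (B u)\<^sup>2 = a u * d u - e2" "e2 \<noteq> 0" "e1 * e1 \<noteq> 4 * e2"
proof -
  have "has_mu u 0" by (simp add: has_mu_def nu_eq_0[OF u])
  note cp = characteristic_polynomial[OF u generic[OF u] this]
  show "d u = e1 - a u" using cp(2) by (simp add: e1_def)
  show "c * h * (B u)\<^sup>2 = a u * d u - e2" using cp(3) fc[OF u] gc[OF u] by (simp add: e2_def)
  from cp(1) consider "k1 = 0" | "k2 = 0" | "k3 = 0" by auto
  then have "e2 \<noteq> 0 \<and> e1 * e1 - 4 * e2 \<noteq> 0"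
  proof cases
    case 1
    have "e1 * e1 - 4 * e2 = (k2 - k3)\<^sup>2" unfolding e1_def e2_def by (simp add: 1 power2_eq_square algebra_simps)
    then show ?thesis using distinct unfolding e2_def by (simp add: 1)
  next
    case 2
    have "e1 * e1 - 4 * e2 = (k1 - k3)\<^sup>2" unfolding e1_def e2_def by (simp add: 2 power2_eq_square algebra_simps)
    then show ?thesis using distinct unfolding e2_def by (simp add: 2)
  next
    case 3
    have "e1 * e1 - 4 * e2 = (k1 - k2)\<^sup>2" unfolding e1_def e2_def by (simp add: 3 power2_eq_square algebra_simps)
    then show ?thesis using distinct unfolding e2_def by (simp add: 3)
  qed
  then show "e2 \<noteq> 0" "e1 * e1 \<noteq> 4 * e2" by auto
qed

lemma constraints:
  assumes u: "u \<in> U" and a': "(a has_derivative a') (at u)" and B': "(B has_derivative B') (at u)"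
    and d': "(d has_derivative d') (at u)"
  shows "d' z = - a' z" "2 * c * h * B u * B' z = a' z * (d u - a u)"
proof -
  show dd: "d' z = - a' z" for z
  proof -
    have "a' z + d' z = 0"
      by (rule F.constant_derivative_0[OF u has_derivative_add[OF a' d'], of e1]) (simp add: symmetric_functions)
    then show ?thesis by simp
  qed
  have "((\<lambda>v. c * h * (B v * B v) - a v * d v) has_derivative
      (\<lambda>z. c * h * (B u * B' z + B' z * B u) - (a u * d' z + a' z * d u))) (at u)"
    by (intro has_derivative_diff has_derivative_mult has_derivative_mult_right a' B' d')
  then have "c * h * (B u * B' z + B' z * B u) - (a u * d' z + a' z * d u) = 0"
    by (rule F.constant_derivative_0[OF u, of _ _ "- e2"])
      (use symmetric_functions(2) in \<open>simp add: power2_eq_square\<close>)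
  then show "2 * c * h * B u * B' z = a' z * (d u - a u)" unfolding dd by (simp add: algebra_simps)
qed

text \<open>The Riccati equations turn the V derivative of the trace into the first equation and
  that of the determinant into the second, once \<open>B\<^sup>2\<close> is eliminated through
  \<open>e2\<close>. What remains is algebraic in \<open>a\<close> and \<open>d\<close>.\<close>

lemma trace_det_equations:
  assumes u: "u \<in> U"
  shows "e1 * (h * a u - c * d u) = (h - c) * e2" "(h * a u - c * d u) * e2 + c * h * (a u - d u) = 0"
proof -
  obtain a' B' d' where dv: "(a has_derivative a') (at u)" "(B has_derivative B') (at u)" "(d has_derivative d') (at u)"
    using shape_coefficients_differentiable[OF u generic[OF u]] by (auto simp: differentiable_def)
  obtain z0 z2 z3 where z: "dual_basis u z0 z2 z3" using dual_basis_exists[OF u generic[OF u]] .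
  note C = codazzi[OF u dv z] and K = constraints[OF u dv] and S = symmetric_functions[OF u]
  have ch: "c \<noteq> 0" "h \<noteq> 0" using c by auto
  have a0: "c * a' z0 = (a u)\<^sup>2 - c * (c * (B u)\<^sup>2) - c" using C(1) ch by (simp add: right_diff_distrib)
  have d0: "h * d' z0 = h + h * (h * (B u)\<^sup>2) - (d u)\<^sup>2" using C(3) ch by (simp add: distrib_left right_diff_distrib)
  have b0: "c * h * B' z0 = B u * (h * a u - c * d u)" using C(2) ch by (simp add: right_diff_distrib)
  define b where "b = c * h * (B u)\<^sup>2"
  have "0 = c * h * a' z0 + c * h * d' z0" using K(1)[of z0] by simp
  also have "\<dots> = h * (c * a' z0) + c * (h * d' z0)" by simp
  also have "\<dots> = h * (a u)\<^sup>2 - c * (d u)\<^sup>2 + (h - c) * b"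
    unfolding a0 d0 b_def by (simp add: algebra_simps)
  finally have 1: "h * (a u)\<^sup>2 - c * (d u)\<^sup>2 + (h - c) * b = 0" by simp
  have bS: "b = a u * d u - e2" unfolding b_def by (rule S(2))
  have e1: "e1 = a u + d u" using S(1) by simp
  show "e1 * (h * a u - c * d u) = (h - c) * e2"
    using 1 unfolding bS e1 by (simp add: power2_eq_square algebra_simps)
  have "2 * c * h * B u * B' z0 = a' z0 * d u + a u * d' z0" using K(2)[of z0] K(1)[of z0] by (simp add: algebra_simps)
  then have "c * h * (2 * c * h * B u * B' z0) = c * h * (a' z0 * d u + a u * d' z0)" by simp
  moreover have "2 * (c * h) * B u * (c * h * B' z0) = c * h * (2 * c * h * B u * B' z0)" by (simp add: mult_ac)
  ultimately have "2 * (c * h) * B u * (c * h * B' z0) = c * h * (a' z0 * d u + a u * d' z0)" by metis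
  also have "\<dots> = h * d u * (c * a' z0) + c * a u * (h * d' z0)" by (simp add: algebra_simps)
  finally have "2 * b * (h * a u - c * d u) = h * d u * (a u)\<^sup>2 - c * b * d u - c * h * d u
      + c * h * a u + h * b * a u - c * a u * (d u)\<^sup>2"
    unfolding a0 d0 b0 b_def by (simp add: algebra_simps power2_eq_square)
  then have "(a u * d u - b) * (h * a u - c * d u) + c * h * (a u - d u) = 0"
    by (simp add: algebra_simps power2_eq_square)
  then show "(h * a u - c * d u) * e2 + c * h * (a u - d u) = 0"
    unfolding bS by (simp add: mult.commute)
qed

text \<open>If \<open>e1\<close> is nonzero, the trace equation is linear in \<open>a\<close> and
  fixes it. If \<open>e1 = 0\<close>, it only yields \<open>c = h = 1/2\<close>, because
  \<open>e2\<close> is nonzero, and \<open>a\<close> could still vary; closedness of a form has to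
  decide.\<close>

lemma shape_coefficients_constant:
  assumes u: "u \<in> U"
  shows "(a has_derivative (\<lambda>w. 0)) (at u) \<and> (B has_derivative (\<lambda>w. 0)) (at u) \<and> (d has_derivative (\<lambda>w. 0)) (at u) \<and>
    (B u = 0 \<and> (a u)\<^sup>2 = c \<and> (d u)\<^sup>2 = h \<or> B u \<noteq> 0 \<and> c = 1/2 \<and> d u = a u \<and> (B u)\<^sup>2 = 4 * (a u)\<^sup>2 - 2)"
proof -
  have ch: "c \<noteq> 0" "h \<noteq> 0" "h = 1 - c" using c by auto
  have dex: "\<exists>a' B' d'. (a has_derivative a') (at u) \<and> (B has_derivative B') (at u) \<and> (d has_derivative d') (at u)"
    if "u \<in> U" for u
    using shape_coefficients_differentiable[OF that generic[OF that]] by (auto simp: differentiable_def)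
  obtain a' B' d' where dv: "(a has_derivative a') (at u)" "(B has_derivative B') (at u)" "(d has_derivative d') (at u)"
    using dex[OF u] by blast
  obtain z0 z2 z3 where z: "dual_basis u z0 z2 z3" using dual_basis_exists[OF u generic[OF u]] .
  note C = codazzi[OF u dv z] and K = constraints[OF u dv]
  have zero: "a' = (\<lambda>w. 0) \<Longrightarrow> B' = (\<lambda>w. 0) \<Longrightarrow> (a has_derivative (\<lambda>w. 0)) (at u) \<and> (B has_derivative (\<lambda>w. 0)) (at u) \<and> (d has_derivative (\<lambda>w. 0)) (at u)"
  proof -
    assume 0: "a' = (\<lambda>w. 0)" "B' = (\<lambda>w. 0)"
    then have "d' = (\<lambda>w. 0)" using K(1) by auto
    with 0 dv show ?thesis by simp
  qed
  have B_zero: ?thesis if "\<And>v. v \<in> U \<Longrightarrow> B v = 0" "a' = (\<lambda>w. 0)"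
  proof -
    have B0: "B' = (\<lambda>w. 0)" using F.constant_derivative_0[OF u dv(2) that(1)] by auto
    have "(a u)\<^sup>2 = c" "(d u)\<^sup>2 = h"
      using C(1,3) K(1)[of z0] that(1)[OF u] that(2) ch(1,2) by (simp_all add: field_simps)
    then show ?thesis using zero[OF that(2) B0] that(1)[OF u] by blast
  qed
  show ?thesis
  proof (cases "e1 = 0")
    case False
    have av: "a v = (h - c) * e2 / e1 + c * e1" if "v \<in> U" for v
    proof -
      have "h * a v - c * d v = a v - c * e1" unfolding symmetric_functions(1)[OF that] ch(3) by (simp add: algebra_simps)
      then have "e1 * (a v - c * e1) = (h - c) * e2" using trace_det_equations(1)[OF that] by simp
      then show ?thesis using False by (simp add: field_simps)
    qed
    have a0: "a' = (\<lambda>w. 0)" using F.constant_derivative_0[OF u dv(1) av] by auto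
    show ?thesis
    proof (cases "B u = 0")
      case True
      \<comment> \<open>\<open>B\<close> has to vanish on all of \<open>U\<close>, not only at
        \<open>u\<close>, before its derivative is known; its square is determined by
        \<open>a\<close> and \<open>d\<close>, which are constant.\<close>
      have "(B v)\<^sup>2 = (B u)\<^sup>2" if "v \<in> U" for v
      proof -
        have "a v = a u" "d v = d u" using av[OF that] av[OF u] symmetric_functions(1)[OF that] symmetric_functions(1)[OF u] by simp_all
        then have "c * h * (B v)\<^sup>2 = c * h * (B u)\<^sup>2"
          using symmetric_functions(2)[OF that] symmetric_functions(2)[OF u] by simp
        then show ?thesis using ch by simp
      qed
      with True show ?thesis using B_zero a0 by simp
    next
      case B: False
      have B0: "B' w = 0" for w using K(2)[of w] a0 B ch by simp
      have "a u / c = d u / h" using C(2) B0 B by simp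
      then have "h * a u - c * d u = 0" using ch(1,2) by (simp add: field_simps)
      with trace_det_equations(2)[OF u] have ad: "d u = a u" using ch by simp
      then have "a u \<noteq> 0" using symmetric_functions(1)[OF u] False by auto
      with \<open>h * a u - c * d u = 0\<close> ad have "c = 1/2" using ch(3) by (simp add: left_diff_distrib[symmetric])
      moreover have "(B u)\<^sup>2 = 4 * (a u)\<^sup>2 - 2"
        using C(1) a0 \<open>c = 1/2\<close> by simp
      ultimately show ?thesis using zero[OF a0] B0 B ad by auto
    qed
  next
    case True
    then have c2: "c = 1/2" "h = 1/2" using trace_det_equations(1)[OF u] symmetric_functions(3)[OF u] ch(3) by auto
    have dm: "d v = - a v" if "v \<in> U" for v using symmetric_functions(1)[OF that] True by simp
    have ae: "a v * (e2 + 1/2) = 0" if "v \<in> U" for v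
      using trace_det_equations(2)[OF that] dm[OF that] c2 by (simp add: algebra_simps)
    \<comment> \<open>Otherwise \<open>a\<close> vanishes identically and its Riccati equation reads
      \<open>B\<^sup>2 = - 2\<close>.\<close>
    have "e2 = - 1/2"
    proof (rule ccontr)
      assume "e2 \<noteq> - 1/2"
      then have av: "a v = 0" if "v \<in> U" for v using ae[OF that] by simp
      then have "a' z0 = 0" by (rule F.constant_derivative_0[OF u dv(1)])
      then have "(B u)\<^sup>2 / 2 = - 1" using C(1) av[OF u] c2 by simp
      then show False using zero_le_power2[of "B u"] by linarith
    qed
    then have BS: "(B v)\<^sup>2 = 2 - 4 * (a v)\<^sup>2" if "v \<in> U" for v
      using symmetric_functions(2)[OF that] dm[OF that] c2 by (simp add: power2_eq_square)
    \<comment> \<open>Here \<open>a\<close> is a function with differential \<open>(4 a\<^sup>2 - 2) om\<close>; as this form is closed, \<open>B\<close> vanishes.\<close>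
    have ader: "(a has_derivative (\<lambda>w. (4 * (a v)\<^sup>2 - 2) * om v w)) (at v)" if v: "v \<in> U" for v
    proof -
      obtain a' B' d' where dv: "(a has_derivative a') (at v)" "(B has_derivative B') (at v)" "(d has_derivative d') (at v)"
        using dex[OF v] by blast
      obtain z0 z2 z3 where z: "dual_basis v z0 z2 z3" using dual_basis_exists[OF v generic[OF v]] .
      note C = codazzi[OF v dv z] and K = constraints[OF v dv]
      have B23: "B' z2 = 2 * a' z3" "B' z3 = - 2 * a' z2" using C(4,5) K(1)[of z2] c2 by auto
      \<comment> \<open>Two linear equations for the derivatives of \<open>a\<close> along
        \<open>z2\<close> and \<open>z3\<close>. Up to sign their determinant is
        \<open>B\<^sup>2 + 4 * a\<^sup>2\<close>, which is 2 by \<open>BS\<close>, so both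
        derivatives vanish.\<close>
      have 2: "B v * a' z3 = - 2 * a v * a' z2" and 3: "B v * a' z2 = 2 * a v * a' z3"
        using K(2)[of z2] K(2)[of z3] dm[OF v] c2 B23 by (simp_all add: algebra_simps)
      have "2 * a' z2 = ((B v)\<^sup>2 + 4 * (a v)\<^sup>2) * a' z2" using BS[OF v] by simp
      also have "\<dots> = B v * (B v * a' z2) + 4 * (a v)\<^sup>2 * a' z2" by (simp add: power2_eq_square algebra_simps)
      also have "\<dots> = 2 * a v * (B v * a' z3) + 4 * (a v)\<^sup>2 * a' z2" unfolding 3 by (simp add: algebra_simps)
      also have "\<dots> = 0" unfolding 2 by (simp add: power2_eq_square)
      finally have a2: "a' z2 = 0" by simp
      have "2 * a' z3 = ((B v)\<^sup>2 + 4 * (a v)\<^sup>2) * a' z3" using BS[OF v] by simp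
      also have "\<dots> = B v * (B v * a' z3) + 2 * a v * (2 * a v * a' z3)" by (simp add: power2_eq_square algebra_simps)
      also have "\<dots> = 0" unfolding 2 3[symmetric] a2 by simp
      finally have a3: "a' z3 = 0" by simp
      have "a' z0 = 4 * (a v)\<^sup>2 - 2" using C(1) c2 BS[OF v] by (simp add: field_simps)
      then have "a' w = (4 * (a v)\<^sup>2 - 2) * om v w" for w
        using expand_in_dual_basis[OF v generic[OF v] has_derivative_linear[OF dv(1)] z, of w] a2 a3 by simp
      then have "a' = (\<lambda>w. (4 * (a v)\<^sup>2 - 2) * om v w)" by blast
      then show ?thesis using dv(1) by simp
    qed
    have Bv: "B v = 0" if v: "v \<in> U" for v
    proof -
      have nz: "f v \<noteq> 0" using generic[OF v] by auto
      obtain D where D: "\<And>w. ((\<lambda>v. om v w) has_derivative D w) (at v)"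
        and DA: "\<And>z w. f v * (D w z - D z w) = F.ka v z * be v w - F.ka v w * be v z + F.nu v z * om v w - F.nu v w * om v z"
        using F.om_derivative[OF v nz] by blast
      obtain z0 z2 z3 where z: "dual_basis v z0 z2 z3" using dual_basis_exists[OF v generic[OF v]] .
      note zz = z[unfolded dual_basis_def]
      let ?a' = "\<lambda>w. (4 * (a v)\<^sup>2 - 2) * om v w"
      have 1: "((\<lambda>v. 4 * (a v * a v) - 2) has_derivative (\<lambda>z. 4 * (a v * ?a' z + ?a' z * a v) - 0)) (at v)"
        by (intro has_derivative_diff has_derivative_mult_right has_derivative_mult ader v has_derivative_const)
      have dd: "((\<lambda>v. (4 * (a v)\<^sup>2 - 2) * om v w) has_derivative
          (\<lambda>z. (4 * (a v * a v) - 2) * D w z + (4 * (a v * ?a' z + ?a' z * a v) - 0) * om v w)) (at v)" for w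
        using has_derivative_mult[OF 1 D[of w]] by (simp add: power2_eq_square)
      have "(4 * (a v * a v) - 2) * D z2 z3 + (4 * (a v * ?a' z3 + ?a' z3 * a v) - 0) * om v z2
          = (4 * (a v * a v) - 2) * D z3 z2 + (4 * (a v * ?a' z2 + ?a' z2 * a v) - 0) * om v z3"
        by (rule second_derivative_symmetric_real[OF F.open_U v ader dd dd])
      then have "(4 * (a v * a v) - 2) * D z2 z3 = (4 * (a v * a v) - 2) * D z3 z2" using zz by simp
      moreover have "(B v)\<^sup>2 = - (4 * (a v * a v) - 2)" using BS[OF v] by (simp add: power2_eq_square)
      ultimately have "(B v)\<^sup>2 * (D z2 z3 - D z3 z2) = 0" by (simp only: mult_minus_left right_diff_distrib)
      moreover have "D z2 z3 - D z3 z2 = - B v"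
        using DA[where z = z3 and w = z2] zz ka[OF v, of z3] fc[OF v] c2 by simp
      ultimately show ?thesis by simp
    qed
    have "a' = (\<lambda>w. (4 * (a u)\<^sup>2 - 2) * om u w)" using has_derivative_unique[OF dv(1) ader[OF u]] .
    moreover have "4 * (a u)\<^sup>2 - 2 = 0" using BS[OF u] Bv[OF u] by simp
    ultimately show ?thesis using B_zero[OF Bv] by simp
  qed
qed

end

section \<open>Exclusion of products of a curve with a hyperbolic plane\<close>

context moving_frame
begin

text \<open>The normal lies in the first factor and dp is a multiple of \<open>e\<close>.
  Eigenvectors for nonzero eigenvalues have no component in the second factor, so they all lie on
  one line.\<close>

lemma degenerate_eigenvalue_unique:
  assumes u: "u \<in> U" and f: "f u = 1" and om: "\<And>w. om u w = 0"
    and q': "linear q'" and inj: "\<And>w. p' u w = 0 \<Longrightarrow> q' w = 0 \<Longrightarrow> w = 0"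
    and w1: "w1 \<noteq> 0" "- m' u w1 = k *\<^sub>R p' u w1" "k *\<^sub>R q' w1 = 0" "k \<noteq> 0"
    and w2: "w2 \<noteq> 0" "- m' u w2 = l *\<^sub>R p' u w2" "l *\<^sub>R q' w2 = 0" "l \<noteq> 0"
  shows "k = l"
proof -
  have P: "p' u w = be u w *\<^sub>R e u" for w using p'_expand[OF u, of w] f om[of w] by simp
  have q0: "q' w1 = 0" "q' w2 = 0" using w1 w2 by auto
  have b: "be u w1 \<noteq> 0" "be u w2 \<noteq> 0" using inj[of w1] inj[of w2] P q0 w1(1) w2(1) by auto
  note lp = p'_linear[OF u] and lm = m'_linear[OF u]
  let ?v = "be u w2 *\<^sub>R w1 - be u w1 *\<^sub>R w2"
  have "?v = 0"
  proof (rule inj)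
    have "p' u ?v = be u w2 *\<^sub>R p' u w1 - be u w1 *\<^sub>R p' u w2" by (simp add: linear_diff[OF lp] linear_cmul[OF lp])
    then show "p' u ?v = 0" unfolding P[of w1] P[of w2] by (simp add: mult.commute)
    show "q' ?v = 0" by (simp add: linear_diff[OF q'] linear_cmul[OF q'] q0)
  qed
  then have "be u w2 *\<^sub>R (- m' u w1) = be u w1 *\<^sub>R (- m' u w2)"
    using linear_cmul[OF lm, of "be u w2" w1] linear_cmul[OF lm, of "be u w1" w2] by (simp add: eq_iff_diff_eq_0[symmetric])
  then have "(be u w2 * k * be u w1) *\<^sub>R e u = (be u w1 * l * be u w2) *\<^sub>R e u"
    unfolding w1(2) w2(2) P by (simp add: mult.assoc)
  moreover have "e u \<noteq> 0" using frame_products(1)[OF u] f by (auto simp: lor_simps)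
  ultimately show ?thesis using b by simp
qed

end

text \<open>If \<open>g\<close> vanishes at \<open>u\<close>, its constancy gives
  \<open>n = 0\<close> on all of \<open>U\<close>, so the derivative of \<open>n\<close> is zero
  too. Two of three distinct curvatures are nonzero, more than such a product admits.\<close>

lemma (in hyper_chart) nondegenerate:
  assumes u: "u \<in> U" and const: "\<And>v. v \<in> U \<Longrightarrow> f v = f u"
  shows "0 < f u" "0 < g u"
proof -
  obtain k l where kl: "k \<in> {k1,k2,k3}" "l \<in> {k1,k2,k3}" "k \<noteq> 0" "l \<noteq> 0" "k \<noteq> l"
    using distinct by (cases "k1 = 0"; cases "k2 = 0") auto
  obtain w1 where w1: "w1 \<noteq> 0" "om u w1 *\<^sub>R p u - m' u w1 = k *\<^sub>R p' u w1" "G.om u w1 *\<^sub>R q u - n' u w1 = k *\<^sub>R q' u w1"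
    using kl(1) unfolding eig[OF u] by blast
  obtain w2 where w2: "w2 \<noteq> 0" "om u w2 *\<^sub>R p u - m' u w2 = l *\<^sub>R p' u w2" "G.om u w2 *\<^sub>R q u - n' u w2 = l *\<^sub>R q' u w2"
    using kl(2) unfolding eig[OF u] by blast
  have "g u \<noteq> 0"
  proof
    assume g0: "g u = 0"
    have n0: "n v = 0" if "v \<in> U" for v
      using lorentz_nonneg(2)[OF G.pp[OF that] G.pm[OF that]] unit[OF that] unit[OF u] const[OF that] g0 by (simp add: G.f_def)
    have n'0: "n' u w = 0" for w using G.constant_derivative_0[OF u G.m_deriv[OF u] n0] .
    have G0: "G.om u w = 0" for w by (simp add: G.om_def n0[OF u] lor_simps)
    have F0: "om u w = 0" for w using tang[OF u, of w] G0[of w] by simp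
    have "k = l"
      by (rule F.degenerate_eigenvalue_unique[OF u, of "q' u" w1 k w2 l])
        (use w1 w2 kl unit[OF u] g0 F0 G0 n'0 G.p'_linear[OF u] inj[OF u] in simp_all)
    with kl show False by simp
  qed
  moreover have "f u \<noteq> 0"
  proof
    assume f0: "f u = 0"
    have m0: "m v = 0" if "v \<in> U" for v
      using lorentz_nonneg(2)[OF F.pp[OF that] F.pm[OF that]] const[OF that] f0 by (simp add: F.f_def)
    have m'0: "m' u w = 0" for w using F.constant_derivative_0[OF u F.m_deriv[OF u] m0] .
    have F0: "om u w = 0" for w by (simp add: F.om_def m0[OF u] lor_simps)
    have G0: "G.om u w = 0" for w using tang[OF u, of w] F0[of w] by simp
    have "k = l"
      by (rule G.degenerate_eigenvalue_unique[OF u, of "p' u" w1 k w2 l])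
        (use w1 w2 kl unit[OF u] f0 F0 G0 m'0 F.p'_linear[OF u] inj[OF u] in simp_all)
    with kl show False by simp
  qed
  ultimately show "0 < f u" "0 < g u" using f_nonneg[OF u] g_nonneg[OF u] by auto
qed

subsection \<open>Global constancy of the shape operator\<close>

lemma smooth_imp_C2_map:
  assumes "smooth_on F U" "open U"
  shows "C2_map U F (\<lambda>u. frechet_derivative F (at u))"
proof -
  have "Ck_on (Suc (Suc 0)) F U" using assms(1) unfolding smooth_on_def by blast
  then show ?thesis using assms(2) by (auto simp: C2_map_def frechet_derivative_works[symmetric])
qed

lemma C2_map_fst_snd:
  assumes "C2_map U F F'"
  shows "C2_map U (\<lambda>u. fst (F u)) (\<lambda>u w. fst (F' u w))" "C2_map U (\<lambda>u. snd (F u)) (\<lambda>u w. snd (F' u w))"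
proof -
  have "(\<lambda>v. fst (F' v w)) differentiable (at u)" "(\<lambda>v. snd (F' v w)) differentiable (at u)"
    if dif: "(\<lambda>v. F' v w) differentiable (at u)" for u w
  proof -
    obtain D where "((\<lambda>v. F' v w) has_derivative D) (at u)" using dif unfolding differentiable_def by blast
    from has_derivative_fst[OF this] has_derivative_snd[OF this]
    show "(\<lambda>v. fst (F' v w)) differentiable (at u)" "(\<lambda>v. snd (F' v w)) differentiable (at u)"
      unfolding differentiable_def by blast+
  qed
  moreover have "((\<lambda>u. fst (F u)) has_derivative (\<lambda>w. fst (F' u w))) (at u)"
    "((\<lambda>u. snd (F u)) has_derivative (\<lambda>w. snd (F' u w))) (at u)" if "u \<in> U" for u
    using assms that has_derivative_fst[of F "F' u"] has_derivative_snd[of F "F' u"] unfolding C2_map_def by blast+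
  ultimately show "C2_map U (\<lambda>u. fst (F u)) (\<lambda>u w. fst (F' u w))" "C2_map U (\<lambda>u. snd (F u)) (\<lambda>u w. snd (F' u w))"
    using assms unfolding C2_map_def by simp_all
qed

locale three_curvatures =
  fixes M :: "pt set" and N :: "pt \<Rightarrow> pt" and k1 k2 k3 :: real
  assumes hyp: "hypersurface M" and conn: "connected M" and ne: "M \<noteq> {}"
    and normal: "unit_normal M N"
    and distinct: "k1 \<noteq> k2" "k1 \<noteq> k3" "k2 \<noteq> k3"
    and curv: "x \<in> M \<Longrightarrow> principal_curvatures M N x = {k1, k2, k3}"
    and V: "x \<in> M \<Longrightarrow> \<exists>\<mu>. shape_op M N x (Vfield N x) = \<mu> *\<^sub>R Vfield N x"
begin

definition "fM x = lor (fst (N x)) (fst (N x))"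
definition "gM x = lor (snd (N x)) (snd (N x))"
definition "E2 x = lcross (fst x) (fst (N x))"
definition "E3 x = lcross (snd x) (snd (N x))"
text \<open>The block entries, written without a chart so that connectedness of \<open>M\<close> can
  act on them. Where a denominator vanishes the value is 0; the identities required by
  \<open>hyper_chart\<close> still hold, because a frame vector vanishes as well.\<close>

definition "aM x = gprod (shape_op M N x (E2 x, 0)) (E2 x, 0) / fM x"
definition "BM x = gprod (shape_op M N x (E2 x, 0)) (0, E3 x) / (fM x * gM x)"
definition "dM x = gprod (shape_op M N x (0, E3 x)) (0, E3 x) / gM x"

lemma chart_at:
  assumes "x \<in> M"
  obtains \<phi> U W u where "is_chart M \<phi> U W" "u \<in> U" "\<phi> u = x"
proof -
  obtain \<phi> U W where c: "is_chart M \<phi> U W" and "x \<in> W" using hyp assms unfolding hypersurface_def by blast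
  then obtain u where "u \<in> U" "\<phi> u = x" using assms unfolding is_chart_def homeomorphism_def by blast
  with c that show thesis by blast
qed

lemma chart_in_M: "is_chart M \<phi> U W \<Longrightarrow> u \<in> U \<Longrightarrow> \<phi> u \<in> M"
  unfolding is_chart_def homeomorphism_def by blast

lemma in_H2: "x \<in> M \<Longrightarrow> fst x \<in> H2" "x \<in> M \<Longrightarrow> snd x \<in> H2"
  using hyp unfolding hypersurface_def HH_def by auto

lemma chart_hyper_chart:
  assumes ch: "is_chart M \<phi> U W"
  shows "hyper_chart U (\<lambda>u. fst (\<phi> u)) (\<lambda>u w. fst (frechet_derivative \<phi> (at u) w))
    (\<lambda>u. fst (N (\<phi> u))) (\<lambda>u w. fst (frechet_derivative (N \<circ> \<phi>) (at u) w))
    (\<lambda>u. snd (\<phi> u)) (\<lambda>u w. snd (frechet_derivative \<phi> (at u) w))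
    (\<lambda>u. snd (N (\<phi> u))) (\<lambda>u w. snd (frechet_derivative (N \<circ> \<phi>) (at u) w))
    k1 k2 k3 (\<lambda>u. aM (\<phi> u)) (\<lambda>u. BM (\<phi> u)) (\<lambda>u. dM (\<phi> u))"
proof -
  let ?D = "\<lambda>u. frechet_derivative \<phi> (at u)" and ?E = "\<lambda>u. frechet_derivative (N \<circ> \<phi>) (at u)"
  have "smooth_on \<phi> U" "open U" using ch by (auto simp: is_chart_def)
  then have c1: "C2_map U \<phi> ?D" by (rule smooth_imp_C2_map)
  have "smooth_on (N \<circ> \<phi>) U" using normal ch unfolding unit_normal_def by blast
  then have c2: "C2_map U (N \<circ> \<phi>) ?E" using \<open>open U\<close> by (rule smooth_imp_C2_map)
  have tg: "N (\<phi> u) \<in> tangent_HH (\<phi> u)" "gprod (N (\<phi> u)) (N (\<phi> u)) = 1" if "u \<in> U" for u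
    using normal chart_in_M[OF ch that] unfolding unit_normal_def by blast+
  have Hpp: "lor (fst (\<phi> u)) (fst (\<phi> u)) = -1" "lor (snd (\<phi> u)) (snd (\<phi> u)) = -1" if "u \<in> U" for u
    using in_H2[OF chart_in_M[OF ch that]] by (auto simp: H2_def)
  interpret F: moving_frame U "\<lambda>u. fst (\<phi> u)" "\<lambda>u w. fst (?D u w)" "\<lambda>u. fst (N (\<phi> u))" "\<lambda>u w. fst (?E u w)"
  proof
    show "C2_map U (\<lambda>u. fst (\<phi> u)) (\<lambda>u w. fst (?D u w))" by (rule C2_map_fst_snd(1)[OF c1])
    show "C2_map U (\<lambda>u. fst (N (\<phi> u))) (\<lambda>u w. fst (?E u w))" using C2_map_fst_snd(1)[OF c2] by simp
  qed (use Hpp tg in \<open>auto simp: tangent_HH_def lor_commute\<close>)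
  interpret G: moving_frame U "\<lambda>u. snd (\<phi> u)" "\<lambda>u w. snd (?D u w)" "\<lambda>u. snd (N (\<phi> u))" "\<lambda>u w. snd (?E u w)"
  proof
    show "C2_map U (\<lambda>u. snd (\<phi> u)) (\<lambda>u w. snd (?D u w))" by (rule C2_map_fst_snd(2)[OF c1])
    show "C2_map U (\<lambda>u. snd (N (\<phi> u))) (\<lambda>u w. snd (?E u w))" using C2_map_fst_snd(2)[OF c2] by simp
  qed (use Hpp tg in \<open>auto simp: tangent_HH_def lor_commute\<close>)
  have ts: "tangent_space M (\<phi> u) = range (?D u)" if "u \<in> U" for u
    using tangent_space_chart[OF ch that] .
  have injD: "?D u w = 0 \<Longrightarrow> w = 0" and linD: "linear (?D u)" if "u \<in> U" for u w
  proof -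
    show l: "linear (?D u)" using chart_has_derivative[OF ch that] by (rule has_derivative_linear)
    show "?D u w = 0 \<Longrightarrow> w = 0" using ch that linear_injective_0[OF l] unfolding is_chart_def by blast
  qed
  \<comment> \<open>\<open>tproj\<close> adds \<open>lor m' p *\<^sub>R p\<close> to the derivative
    \<open>m'\<close> of the normal, and \<open>lor p m' = - om\<close>; the negative of the sum is
    \<open>om *\<^sub>R p - m'\<close>.\<close>
  have shape: "shape_op M N (\<phi> u) (?D u w) = (F.om u w *\<^sub>R fst (\<phi> u) - fst (?E u w), G.om u w *\<^sub>R snd (\<phi> u) - snd (?E u w))"
    if u: "u \<in> U" for u w
  proof -
    have "(N \<circ> \<phi> has_derivative ?E u) (at u)" using c2 u by (auto simp: C2_map_def)
    from frechet_derivative_within_chart[OF ch u this, of w]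
    show ?thesis unfolding shape_op_def tproj_def
      using F.lor_p_m'[OF u, of w] G.lor_p_m'[OF u, of w] by (simp add: lor_commute[of "fst (?E u w)"] lor_commute[of "snd (?E u w)"])
  qed
  have Ff: "F.f u = fM (\<phi> u)" "G.f u = gM (\<phi> u)" "F.e u = E2 (\<phi> u)" "G.e u = E3 (\<phi> u)" for u
    by (simp_all add: F.f_def G.f_def F.e_def G.e_def fM_def gM_def E2_def E3_def)
  show ?thesis
  proof
    fix u assume u: "u \<in> U"
    note x = chart_in_M[OF ch u]
    show un: "F.f u + G.f u = 1" using tg(2)[OF u] by (simp add: gprod_def F.f_def G.f_def)
    show "F.om u w + G.om u w = 0" for w
    proof -
      have "\<forall>v\<in>tangent_space M (\<phi> u). gprod (N (\<phi> u)) v = 0" using normal x unfolding unit_normal_def by blast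
      then show ?thesis using ts[OF u] by (simp add: gprod_def F.om_def G.om_def)
    qed
    show inj: "fst (?D u w) = 0 \<Longrightarrow> snd (?D u w) = 0 \<Longrightarrow> w = 0" for w
      using injD[OF u, of w] by (simp add: prod_eq_iff)
    show "k \<in> {k1, k2, k3} \<longleftrightarrow> (\<exists>w. w \<noteq> 0 \<and> F.om u w *\<^sub>R fst (\<phi> u) - fst (?E u w) = k *\<^sub>R fst (?D u w)
      \<and> G.om u w *\<^sub>R snd (\<phi> u) - snd (?E u w) = k *\<^sub>R snd (?D u w))" for k
    proof -
      have nz: "?D u w \<noteq> 0 \<longleftrightarrow> w \<noteq> 0" for w using injD[OF u, of w] linear_0[OF linD[OF u]] by auto
      have "k \<in> {k1, k2, k3} \<longleftrightarrow> (\<exists>v\<in>range (?D u). v \<noteq> 0 \<and> shape_op M N (\<phi> u) v = k *\<^sub>R v)"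
        using curv[OF x] unfolding principal_curvatures_def ts[OF u] by blast
      also have "\<dots> \<longleftrightarrow> (\<exists>w. w \<noteq> 0 \<and> shape_op M N (\<phi> u) (?D u w) = k *\<^sub>R ?D u w)"
        using nz by auto
      finally show ?thesis unfolding shape[OF u] by (simp add: prod_eq_iff)
    qed
    show "\<exists>\<mu>. F.om u w *\<^sub>R fst (\<phi> u) - fst (?E u w) = \<mu> *\<^sub>R fst (?D u w) \<and>
        G.om u w *\<^sub>R snd (\<phi> u) - snd (?E u w) = \<mu> *\<^sub>R snd (?D u w)"
      if "fst (?D u w) = (2 * G.f u) *\<^sub>R fst (N (\<phi> u))" "snd (?D u w) = - (2 * F.f u) *\<^sub>R snd (N (\<phi> u))" for w
    proof -
      have gp: "gprod (Pstr (N (\<phi> u))) (N (\<phi> u)) = F.f u - G.f u"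
        by (simp add: gprod_def Pstr_def F.f_def G.f_def lor_simps)
      have e: "2 * G.f u = 1 - (F.f u - G.f u)" "- (2 * F.f u) = - 1 - (F.f u - G.f u)" using un by linarith+
      \<comment> \<open>Since the two squared lengths add up to 1, V is
        \<open>(2 g m, - 2 f n)\<close>, the form in which \<open>V_principal\<close> describes
        it.\<close>
      have "?D u w = Vfield N (\<phi> u)"
        using that(1)[unfolded e(1)] that(2)[unfolded e(2)] unfolding Vfield_def gp
        by (simp add: prod_eq_iff Pstr_def scaleR_diff_left)
      then obtain \<mu> where "shape_op M N (\<phi> u) (?D u w) = \<mu> *\<^sub>R ?D u w" using V[OF x] by auto
      then show ?thesis using shape[OF u, of w] by (intro exI[of _ \<mu>]) (simp add: prod_eq_iff)
    qed
    show "F.ka u w = - F.f u * aM (\<phi> u) \<and> G.ka u w = - F.f u * G.f u * BM (\<phi> u)"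
      if "fst (?D u w) = F.e u" "snd (?D u w) = 0" for w
    proof -
      have Dw: "?D u w = (E2 (\<phi> u), 0)" using that Ff by (simp add: prod_eq_iff)
      have s: "shape_op M N (\<phi> u) (E2 (\<phi> u), 0) = (F.om u w *\<^sub>R fst (\<phi> u) - fst (?E u w), G.om u w *\<^sub>R snd (\<phi> u) - snd (?E u w))"
        using shape[OF u, of w] Dw by simp
      have A: "F.f u * aM (\<phi> u) = - F.ka u w" if "F.f u \<noteq> 0"
        using that F.frame_products(4)[OF u] unfolding aM_def s unfolding Ff(1,3)[symmetric]
        by (simp add: gprod_def lor_simps F.ka_def lor_commute[of _ "F.e u"])
      have B: "F.f u * G.f u * BM (\<phi> u) = - G.ka u w" if "F.f u \<noteq> 0" "G.f u \<noteq> 0"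
        using that G.frame_products(4)[OF u] unfolding BM_def s unfolding Ff(1,2,4)[symmetric]
        by (simp add: gprod_def lor_simps G.ka_def lor_commute[of _ "G.e u"])
      have f0: "F.ka u w = 0 \<and> G.ka u w = 0" if "F.f u = 0"
      proof -
        have "fst (N (\<phi> u)) = 0" using lorentz_nonneg(2)[OF F.pp[OF u] F.pm[OF u]] that by (simp add: F.f_def)
        then have "F.e u = 0" by (simp add: F.e_def lcross.zero_right)
        then have "w = 0" using inj[of w] \<open>fst (?D u w) = F.e u\<close> \<open>snd (?D u w) = 0\<close> by simp
        then show ?thesis using linear_0[OF F.m'_linear[OF u]] linear_0[OF G.m'_linear[OF u]] by (simp add: F.ka_def G.ka_def lor_simps)
      qed
      have g0: "G.ka u w = 0" if "G.f u = 0"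
      proof -
        have "snd (N (\<phi> u)) = 0" using lorentz_nonneg(2)[OF G.pp[OF u] G.pm[OF u]] that by (simp add: G.f_def)
        then show ?thesis by (simp add: G.ka_def G.e_def lor_simps lcross.zero_right)
      qed
      show ?thesis using A B f0 g0 by (cases "F.f u = 0"; cases "G.f u = 0") auto
    qed
    show "G.ka u w = - G.f u * dM (\<phi> u)" if "fst (?D u w) = 0" "snd (?D u w) = G.e u" for w
    proof -
      have Dw: "?D u w = (0, E3 (\<phi> u))" using that Ff by (simp add: prod_eq_iff)
      have s: "shape_op M N (\<phi> u) (0, E3 (\<phi> u)) = (F.om u w *\<^sub>R fst (\<phi> u) - fst (?E u w), G.om u w *\<^sub>R snd (\<phi> u) - snd (?E u w))"
        using shape[OF u, of w] Dw by simp
      have "G.f u * dM (\<phi> u) = - G.ka u w" if "G.f u \<noteq> 0"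
        using that G.frame_products(4)[OF u] unfolding dM_def s unfolding Ff(2,4)[symmetric]
        by (simp add: gprod_def lor_simps G.ka_def lor_commute[of _ "G.e u"])
      moreover have "G.ka u w = 0" if "G.f u = 0"
      proof -
        have "snd (N (\<phi> u)) = 0" using lorentz_nonneg(2)[OF G.pp[OF u] G.pm[OF u]] that by (simp add: G.f_def)
        then show ?thesis by (simp add: G.ka_def G.e_def lor_simps lcross.zero_right)
      qed
      ultimately show ?thesis by (cases "G.f u = 0") auto
    qed
  qed (use distinct in auto)
qed

text \<open>The order matters: \<open>nondegenerate\<close> needs \<open>f\<close> to be constant,
  and only positivity of both squared lengths gives access to the Codazzi equations that make the
  other coefficients constant.\<close>

lemma shape_constants:
  obtains c h a B d where "0 < c" "0 < h" "c + h = 1"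
    "\<forall>x\<in>M. fM x = c \<and> aM x = a \<and> BM x = B \<and> dM x = d"
    "B = 0 \<and> a\<^sup>2 = c \<and> d\<^sup>2 = h \<and> a \<noteq> d \<or> B \<noteq> 0 \<and> c = 1/2 \<and> d = a \<and> B\<^sup>2 = 4 * a\<^sup>2 - 2"
proof -
  obtain x0 where x0: "x0 \<in> M" using ne by blast
  define c where "c = fM x0"
  have fMc: "fM x = c" if "x \<in> M" for x
    unfolding c_def
  proof (rule zero_derivative_in_charts_imp_constant[OF hyp conn _ that x0])
    fix \<phi> U W u assume ch: "is_chart M \<phi> U W" and u: "u \<in> U"
    interpret hyper_chart U "\<lambda>u. fst (\<phi> u)" "\<lambda>u w. fst (frechet_derivative \<phi> (at u) w)"
      "\<lambda>u. fst (N (\<phi> u))" "\<lambda>u w. fst (frechet_derivative (N \<circ> \<phi>) (at u) w)"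
      "\<lambda>u. snd (\<phi> u)" "\<lambda>u w. snd (frechet_derivative \<phi> (at u) w)"
      "\<lambda>u. snd (N (\<phi> u))" "\<lambda>u w. snd (frechet_derivative (N \<circ> \<phi>) (at u) w)"
      k1 k2 k3 "\<lambda>u. aM (\<phi> u)" "\<lambda>u. BM (\<phi> u)" "\<lambda>u. dM (\<phi> u)" by (rule chart_hyper_chart[OF ch])
    show "((\<lambda>u. fM (\<phi> u)) has_derivative (\<lambda>w. 0)) (at u)"
      using f_derivative_0[OF u] by (simp add: F.f_def[abs_def] fM_def)
  qed
  have pos: "0 < c \<and> 0 < 1 - c"
  proof -
    obtain \<phi> U W u where ch: "is_chart M \<phi> U W" and u: "u \<in> U" and "\<phi> u = x0" by (rule chart_at[OF x0])
    interpret hyper_chart U "\<lambda>u. fst (\<phi> u)" "\<lambda>u w. fst (frechet_derivative \<phi> (at u) w)"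
      "\<lambda>u. fst (N (\<phi> u))" "\<lambda>u w. fst (frechet_derivative (N \<circ> \<phi>) (at u) w)"
      "\<lambda>u. snd (\<phi> u)" "\<lambda>u w. snd (frechet_derivative \<phi> (at u) w)"
      "\<lambda>u. snd (N (\<phi> u))" "\<lambda>u w. snd (frechet_derivative (N \<circ> \<phi>) (at u) w)"
      k1 k2 k3 "\<lambda>u. aM (\<phi> u)" "\<lambda>u. BM (\<phi> u)" "\<lambda>u. dM (\<phi> u)" by (rule chart_hyper_chart[OF ch])
    have f: "f v = c" if "v \<in> U" for v using fMc[OF chart_in_M[OF ch that]] by (simp add: F.f_def fM_def)
    show ?thesis using nondegenerate[OF u] f u unit[OF u] by auto
  qed
  have const: "hyper_chart_const U (\<lambda>u. fst (\<phi> u)) (\<lambda>u w. fst (frechet_derivative \<phi> (at u) w))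
    (\<lambda>u. fst (N (\<phi> u))) (\<lambda>u w. fst (frechet_derivative (N \<circ> \<phi>) (at u) w))
    (\<lambda>u. snd (\<phi> u)) (\<lambda>u w. snd (frechet_derivative \<phi> (at u) w))
    (\<lambda>u. snd (N (\<phi> u))) (\<lambda>u w. snd (frechet_derivative (N \<circ> \<phi>) (at u) w))
    k1 k2 k3 (\<lambda>u. aM (\<phi> u)) (\<lambda>u. BM (\<phi> u)) (\<lambda>u. dM (\<phi> u)) c (1 - c)" if ch: "is_chart M \<phi> U W" for \<phi> U W
  proof -
    interpret hyper_chart U "\<lambda>u. fst (\<phi> u)" "\<lambda>u w. fst (frechet_derivative \<phi> (at u) w)"
      "\<lambda>u. fst (N (\<phi> u))" "\<lambda>u w. fst (frechet_derivative (N \<circ> \<phi>) (at u) w)"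
      "\<lambda>u. snd (\<phi> u)" "\<lambda>u w. snd (frechet_derivative \<phi> (at u) w)"
      "\<lambda>u. snd (N (\<phi> u))" "\<lambda>u w. snd (frechet_derivative (N \<circ> \<phi>) (at u) w)"
      k1 k2 k3 "\<lambda>u. aM (\<phi> u)" "\<lambda>u. BM (\<phi> u)" "\<lambda>u. dM (\<phi> u)" by (rule chart_hyper_chart[OF ch])
    show ?thesis
      by unfold_locales (use pos fMc chart_in_M[OF ch] in \<open>auto simp: F.f_def fM_def\<close>)
  qed
  note SC = hyper_chart_const.shape_coefficients_constant[OF const]
  have a: "aM x = aM x0" and B: "BM x = BM x0" and d: "dM x = dM x0" if "x \<in> M" for x
    by (rule zero_derivative_in_charts_imp_constant[OF hyp conn _ that x0], use SC in blast)+
  obtain \<phi> U W u where ch: "is_chart M \<phi> U W" and u: "u \<in> U" and \<phi>u: "\<phi> u = x0" by (rule chart_at[OF x0])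
  interpret hyper_chart_const U "\<lambda>u. fst (\<phi> u)" "\<lambda>u w. fst (frechet_derivative \<phi> (at u) w)"
      "\<lambda>u. fst (N (\<phi> u))" "\<lambda>u w. fst (frechet_derivative (N \<circ> \<phi>) (at u) w)"
      "\<lambda>u. snd (\<phi> u)" "\<lambda>u w. snd (frechet_derivative \<phi> (at u) w)"
      "\<lambda>u. snd (N (\<phi> u))" "\<lambda>u w. snd (frechet_derivative (N \<circ> \<phi>) (at u) w)"
      k1 k2 k3 "\<lambda>u. aM (\<phi> u)" "\<lambda>u. BM (\<phi> u)" "\<lambda>u. dM (\<phi> u)" c "1 - c" by (rule const[OF ch])
  \<comment> \<open>With \<open>B = 0\<close> the block is diagonal, and equal entries would make
    the discriminant vanish. This is what later removes the parameter 1/2 from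
    \<open>M1m1\<close>.\<close>
  have "aM x0 \<noteq> dM x0" if "BM x0 = 0"
  proof
    assume "aM x0 = dM x0"
    then have "e1 = dM x0 + dM x0" "e2 = dM x0 * dM x0"
      using symmetric_functions(1,2)[OF u] that \<phi>u by simp_all
    then show False using symmetric_functions(4)[OF u] by simp
  qed
  then have "BM x0 = 0 \<and> (aM x0)\<^sup>2 = c \<and> (dM x0)\<^sup>2 = 1 - c \<and> aM x0 \<noteq> dM x0
      \<or> BM x0 \<noteq> 0 \<and> c = 1/2 \<and> dM x0 = aM x0 \<and> (BM x0)\<^sup>2 = 4 * (aM x0)\<^sup>2 - 2"
    using shape_coefficients_constant[OF u] \<phi>u by auto
  with that[of c "1 - c" "aM x0" "BM x0" "dM x0"] fMc a B d pos show thesis by simp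
qed

end

locale constant_shape = three_curvatures +
  fixes c h a B d :: real
  assumes c: "0 < c" "0 < h" "c + h = 1"
    and fM: "x \<in> M \<Longrightarrow> fM x = c" and aM: "x \<in> M \<Longrightarrow> aM x = a" and BM: "x \<in> M \<Longrightarrow> BM x = B" and dM: "x \<in> M \<Longrightarrow> dM x = d"
begin

lemma gM: "x \<in> M \<Longrightarrow> gM x = h"
proof -
  assume x: "x \<in> M"
  then have "gprod (N x) (N x) = 1" using normal unfolding unit_normal_def by blast
  then show ?thesis using fM[OF x] c(3) by (simp add: gprod_def fM_def gM_def)
qed

text \<open>A linear system for the six frame vectors whose coefficients are constants times three
  forms. Any expression in the frame whose differential cancels here is constant on
  \<open>M\<close>.\<close>

lemma frame_equations:
  assumes ch: "is_chart M \<phi> U W" and u: "u \<in> U"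
  shows "\<exists>om be xi. ((\<lambda>v. fst (\<phi> v)) has_derivative (\<lambda>w. (om w / c) *\<^sub>R fst (N (\<phi> u)) + (be w / c) *\<^sub>R E2 (\<phi> u))) (at u)
    \<and> ((\<lambda>v. snd (\<phi> v)) has_derivative (\<lambda>w. - (om w / h) *\<^sub>R snd (N (\<phi> u)) + (xi w / h) *\<^sub>R E3 (\<phi> u))) (at u)
    \<and> ((\<lambda>v. fst (N (\<phi> v))) has_derivative (\<lambda>w. om w *\<^sub>R fst (\<phi> u) - (a * be w / c + B * xi w) *\<^sub>R E2 (\<phi> u))) (at u)
    \<and> ((\<lambda>v. snd (N (\<phi> v))) has_derivative (\<lambda>w. - om w *\<^sub>R snd (\<phi> u) - (B * be w + d * xi w / h) *\<^sub>R E3 (\<phi> u))) (at u)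
    \<and> ((\<lambda>v. E2 (\<phi> v)) has_derivative (\<lambda>w. be w *\<^sub>R fst (\<phi> u) + (a * be w / c + B * xi w) *\<^sub>R fst (N (\<phi> u)))) (at u)
    \<and> ((\<lambda>v. E3 (\<phi> v)) has_derivative (\<lambda>w. xi w *\<^sub>R snd (\<phi> u) + (B * be w + d * xi w / h) *\<^sub>R snd (N (\<phi> u)))) (at u)"
proof -
  interpret hyper_chart U "\<lambda>u. fst (\<phi> u)" "\<lambda>u w. fst (frechet_derivative \<phi> (at u) w)"
    "\<lambda>u. fst (N (\<phi> u))" "\<lambda>u w. fst (frechet_derivative (N \<circ> \<phi>) (at u) w)"
    "\<lambda>u. snd (\<phi> u)" "\<lambda>u w. snd (frechet_derivative \<phi> (at u) w)"
    "\<lambda>u. snd (N (\<phi> u))" "\<lambda>u w. snd (frechet_derivative (N \<circ> \<phi>) (at u) w)"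
    k1 k2 k3 "\<lambda>u. aM (\<phi> u)" "\<lambda>u. BM (\<phi> u)" "\<lambda>u. dM (\<phi> u)" by (rule chart_hyper_chart[OF ch])
  interpret hyper_chart_const U "\<lambda>u. fst (\<phi> u)" "\<lambda>u w. fst (frechet_derivative \<phi> (at u) w)"
    "\<lambda>u. fst (N (\<phi> u))" "\<lambda>u w. fst (frechet_derivative (N \<circ> \<phi>) (at u) w)"
    "\<lambda>u. snd (\<phi> u)" "\<lambda>u w. snd (frechet_derivative \<phi> (at u) w)"
    "\<lambda>u. snd (N (\<phi> u))" "\<lambda>u w. snd (frechet_derivative (N \<circ> \<phi>) (at u) w)"
    k1 k2 k3 "\<lambda>u. aM (\<phi> u)" "\<lambda>u. BM (\<phi> u)" "\<lambda>u. dM (\<phi> u)" c h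
    by unfold_locales (use c fM chart_in_M[OF ch] in \<open>auto simp: F.f_def fM_def\<close>)
  note x = chart_in_M[OF ch u]
  have scale: "y = (1 / s) *\<^sub>R z" if "s *\<^sub>R y = z" "s > 0" for y z :: "real^3" and s :: real
    using that by auto
  have E: "F.e = (\<lambda>v. E2 (\<phi> v))" "G.e = (\<lambda>v. E3 (\<phi> v))" by (simp_all add: fun_eq_iff F.e_def G.e_def E2_def E3_def)
  have ne: "c \<noteq> 0" "h \<noteq> 0" using c by auto
  note k = ka[OF u, unfolded aM[OF x] BM[OF x]] G_ka[OF u, unfolded dM[OF x] BM[OF x]]
  note fg = fc[OF u] gc[OF u]
  have 1: "fst (frechet_derivative \<phi> (at u) w) = (om u w / c) *\<^sub>R fst (N (\<phi> u)) + (be u w / c) *\<^sub>R E2 (\<phi> u)" for w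
    using scale[OF F.p'_expand[OF u, of w, unfolded fg] c(1)] by (simp add: E scaleR_add_right)
  have 2: "snd (frechet_derivative \<phi> (at u) w) = - (om u w / h) *\<^sub>R snd (N (\<phi> u)) + (xi u w / h) *\<^sub>R E3 (\<phi> u)" for w
    using scale[OF G.p'_expand[OF u, of w, unfolded fg] c(2)] by (simp add: E scaleR_add_right scaleR_diff_right G_om[OF u])
  have 3: "fst (frechet_derivative (N \<circ> \<phi>) (at u) w) = om u w *\<^sub>R fst (\<phi> u) - (a * be u w / c + B * xi u w) *\<^sub>R E2 (\<phi> u)" for w
  proof -
    have "(1 / c) * F.ka u w = - (a * be u w / c + B * xi u w)" unfolding k using ne by (simp add: field_simps)
    then show ?thesis
      using scale[OF F.m'_expand[OF u, of w, unfolded fg nu_eq_0[OF u]] c(1)] ne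
      by (simp only: E scaleR_add_right scaleR_scaleR) (simp add: scaleR_add_left scaleR_diff_left)
  qed
  have 4: "snd (frechet_derivative (N \<circ> \<phi>) (at u) w) = - om u w *\<^sub>R snd (\<phi> u) - (B * be u w + d * xi u w / h) *\<^sub>R E3 (\<phi> u)" for w
  proof -
    have "(1 / h) * G.ka u w = - (B * be u w + d * xi u w / h)" unfolding k using ne by (simp add: field_simps)
    then show ?thesis
      using scale[OF G.m'_expand[OF u, of w, unfolded fg G_nu_eq_0[OF u] G_om[OF u]] c(2)] ne
      by (simp only: E scaleR_add_right scaleR_scaleR) (simp add: scaleR_add_left scaleR_diff_left)
  qed
  have 5: "lcross (fst (\<phi> u)) (fst (frechet_derivative (N \<circ> \<phi>) (at u) w)) + lcross (fst (frechet_derivative \<phi> (at u) w)) (fst (N (\<phi> u)))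
      = be u w *\<^sub>R fst (\<phi> u) + (a * be u w / c + B * xi u w) *\<^sub>R fst (N (\<phi> u))" for w
  proof -
    have "(1 / c) * F.ka u w = - (a * be u w / c + B * xi u w)" unfolding k using ne by (simp add: field_simps)
    then show ?thesis
      using scale[OF F.e'_expand[OF u, of w, unfolded fg nu_eq_0[OF u]] c(1)] ne
      by (simp only: E scaleR_add_right scaleR_diff_right scaleR_scaleR) (simp add: scaleR_add_left scaleR_diff_left)
  qed
  have 6: "lcross (snd (\<phi> u)) (snd (frechet_derivative (N \<circ> \<phi>) (at u) w)) + lcross (snd (frechet_derivative \<phi> (at u) w)) (snd (N (\<phi> u)))
      = xi u w *\<^sub>R snd (\<phi> u) + (B * be u w + d * xi u w / h) *\<^sub>R snd (N (\<phi> u))" for w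
  proof -
    have "(1 / h) * G.ka u w = - (B * be u w + d * xi u w / h)" unfolding k using ne by (simp add: field_simps)
    then show ?thesis
      using scale[OF G.e'_expand[OF u, of w, unfolded fg G_nu_eq_0[OF u]] c(2)] ne
      by (simp only: E scaleR_add_right scaleR_diff_right scaleR_scaleR) (simp add: scaleR_add_left scaleR_diff_left)
  qed
  show ?thesis
    using F.p_deriv[OF u] G.p_deriv[OF u] F.m_deriv[OF u] G.m_deriv[OF u] F.e_deriv0[OF u] G.e_deriv0[OF u]
    unfolding 1 2 3 4 unfolding 5[unfolded 1 3] 6[unfolded 2 4] E
    by (intro exI[of _ "om u"] exI[of _ "be u"] exI[of _ "xi u"] conjI)
qed

end

subsection \<open>The model hypersurfaces\<close>

text \<open>Of the model only local continuous injections into three-space are required. Composed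
  with \<Phi> and a chart of \<open>M\<close> they are continuous injections between spaces of equal
  dimension, hence open by invariance of domain.\<close>

lemma hypersurface_image_open_part:
  fixes \<Phi> :: "pt \<Rightarrow> pt"
  assumes M: "hypersurface M" and \<Phi>: "continuous_on UNIV \<Phi>" "inj_on \<Phi> M" "\<Phi> ` M \<subseteq> S"
    and coord: "\<And>y. y \<in> S \<Longrightarrow> \<exists>T (\<eta> :: pt \<Rightarrow> real^3). open T \<and> y \<in> T \<and> continuous_on (S \<inter> T) \<eta> \<and> inj_on \<eta> (S \<inter> T)"
  shows "openin (top_of_set S) (\<Phi> ` M)"
proof (subst openin_subopen, intro ballI)
  fix y assume "y \<in> \<Phi> ` M"
  then obtain x where x: "x \<in> M" "y = \<Phi> x" by blast
  obtain \<phi> U W where c: "is_chart M \<phi> U W" and "x \<in> W" using M x(1) unfolding hypersurface_def by blast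
  then obtain \<psi> where h: "homeomorphism U (M \<inter> W) \<phi> \<psi>" and U: "open U" unfolding is_chart_def by blast
  obtain u where u: "u \<in> U" "\<phi> u = x" using h x(1) \<open>x \<in> W\<close> unfolding homeomorphism_def by blast
  obtain T and \<eta> :: "pt \<Rightarrow> real^3" where T: "open T" "y \<in> T" "continuous_on (S \<inter> T) \<eta>" "inj_on \<eta> (S \<inter> T)"
    using coord \<Phi>(3) x by blast
  have \<phi>U: "\<phi> ` U \<subseteq> M" using homeomorphism_image1[OF h] by blast
  have inj\<phi>: "inj_on \<phi> U" using homeomorphism_apply1[OF h] by (metis inj_on_inverseI)
  have cont: "continuous_on U (\<Phi> \<circ> \<phi>)"
    using homeomorphism_cont1[OF h] continuous_on_subset[OF \<Phi>(1)] by (intro continuous_on_compose) auto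
  define U' where "U' = U \<inter> (\<Phi> \<circ> \<phi>) -` T"
  have U'o: "open U'" unfolding U'_def using continuous_open_preimage[OF cont U T(1)] .
  have im: "(\<Phi> \<circ> \<phi>) ` U' \<subseteq> S \<inter> T" using \<phi>U \<Phi>(3) unfolding U'_def by auto
  have "inj_on (\<Phi> \<circ> \<phi>) U'"
    by (rule comp_inj_on) (use inj\<phi> \<Phi>(2) \<phi>U in \<open>auto simp: U'_def intro: inj_on_subset\<close>)
  then have "inj_on (\<eta> \<circ> (\<Phi> \<circ> \<phi>)) U'" by (rule comp_inj_on) (rule inj_on_subset[OF T(4) im])
  moreover have "continuous_on U' (\<eta> \<circ> (\<Phi> \<circ> \<phi>))"
    by (intro continuous_on_compose continuous_on_subset[OF T(3) im] continuous_on_subset[OF cont]) (auto simp: U'_def)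
  ultimately have O: "open ((\<eta> \<circ> (\<Phi> \<circ> \<phi>)) ` U')" using invariance_of_domain U'o by blast
  let ?Z = "S \<inter> T \<inter> \<eta> -` ((\<eta> \<circ> (\<Phi> \<circ> \<phi>)) ` U')"
  have "openin (top_of_set (S \<inter> T)) ?Z" by (rule continuous_openin_preimage_gen[OF T(3) O])
  moreover have "openin (top_of_set S) (S \<inter> T)" using T(1) by blast
  ultimately have "openin (top_of_set S) ?Z" by (rule openin_trans)
  moreover have "y \<in> ?Z" using u x T(2) \<Phi>(3) by (auto simp: U'_def intro!: image_eqI[of _ _ u])
  moreover have "?Z \<subseteq> \<Phi> ` M"
  proof
    fix z assume z: "z \<in> ?Z"
    then obtain v where v: "v \<in> U'" "\<eta> z = \<eta> (\<Phi> (\<phi> v))" by auto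
    then have "z = \<Phi> (\<phi> v)" using T(4) z im by (auto dest!: inj_onD)
    then show "z \<in> \<Phi> ` M" using v(1) \<phi>U by (auto simp: U'_def)
  qed
  ultimately show "\<exists>Z. openin (top_of_set S) Z \<and> y \<in> Z \<and> Z \<subseteq> \<Phi> ` M" by blast
qed

lemma continuous_on_vec3 [continuous_intros]:
  assumes "continuous_on S f" "continuous_on S g" "continuous_on S h"
  shows "continuous_on S (\<lambda>x. vec3 (f x) (g x) (h x))"
proof -
  have "continuous_on S (\<lambda>x. if i = 1 then f x else if i = 2 then g x else h x)" for i :: 3
    by (cases "i = 1"; cases "i = 2") (use assms in simp_all)
  then show ?thesis unfolding vec3_def by (rule continuous_on_vec_lambda)
qed

lemma H2_13_pos:
  assumes "y \<in> H2" shows "y$1 - y$3 > 0"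
proof -
  have "(y$1)\<^sup>2 = 1 + (y$2)\<^sup>2 + (y$3)\<^sup>2" "0 < y$1" using assms by (auto simp: H2_def lor_def power2_eq_square)
  then have "(y$3)\<^sup>2 < (y$1)\<^sup>2" "0 < y$1" using zero_le_power2[of "y$2"] by linarith+
  then have "y$3 < y$1" by (meson less_imp_le power_less_imp_less_base)
  then show ?thesis by simp
qed

text \<open>Horocyclic coordinates for the point at infinity of the null vector (1, 0, 1):
  \<open>y$1 - y$3\<close> is minus the pairing with it, so \<open>s\<close> is a Busemann function
  and \<open>y$2 / (y$1 - y$3)\<close> the parameter on the horocycle.\<close>

lemma H2_horocyclic:
  assumes y: "y \<in> H2" and s: "exp (- s) = y$1 - y$3"
  shows "y = cosh s *\<^sub>R gam (y$2 / (y$1 - y$3)) + sinh s *\<^sub>R Nvec (y$2 / (y$1 - y$3))"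
proof -
  define P where "P = y$1 - y$3"
  define r where "r = y$2 / P"
  have P: "P > 0" unfolding P_def by (rule H2_13_pos[OF y])
  have r: "y$2 = P * r" using P by (simp add: r_def)
  have es: "exp (- s) = P" "exp s = 1 / P" using s P by (simp_all add: P_def[symmetric] exp_minus field_simps)
  have c: "cosh s = (1 / P + P) / 2" "sinh s = (1 / P - P) / 2" by (simp_all add: cosh_def sinh_def es)
  have "(y$1)\<^sup>2 = 1 + (y$2)\<^sup>2 + (y$3)\<^sup>2" using y by (simp add: H2_def lor_def power2_eq_square)
  then have "P * (y$1 + y$3) = 1 + (y$2)\<^sup>2" unfolding P_def by (simp add: power2_eq_square algebra_simps)
  then have "P * (y$1 + y$3) = 1 + (P * r)\<^sup>2" unfolding r .
  then have sum: "y$1 + y$3 = 1 / P + P * r\<^sup>2" using P by (simp add: field_simps power2_eq_square)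
  have y1: "y$1 = (1 / P + P * r\<^sup>2 + P) / 2" and y3: "y$3 = (1 / P + P * r\<^sup>2 - P) / 2"
    unfolding sum[symmetric] by (simp_all add: P_def)
  have "y = cosh s *\<^sub>R gam r + sinh s *\<^sub>R Nvec r"
    unfolding c vec_eq_iff forall_3 using P by (simp add: gam_def Nvec_def y1 y3 r field_simps power2_eq_square)
  then show ?thesis by (simp add: r_def P_def)
qed

lemma Nminus_eq: "Nminus s = - Nvec s"
  by (simp add: Nminus_def Nvec_def vec_eq_iff forall_3 field_simps)

lemma in_M11:
  assumes c: "0 < c" "c < 1" and y: "y \<in> H2" "z \<in> H2"
    and eq: "sqrt (1 - c) * ln (y$1 - y$3) = sqrt c * ln (z$1 - z$3)"
  shows "(y, z) \<in> M11 c"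
proof -
  define t where "t = - ln (y$1 - y$3) / sqrt c"
  note P = H2_13_pos[OF y(1)] H2_13_pos[OF y(2)]
  have "exp (- (sqrt c * t)) = y$1 - y$3" using c P by (simp add: t_def)
  moreover have "ln (z$1 - z$3) = - (sqrt (1 - c) * t)" using c eq by (simp add: t_def field_simps)
  then have "exp (- (sqrt (1 - c) * t)) = z$1 - z$3" using P by (metis exp_ln)
  ultimately show ?thesis using H2_horocyclic[OF y(1)] H2_horocyclic[OF y(2)]
    unfolding M11_def Mc_def by (intro image_eqI[of _ _ "(t, y$2 / (y$1 - y$3), z$2 / (z$1 - z$3))"]) auto
qed

text \<open>Since \<open>Nminus = - Nvec\<close>, the second factor crosses its horocycles with the
  opposite sign of \<open>t\<close>; this is the only difference from \<open>in_M11\<close>.\<close>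

lemma in_M1m1:
  assumes c: "0 < c" "c < 1" and y: "y \<in> H2" "z \<in> H2"
    and eq: "sqrt (1 - c) * ln (y$1 - y$3) = - sqrt c * ln (z$1 - z$3)"
  shows "(y, z) \<in> M1m1 c"
proof -
  define t where "t = - ln (y$1 - y$3) / sqrt c"
  note P = H2_13_pos[OF y(1)] H2_13_pos[OF y(2)]
  have "exp (- (sqrt c * t)) = y$1 - y$3" using c P by (simp add: t_def)
  moreover have "ln (z$1 - z$3) = - (- (sqrt (1 - c) * t))" using c eq by (simp add: t_def field_simps)
  then have "exp (- (- (sqrt (1 - c) * t))) = z$1 - z$3" using P by (metis exp_ln)
  ultimately show ?thesis using H2_horocyclic[OF y(1), of "sqrt c * t"] H2_horocyclic[OF y(2), of "- (sqrt (1 - c) * t)"]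
    unfolding M1m1_def Mc_def by (intro image_eqI[of _ _ "(t, y$2 / (y$1 - y$3), z$2 / (z$1 - z$3))"]) (auto simp: Nminus_eq)
qed

text \<open>One map serves the whole model: its first entry \<open>exp (- (sqrt c * t))\<close>
  gives \<open>t\<close>, then the second gives \<open>r\<close> and the third
  \<open>s\<close>.\<close>

lemma Mc_coordinates:
  assumes c: "0 < c" "c < 1" and Nt: "Nt = Nvec \<or> Nt = Nminus"
  defines "\<eta> \<equiv> \<lambda>x :: pt. vec3 (fst x$1 - fst x$3) (fst x$2) (snd x$2)"
  shows "continuous_on UNIV \<eta>" "inj_on \<eta> (Mc c Nt)"
proof -
  show "continuous_on UNIV \<eta>" unfolding \<eta>_def by (intro continuous_intros)
  show "inj_on \<eta> (Mc c Nt)"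
  proof (rule inj_onI)
    fix x x' assume "x \<in> Mc c Nt" "x' \<in> Mc c Nt" and eq: "\<eta> x = \<eta> x'"
    then obtain t r s t' r' s' where x: "x = (cosh (sqrt c * t) *\<^sub>R gam r + sinh (sqrt c * t) *\<^sub>R Nvec r,
          cosh (sqrt (1 - c) * t) *\<^sub>R gam s + sinh (sqrt (1 - c) * t) *\<^sub>R Nt s)"
        and x': "x' = (cosh (sqrt c * t') *\<^sub>R gam r' + sinh (sqrt c * t') *\<^sub>R Nvec r',
          cosh (sqrt (1 - c) * t') *\<^sub>R gam s' + sinh (sqrt (1 - c) * t') *\<^sub>R Nt s')"
      by (auto simp: Mc_def)
    define \<sigma> :: real where "\<sigma> = (if Nt = Nvec then 1 else -1)"
    have Nt2: "Nt r $ 2 = - \<sigma> * r" for r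
      using Nt by (auto simp: \<sigma>_def Nvec_def Nminus_def)
    have d: "cosh z *\<^sub>R gam r $ 1 + sinh z * Nvec r $ 1 - (cosh z * gam r $ 3 + sinh z * Nvec r $ 3) = exp (- z)" for z r :: real
      by (simp add: gam_def Nvec_def field_simps cosh_minus_sinh[symmetric])
    have "exp (- (sqrt c * t)) = exp (- (sqrt c * t'))"
      using eq d[of "sqrt c * t" r] d[of "sqrt c * t'" r'] by (simp add: \<eta>_def x x' vec_eq_iff forall_3)
    then have t: "t = t'" using c by simp
    have "exp (- (sqrt c * t)) * r = exp (- (sqrt c * t')) * r'"
      using eq by (simp add: \<eta>_def x x' vec_eq_iff forall_3 gam_def Nvec_def cosh_minus_sinh[symmetric] left_diff_distrib)
    then have r: "r = r'" using t by simp
    let ?z = "sqrt (1 - c) * t"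
    have "cosh ?z * s - sinh ?z * (\<sigma> * s) = cosh ?z * s' - sinh ?z * (\<sigma> * s')"
      using eq t by (simp add: \<eta>_def x x' vec_eq_iff forall_3 gam_def Nt2)
    then have "(cosh ?z - \<sigma> * sinh ?z) * s = (cosh ?z - \<sigma> * sinh ?z) * s'" unfolding left_diff_distrib by (simp add: mult_ac)
    moreover have "cosh ?z - \<sigma> * sinh ?z \<noteq> 0"
      using cosh_minus_sinh[of ?z] cosh_plus_sinh[of ?z] by (auto simp: \<sigma>_def)
    ultimately have "s = s'" by simp
    then show "x = x'" using t r x x' by simp
  qed
qed

text \<open>The last two coordinates fix \<open>p\<close>. The admissible \<open>q\<close> form a
  circle about \<open>p\<close>, and the component along \<open>lcross p q0\<close> is its
  coordinate: \<alpha> > 0 selects the half on the side of \<open>q0\<close>, and \<nu> > 0 keeps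
  the projection of \<open>q0\<close> orthogonal to \<open>p\<close> nonzero.\<close>

lemma Mtau_coordinates:
  assumes y0: "(p0, q0) \<in> Mtau \<tau>" and \<tau>: "\<tau> < -1"
  defines "\<eta> \<equiv> \<lambda>x :: pt. vec3 (fst x$2) (fst x$3) (lor (lcross (fst x) q0) (snd x))"
    and "\<alpha> \<equiv> \<lambda>x :: pt. lor q0 (snd x) + lor (fst x) q0 * lor (fst x) (snd x)"
    and "\<nu> \<equiv> \<lambda>x :: pt. (lor (fst x) q0)\<^sup>2 - 1"
  shows "\<exists>T (\<eta> :: pt \<Rightarrow> real^3). open T \<and> (p0, q0) \<in> T \<and> continuous_on (Mtau \<tau> \<inter> T) \<eta> \<and> inj_on \<eta> (Mtau \<tau> \<inter> T)"
proof -
  let ?T = "{x. \<alpha> x > 0} \<inter> {x. \<nu> x > 0}"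
  have lc: "continuous_on UNIV (\<lambda>x::pt. lor (fst x) (snd x))" "continuous_on UNIV (\<lambda>x::pt. lor (fst x) q0)"
      "continuous_on UNIV (\<lambda>x::pt. lor q0 (snd x))"
    by (intro lor.continuous_on continuous_intros)+
  have "open ?T" unfolding \<alpha>_def \<nu>_def
    by (intro open_Int open_Collect_less continuous_intros lc)
  moreover have "(p0, q0) \<in> ?T"
  proof -
    have q: "lor q0 q0 = -1" "lor p0 q0 = \<tau>" using y0 by (auto simp: Mtau_def HH_def H2_def)
    have "1 < \<tau>\<^sup>2" using \<tau> power_strict_mono[of 1 "- \<tau>" 2] by simp
    then show ?thesis by (simp add: \<alpha>_def \<nu>_def q power2_eq_square)
  qed
  moreover have "continuous_on (Mtau \<tau> \<inter> ?T) \<eta>"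
  proof -
    have "continuous_on UNIV \<eta>"
      unfolding \<eta>_def by (intro continuous_intros lor.continuous_on lcross.continuous_on)
    then show ?thesis by (rule continuous_on_subset) simp
  qed
  moreover have "inj_on \<eta> (Mtau \<tau> \<inter> ?T)"
  proof (rule inj_onI, clarify)
    fix p q p' q'
    assume M: "(p, q) \<in> Mtau \<tau>" "(p', q') \<in> Mtau \<tau>" and pos: "\<alpha> (p, q) > 0" "\<alpha> (p', q') > 0" "\<nu> (p, q) > 0" "\<nu> (p', q') > 0"
      and eq: "\<eta> (p, q) = \<eta> (p', q')"
    have H: "p \<in> H2" "p' \<in> H2" "q \<in> H2" "q' \<in> H2" "lor p q = \<tau>" "lor p' q' = \<tau>" using M by (auto simp: Mtau_def HH_def)
    have e: "p$2 = p'$2" "p$3 = p'$3" "lor (lcross p q0) q = lor (lcross p' q0) q'"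
      using eq by (auto simp: \<eta>_def vec_eq_iff forall_3)
    have "(p$1)\<^sup>2 = (p'$1)\<^sup>2" "p$1 > 0" "p'$1 > 0" using H(1,2) e(1,2) by (auto simp: H2_def lor_def power2_eq_square)
    then have "p$1 = p'$1" by (simp add: power2_eq_iff)
    with e have pp: "p' = p" by (simp add: vec_eq_iff forall_3)
    define w where "w = q0 + lor p q0 *\<^sub>R p"
    have p1: "lor p p = -1" using H by (simp add: H2_def)
    have q0: "lor q0 q0 = -1" using y0 by (simp add: Mtau_def HH_def H2_def)
    have pw: "lor p w = 0" by (simp add: w_def lor_simps p1)
    have ww: "lor w w = \<nu> (p, q)" by (simp add: w_def lor_simps p1 q0 \<nu>_def lor_commute[of q0 p] power2_eq_square)
    have cw: "lcross p w = lcross p q0"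
    proof -
      have "lcross p p = 0" by (simp add: lcross_def vec_eq_iff forall_3)
      then show ?thesis by (simp add: w_def lcross.add_right lcross.scaleR_right)
    qed
    have al: "lor w q = \<alpha> (p, q)" "lor w q' = \<alpha> (p, q')" by (simp_all add: w_def lor_simps \<alpha>_def)
    have qq: "lor q q = -1" "lor q' q' = -1" using H by (auto simp: H2_def)
    have "(lor w x)\<^sup>2 = lor w w * \<tau>\<^sup>2 - lor w w - (lor (lcross p q0) x)\<^sup>2" if "lor x x = -1" "lor p x = \<tau>" for x
      using lorentz_parseval[OF p1 pw, of x x] that unfolding cw by (simp add: power2_eq_square)
    then have "(lor w q)\<^sup>2 = (lor w q')\<^sup>2" using e(3) qq H(5,6) unfolding pp by simp
    then have lw: "lor w q = lor w q'" using pos al pp by (simp add: power2_eq_iff)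
    have "lor w w *\<^sub>R q = lor w w *\<^sub>R q'"
      unfolding lorentz_expand[OF p1 pw, of q] lorentz_expand[OF p1 pw, of q'] cw using lw e(3) pp H(5,6) by simp
    then have "q = q'" using pos ww by simp
    with pp show "p = p' \<and> q = q'" by simp
  qed
  ultimately show ?thesis by blast
qed

subsection \<open>Identification with the models\<close>

text \<open>By Cauchy-Schwarz the time component dominates the pairing of a null vector with a point
  of \<open>H2\<close>. This keeps the arguments of the logarithms in the horospherical case
  positive.\<close>

lemma null_vector_sign:
  assumes l: "lor l l = 0" and y: "y \<in> H2"
  shows "lor y l < 0 \<longleftrightarrow> l$1 > 0"
proof -
  have l1: "(l$1)\<^sup>2 = (l$2)\<^sup>2 + (l$3)\<^sup>2" using l by (simp add: lor_def power2_eq_square)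
  have y1: "(y$1)\<^sup>2 = 1 + ((y$2)\<^sup>2 + (y$3)\<^sup>2)" and y0: "y$1 > 0" using y by (auto simp: H2_def lor_def power2_eq_square)
  let ?s = "y$2 * l$2 + y$3 * l$3"
  have "?s\<^sup>2 \<le> ((y$2)\<^sup>2 + (y$3)\<^sup>2) * ((l$2)\<^sup>2 + (l$3)\<^sup>2)"
    using zero_le_power2[of "y$2 * l$3 - y$3 * l$2"] by (simp add: power2_eq_square algebra_simps)
  also have "\<dots> = (y$1 * l$1)\<^sup>2 - (l$1)\<^sup>2" unfolding power_mult_distrib l1 y1 by (simp add: algebra_simps)
  finally have s: "?s\<^sup>2 \<le> (y$1 * l$1)\<^sup>2 - (l$1)\<^sup>2" .
  have "?s\<^sup>2 < (y$1 * l$1)\<^sup>2" if "l$1 \<noteq> 0"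
  proof -
    have "(l$1)\<^sup>2 > 0" using that by simp
    with s show ?thesis by linarith
  qed
  then have abs: "\<bar>?s\<bar> < \<bar>y$1 * l$1\<bar>" if "l$1 \<noteq> 0" using that by (meson abs_le_square_iff linorder_not_less)
  have "?s = 0" if "l$1 = 0" using s that by simp
  moreover have "y$1 * l$1 < 0" if "l$1 < 0" using that y0 by (simp add: mult_pos_neg)
  moreover have "y$1 * l$1 > 0" if "l$1 > 0" using that y0 by simp
  ultimately show ?thesis using abs unfolding lor_def
    by (cases "l$1" "0 :: real" rule: linorder_cases) (fastforce simp: abs_if split: if_splits)+
qed

text \<open>Only the length of \<open>l\<close> varies, not its line; dividing by the pairing with a
  fixed vector removes the length.\<close>

lemma scaled_derivative_imp_direction_constant:
  fixes l :: "'a::real_normed_vector \<Rightarrow> real^3"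
  assumes l: "(l has_derivative (\<lambda>w. \<theta> w *\<^sub>R l u)) (at u)" and nz: "lor y (l u) \<noteq> 0"
  shows "((\<lambda>v. (1 / lor y (l v)) *\<^sub>R l v) has_derivative (\<lambda>w. 0)) (at u)"
proof -
  have d: "((\<lambda>v. lor y (l v)) has_derivative (\<lambda>w. \<theta> w * lor y (l u))) (at u)"
    using lor.FDERIV[OF has_derivative_const l, of y] by (simp add: lor_simps)
  have "((\<lambda>v. (1 / lor y (l v)) *\<^sub>R l v) has_derivative (\<lambda>w. (1 / lor y (l u)) *\<^sub>R (\<theta> w *\<^sub>R l u)
      + ((0 * lor y (l u) - 1 * (\<theta> w * lor y (l u))) / (lor y (l u) * lor y (l u))) *\<^sub>R l u)) (at u)"
    by (intro has_derivative_scaleR has_derivative_divide' has_derivative_const d l nz)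
  then show ?thesis using nz by (simp add: scaleR_add_left[symmetric])
qed

context constant_shape
begin

lemma normal_products:
  assumes "x \<in> M"
  shows "lor (fst x) (fst x) = -1" "lor (snd x) (snd x) = -1" "lor (fst x) (fst (N x)) = 0" "lor (snd x) (snd (N x)) = 0"
    "lor (fst (N x)) (fst (N x)) = c" "lor (snd (N x)) (snd (N x)) = h"
  using in_H2[OF assms] fM[OF assms] gM[OF assms] normal assms
  by (auto simp: H2_def fM_def gM_def unit_normal_def tangent_HH_def lor_commute)

lemma frame_map_product_isometry:
  assumes "y \<in> H2" "lor y m = 0" "lor m m = 1" "\<epsilon>\<^sup>2 = 1" "z \<in> H2" "lor z n = 0" "lor n n = 1"
  defines "\<Phi> \<equiv> map_prod (frame_map \<epsilon> y m) (frame_map 1 z n)"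
  shows "isometry_HH \<Phi>" "continuous_on UNIV \<Phi>" "inj_on \<Phi> M" "x \<in> M \<Longrightarrow> fst (\<Phi> x) \<in> H2" "x \<in> M \<Longrightarrow> snd (\<Phi> x) \<in> H2"
proof -
  have pp: "lor y y = -1" "lor z z = -1" using assms by (auto simp: H2_def)
  have b: "bij_betw (frame_map \<epsilon> y m) H2 H2" "bij_betw (frame_map 1 z n) H2 H2"
    using frame_map_bij assms(1-7) by auto
  show iso: "isometry_HH \<Phi>"
    unfolding \<Phi>_def using frame_map_lor pp assms(2-4,6,7) by (intro isometry_map_prod b) auto
  have "continuous_on UNIV (\<lambda>x :: pt. (frame_map \<epsilon> y m (fst x), frame_map 1 z n (snd x)))"
    by (rule continuous_on_Pair[OF linear_continuous_on_compose[OF continuous_on_fst[OF continuous_on_id] frame_map_linear]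
        linear_continuous_on_compose[OF continuous_on_snd[OF continuous_on_id] frame_map_linear]])
  then show "continuous_on UNIV \<Phi>" unfolding \<Phi>_def by (simp add: map_prod_def case_prod_unfold)
  have "M \<subseteq> HH" using hyp by (simp add: hypersurface_def)
  then show "inj_on \<Phi> M" using iso inj_on_subset[of \<Phi> HH M] unfolding isometry_HH_def bij_betw_def by simp
  show "fst (\<Phi> x) \<in> H2" "snd (\<Phi> x) \<in> H2" if "x \<in> M"
    using b in_H2[OF that] unfolding \<Phi>_def bij_betw_def by (auto simp: fst_map_prod snd_map_prod)
qed

lemma horospherical_case:
  assumes B0: "B = 0" and a2: "a\<^sup>2 = c" and d2: "d\<^sup>2 = h" and ad: "a \<noteq> d"
  shows "(\<exists>c. (0 < c \<and> c < 1/2 \<or> 1/2 < c \<and> c < 1) \<and> open_part_upto_isometry M (M1m1 c))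
       \<or> (\<exists>c. 0 < c \<and> c < 1 \<and> open_part_upto_isometry M (M11 c))"
proof -
  obtain x0 where x0: "x0 \<in> M" using ne by blast
  have nz: "a \<noteq> 0" "d \<noteq> 0" using a2 d2 c by auto
  \<comment> \<open>The endpoints at infinity of the geodesics in direction \<open>V\<close>: their null directions are constant.\<close>
  define l1 where "l1 x = fst x + (1 / a) *\<^sub>R fst (N x)" for x
  define l2 where "l2 x = snd x + (1 / d) *\<^sub>R snd (N x)" for x
  have prod: "lor (l1 x) (l1 x) = 0" "lor (l2 x) (l2 x) = 0" "lor (fst x) (l1 x) = -1" "lor (snd x) (l2 x) = -1" if "x \<in> M" for x
    using normal_products[OF that] nz a2 d2 c(1,2)
    by (simp_all add: l1_def l2_def lor_simps lor_commute[of "fst (N x)" "fst x"] lor_commute[of "snd (N x)" "snd x"] power2_eq_square)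
  have neg: "lor y (l1 x) < 0" "lor y (l2 x) < 0" if "x \<in> M" "y \<in> H2" for x y
  proof -
    have "l1 x $ 1 > 0" "l2 x $ 1 > 0"
      using prod[OF that(1)] null_vector_sign[of "l1 x" "fst x"] null_vector_sign[of "l2 x" "snd x"] in_H2[OF that(1)] by simp_all
    then show "lor y (l1 x) < 0" "lor y (l2 x) < 0"
      using prod(1,2)[OF that(1)] null_vector_sign[OF _ that(2)] by simp_all
  qed
  have deriv: "\<exists>\<theta>. ((\<lambda>v. l1 (\<phi> v)) has_derivative (\<lambda>w. (\<theta> w / a) *\<^sub>R l1 (\<phi> u))) (at u)
      \<and> ((\<lambda>v. l2 (\<phi> v)) has_derivative (\<lambda>w. (- \<theta> w / d) *\<^sub>R l2 (\<phi> u))) (at u)"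
    if ch: "is_chart M \<phi> U W" and u: "u \<in> U" for \<phi> U W u
  proof -
    obtain om be xi where
      D: "((\<lambda>v. fst (\<phi> v)) has_derivative (\<lambda>w. (om w / c) *\<^sub>R fst (N (\<phi> u)) + (be w / c) *\<^sub>R E2 (\<phi> u))) (at u)"
        "((\<lambda>v. snd (\<phi> v)) has_derivative (\<lambda>w. - (om w / h) *\<^sub>R snd (N (\<phi> u)) + (xi w / h) *\<^sub>R E3 (\<phi> u))) (at u)"
        "((\<lambda>v. fst (N (\<phi> v))) has_derivative (\<lambda>w. om w *\<^sub>R fst (\<phi> u) - (a * be w / c + B * xi w) *\<^sub>R E2 (\<phi> u))) (at u)"
        "((\<lambda>v. snd (N (\<phi> v))) has_derivative (\<lambda>w. - om w *\<^sub>R snd (\<phi> u) - (B * be w + d * xi w / h) *\<^sub>R E3 (\<phi> u))) (at u)"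
      using frame_equations[OF ch u] by blast
    have ca: "c = a * a" "h = d * d" using a2 d2 by (simp_all add: power2_eq_square)
    have "(om w / c) *\<^sub>R fst (N (\<phi> u)) + (be w / c) *\<^sub>R E2 (\<phi> u) + (1 / a) *\<^sub>R (om w *\<^sub>R fst (\<phi> u) - (a * be w / c + B * xi w) *\<^sub>R E2 (\<phi> u))
        = (om w / a) *\<^sub>R l1 (\<phi> u)" for w
      unfolding l1_def ca B0 using nz by (simp add: scaleR_add_right scaleR_diff_right)
    moreover have "- (om w / h) *\<^sub>R snd (N (\<phi> u)) + (xi w / h) *\<^sub>R E3 (\<phi> u) + (1 / d) *\<^sub>R (- om w *\<^sub>R snd (\<phi> u) - (B * be w + d * xi w / h) *\<^sub>R E3 (\<phi> u))
        = (- om w / d) *\<^sub>R l2 (\<phi> u)" for w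
      unfolding l2_def ca B0 using nz by (simp add: scaleR_add_right scaleR_diff_right)
    ultimately show ?thesis
      using has_derivative_add[OF D(1) has_derivative_scaleR_right[OF D(3), of "1 / a"]]
        has_derivative_add[OF D(2) has_derivative_scaleR_right[OF D(4), of "1 / d"]]
      by (intro exI[of _ om] conjI) (simp_all add: l1_def l2_def)
  qed
  \<comment> \<open>The lengths of the null vectors relative to \<open>x0\<close>. They are
    exponentials of Busemann functions, with logarithmic derivatives \<open>\<theta> / a\<close> and
    \<open>- \<theta> / d\<close>; the relation \<open>rel\<close> cancels these.\<close>
  define \<Lambda>1 where "\<Lambda>1 x = - lor (fst x0) (l1 x)" for x
  define \<Lambda>2 where "\<Lambda>2 x = - lor (snd x0) (l2 x)" for x
  have pos: "\<Lambda>1 x > 0" "\<Lambda>2 x > 0" if "x \<in> M" for x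
    using neg[OF that] in_H2[OF x0] by (auto simp: \<Lambda>1_def \<Lambda>2_def)
  have at0: "\<Lambda>1 x0 = 1" "\<Lambda>2 x0 = 1" using prod[OF x0] by (simp_all add: \<Lambda>1_def \<Lambda>2_def)
  have dir1: "l1 x = \<Lambda>1 x *\<^sub>R l1 x0" if x: "x \<in> M" for x
  proof -
    have "(1 / lor (fst x0) (l1 x)) *\<^sub>R l1 x = (1 / lor (fst x0) (l1 x0)) *\<^sub>R l1 x0"
    proof (rule zero_derivative_in_charts_imp_constant[OF hyp conn _ x x0])
      fix \<phi> U W u assume ch: "is_chart M \<phi> U W" and u: "u \<in> U"
      obtain \<theta> where "((\<lambda>v. l1 (\<phi> v)) has_derivative (\<lambda>w. (\<theta> w / a) *\<^sub>R l1 (\<phi> u))) (at u)" using deriv[OF ch u] by blast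
      then show "((\<lambda>u. (1 / lor (fst x0) (l1 (\<phi> u))) *\<^sub>R l1 (\<phi> u)) has_derivative (\<lambda>w. 0)) (at u)"
        by (rule scaled_derivative_imp_direction_constant)
          (use neg(1)[OF chart_in_M[OF ch u] in_H2(1)[OF x0]] in simp)
    qed
    then have "lor (fst x0) (l1 x) *\<^sub>R ((1 / lor (fst x0) (l1 x)) *\<^sub>R l1 x) = lor (fst x0) (l1 x) *\<^sub>R ((1 / lor (fst x0) (l1 x0)) *\<^sub>R l1 x0)" by simp
    then show ?thesis using neg(1)[OF x in_H2(1)[OF x0]] prod(3)[OF x0] by (simp add: \<Lambda>1_def)
  qed
  have dir2: "l2 x = \<Lambda>2 x *\<^sub>R l2 x0" if x: "x \<in> M" for x
  proof -
    have "(1 / lor (snd x0) (l2 x)) *\<^sub>R l2 x = (1 / lor (snd x0) (l2 x0)) *\<^sub>R l2 x0"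
    proof (rule zero_derivative_in_charts_imp_constant[OF hyp conn _ x x0])
      fix \<phi> U W u assume ch: "is_chart M \<phi> U W" and u: "u \<in> U"
      obtain \<theta> where "((\<lambda>v. l2 (\<phi> v)) has_derivative (\<lambda>w. (- \<theta> w / d) *\<^sub>R l2 (\<phi> u))) (at u)" using deriv[OF ch u] by blast
      then show "((\<lambda>u. (1 / lor (snd x0) (l2 (\<phi> u))) *\<^sub>R l2 (\<phi> u)) has_derivative (\<lambda>w. 0)) (at u)"
        by (rule scaled_derivative_imp_direction_constant)
          (use neg(2)[OF chart_in_M[OF ch u] in_H2(2)[OF x0]] in simp)
    qed
    then have "lor (snd x0) (l2 x) *\<^sub>R ((1 / lor (snd x0) (l2 x)) *\<^sub>R l2 x) = lor (snd x0) (l2 x) *\<^sub>R ((1 / lor (snd x0) (l2 x0)) *\<^sub>R l2 x0)" by simp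
    then show ?thesis using neg(2)[OF x in_H2(2)[OF x0]] prod(4)[OF x0] by (simp add: \<Lambda>2_def)
  qed
  have rel: "a * ln (\<Lambda>1 x) + d * ln (\<Lambda>2 x) = 0" if x: "x \<in> M" for x
  proof -
    have "a * ln (\<Lambda>1 x) + d * ln (\<Lambda>2 x) = a * ln (\<Lambda>1 x0) + d * ln (\<Lambda>2 x0)"
    proof (rule zero_derivative_in_charts_imp_constant[OF hyp conn _ x x0])
      fix \<phi> U W u assume ch: "is_chart M \<phi> U W" and u: "u \<in> U"
      obtain \<theta> where t: "((\<lambda>v. l1 (\<phi> v)) has_derivative (\<lambda>w. (\<theta> w / a) *\<^sub>R l1 (\<phi> u))) (at u)"
        "((\<lambda>v. l2 (\<phi> v)) has_derivative (\<lambda>w. (- \<theta> w / d) *\<^sub>R l2 (\<phi> u))) (at u)" using deriv[OF ch u] by blast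
      note p = pos[OF chart_in_M[OF ch u]]
      have 1: "((\<lambda>v. \<Lambda>1 (\<phi> v)) has_derivative (\<lambda>w. (\<theta> w / a) * \<Lambda>1 (\<phi> u))) (at u)"
        unfolding \<Lambda>1_def using has_derivative_minus[OF lor.FDERIV[OF has_derivative_const t(1), of "fst x0"]] by (simp add: lor_simps)
      have 2: "((\<lambda>v. \<Lambda>2 (\<phi> v)) has_derivative (\<lambda>w. (- \<theta> w / d) * \<Lambda>2 (\<phi> u))) (at u)"
        unfolding \<Lambda>2_def using has_derivative_minus[OF lor.FDERIV[OF has_derivative_const t(2), of "snd x0"]] by (simp add: lor_simps)
      have "((\<lambda>v. a * ln (\<Lambda>1 (\<phi> v)) + d * ln (\<Lambda>2 (\<phi> v))) has_derivative
          (\<lambda>w. a * ((\<theta> w / a) * \<Lambda>1 (\<phi> u) * inverse (\<Lambda>1 (\<phi> u))) + d * ((- \<theta> w / d) * \<Lambda>2 (\<phi> u) * inverse (\<Lambda>2 (\<phi> u))))) (at u)"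
        by (intro has_derivative_add has_derivative_mult_right has_derivative_ln[OF p(1) 1] has_derivative_ln[OF p(2) 2])
      moreover have "a * ((\<theta> w / a) * \<Lambda>1 (\<phi> u) * inverse (\<Lambda>1 (\<phi> u))) + d * ((- \<theta> w / d) * \<Lambda>2 (\<phi> u) * inverse (\<Lambda>2 (\<phi> u))) = 0" for w
        using p nz by simp
      ultimately show "((\<lambda>u. a * ln (\<Lambda>1 (\<phi> u)) + d * ln (\<Lambda>2 (\<phi> u))) has_derivative (\<lambda>w. 0)) (at u)" by (simp only:)
    qed
    then show ?thesis by (simp add: at0)
  qed
  \<comment> \<open>Unit vectors because \<open>a\<^sup>2 = c\<close> and
    \<open>d\<^sup>2 = h\<close>. In these frames the null vectors at \<open>x0\<close> become (1,
    0, 1), the point at infinity of the model horocycles.\<close>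
  let ?m = "(1 / a) *\<^sub>R fst (N x0)" and ?n = "(1 / d) *\<^sub>R snd (N x0)"
  define \<Phi> where "\<Phi> = map_prod (frame_map 1 (fst x0) ?m) (frame_map 1 (snd x0) ?n)"
  have fr: "lor (fst x0) ?m = 0" "lor ?m ?m = 1" "lor (snd x0) ?n = 0" "lor ?n ?n = 1"
    using normal_products[OF x0] nz a2 d2 c by (simp_all add: lor_simps power2_eq_square)
  note iso = frame_map_product_isometry[OF in_H2(1)[OF x0] fr(1,2) _ in_H2(2)[OF x0] fr(3,4), of 1, folded \<Phi>_def, simplified]
  have coord: "fst (\<Phi> x) $ 1 - fst (\<Phi> x) $ 3 = 1 / \<Lambda>1 x" "snd (\<Phi> x) $ 1 - snd (\<Phi> x) $ 3 = 1 / \<Lambda>2 x" if x: "x \<in> M" for x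
  proof -
    have "lor (fst x) (\<Lambda>1 x *\<^sub>R l1 x0) = -1" using dir1[OF x] prod(3)[OF x] by simp
    then have "lor (fst x) (l1 x0) = - (1 / \<Lambda>1 x)" using pos(1)[OF x] by (simp add: lor_simps field_simps)
    then show "fst (\<Phi> x) $ 1 - fst (\<Phi> x) $ 3 = 1 / \<Lambda>1 x"
      by (simp add: \<Phi>_def frame_map_def l1_def lor_simps lor_commute[of "fst x"])
    have "lor (snd x) (\<Lambda>2 x *\<^sub>R l2 x0) = -1" using dir2[OF x] prod(4)[OF x] by simp
    then have "lor (snd x) (l2 x0) = - (1 / \<Lambda>2 x)" using pos(2)[OF x] by (simp add: lor_simps field_simps)
    then show "snd (\<Phi> x) $ 1 - snd (\<Phi> x) $ 3 = 1 / \<Lambda>2 x"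
      by (simp add: \<Phi>_def frame_map_def l2_def lor_simps lor_commute[of "snd x"])
  qed
  have lnc: "a * ln (fst (\<Phi> x) $ 1 - fst (\<Phi> x) $ 3) + d * ln (snd (\<Phi> x) $ 1 - snd (\<Phi> x) $ 3) = 0" if x: "x \<in> M" for x
    using rel[OF x] pos[OF x] unfolding coord[OF x] by (simp add: ln_div)
  \<comment> \<open>The model parameter is \<open>h\<close>, not \<open>c\<close>: V has components
    of lengths \<open>2 * h * sqrt c\<close> and \<open>2 * c * sqrt h\<close>, so its unit speed
    integral curves move in the two factors with speeds \<open>sqrt h\<close> and
    \<open>sqrt c\<close>.\<close>
  have h1: "0 < h" "h < 1" "1 - h = c" using c by auto
  have abs: "\<bar>a\<bar> = sqrt (1 - h)" "\<bar>d\<bar> = sqrt h" using a2 d2 h1(3) by (metis real_sqrt_abs)+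
  have open_part: "open_part_upto_isometry M (Mc h Nt)" if "Nt = Nvec \<or> Nt = Nminus" "\<Phi> ` M \<subseteq> Mc h Nt" for Nt
    unfolding open_part_upto_isometry_def
  proof (intro exI conjI)
    show "openin (top_of_set (Mc h Nt)) (\<Phi> ` M)"
    proof (rule hypersurface_image_open_part[OF hyp iso(2,3) that(2)])
      fix y assume "y \<in> Mc h Nt"
      show "\<exists>T (\<eta> :: pt \<Rightarrow> real^3). open T \<and> y \<in> T \<and> continuous_on (Mc h Nt \<inter> T) \<eta> \<and> inj_on \<eta> (Mc h Nt \<inter> T)"
        using Mc_coordinates[OF h1(1,2) that(1)] by (intro exI[of _ UNIV] exI conjI) (auto intro: continuous_on_subset)
    qed
  qed (use iso(1) that(2) in auto)
  show ?thesis
  \<comment> \<open>For equal signs of \<open>a\<close> and \<open>d\<close> the two logarithms have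
    opposite signs, as in \<open>M1m1\<close>; opposite signs lead to \<open>M11\<close>.\<close>
  proof (cases "a * d > 0")
    case True
    have "\<Phi> x \<in> M1m1 h" if x: "x \<in> M" for x
    proof -
      have "sqrt (1 - h) * ln (fst (\<Phi> x) $ 1 - fst (\<Phi> x) $ 3) = - sqrt h * ln (snd (\<Phi> x) $ 1 - snd (\<Phi> x) $ 3)"
        using lnc[OF x] True unfolding abs[symmetric] by (auto simp: zero_less_mult_iff)
      from in_M1m1[OF h1(1,2) iso(4,5)[OF x] this] show ?thesis by simp
    qed
    then have "open_part_upto_isometry M (M1m1 h)" using open_part[of Nminus] unfolding M1m1_def by blast
    moreover have "h \<noteq> 1/2"
    proof
      assume "h = 1/2"
      then have "\<bar>a\<bar> = \<bar>d\<bar>" using abs by simp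
      then show False using True ad by (auto simp: abs_eq_iff zero_less_mult_iff)
    qed
    ultimately show ?thesis using h1(1,2) by (intro disjI1 exI[of _ h]) auto
  next
    case False
    then have neg: "a * d < 0" using nz by (simp add: linorder_not_less order_le_less)
    have "\<Phi> x \<in> M11 h" if x: "x \<in> M" for x
    proof -
      have "sqrt (1 - h) * ln (fst (\<Phi> x) $ 1 - fst (\<Phi> x) $ 3) = sqrt h * ln (snd (\<Phi> x) $ 1 - snd (\<Phi> x) $ 3)"
        using lnc[OF x] neg unfolding abs[symmetric] by (auto simp: mult_less_0_iff)
      from in_M11[OF h1(1,2) iso(4,5)[OF x] this] show ?thesis by simp
    qed
    then have "open_part_upto_isometry M (M11 h)" using open_part[of Nvec] unfolding M11_def by blast
    then show ?thesis using h1(1,2) by blast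
  qed
qed

lemma tube_case:
  assumes B: "B \<noteq> 0" and c2: "c = 1/2" and da: "d = a" and Ba: "B\<^sup>2 = 4 * a\<^sup>2 - 2"
  shows "\<exists>\<tau>. \<tau> < -1 \<and> open_part_upto_isometry M (Mtau \<tau>)"
proof -
  obtain x0 where x0: "x0 \<in> M" using ne by blast
  have h2: "h = 1/2" using c c2 by simp
  have a0: "a \<noteq> 0" using Ba zero_le_power2[of B] by auto
  \<comment> \<open>\<open>k\<close> and \<tau> are forced by two of the cancellations that
    \<open>const\<close> needs, \<open>k * B = 2 * \<delta>\<close> and
    \<open>k * a + \<tau> = 0\<close>; with \<open>Ba\<close> they satisfy \<open>k\<tau>\<close>.
    The sign \<delta> makes \<tau> negative whatever the signs of \<open>a\<close> and
    \<open>B\<close>.\<close>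
  define \<delta> where "\<delta> = sgn (a * B)"
  define k where "k = 2 * \<delta> / B"
  define \<tau> where "\<tau> = - k * a"
  have \<delta>: "\<delta> * \<delta> = 1" using a0 B by (simp add: \<delta>_def sgn_if)
  have kB: "k * B = 2 * \<delta>" using B by (simp add: k_def)
  have k4: "k * k * (B * B) = 4" 
  proof -
    have "k * k * (B * B) = (k * B) * (k * B)" by (simp add: mult_ac)
    also have "\<dots> = 4 * (\<delta> * \<delta>)" unfolding kB by simp
    finally show ?thesis using \<delta> by simp
  qed
  have BB: "B * B = 4 * (a * a) - 2" using Ba by (simp add: power2_eq_square)
  have k\<tau>: "k * k / 2 - \<tau> * \<tau> = - 1"
  proof -
    have "\<tau> * \<tau> = k * k * (a * a)" by (simp add: \<tau>_def)
    moreover have "k * k * (4 * (a * a) - 2) = 4" using k4 BB by simp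
    ultimately show ?thesis by (simp add: right_diff_distrib)
  qed
  have "\<tau> < 0"
  proof -
    have "k * a * (B * B) = 2 * \<bar>a * B\<bar>" using kB by (simp add: \<delta>_def abs_sgn mult_ac)
    then have "k * a * (B * B) > 0" using a0 B by simp
    moreover have "B * B > 0" using B by (metis not_real_square_gt_zero)
    ultimately have "k * a > 0" by (simp add: zero_less_mult_iff)
    then show ?thesis by (simp add: \<tau>_def)
  qed
  moreover have "\<tau> * \<tau> > 1" 
  proof -
    have "k \<noteq> 0" using k4 by auto
    then have "k * k > 0" by (metis not_real_square_gt_zero)
    with k\<tau> show ?thesis by linarith
  qed
  ultimately have \<tau>: "\<tau> < -1"
  proof -
    assume "\<tau> < 0" "\<tau> * \<tau> > 1"
    then have "(- \<tau>)\<^sup>2 > 1\<^sup>2" by (simp add: power2_eq_square)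
    then have "- \<tau> > 1" using \<open>\<tau> < 0\<close> power2_less_imp_less[of 1 "- \<tau>"] by simp
    then show ?thesis by simp
  qed
  \<comment> \<open>On \<open>Mtau \<tau>\<close> itself \<open>qh (p, q) = q\<close>; in general \<open>qh\<close>, \<open>nh\<close>, \<open>- \<delta> E2\<close> satisfy the same structure
    equations as \<open>q\<close>, \<open>n\<close>, \<open>E3\<close>, so a fixed Lorentz transformation maps one frame to the other.\<close>
  define qh where "qh x = k *\<^sub>R fst (N x) - \<tau> *\<^sub>R fst x" for x
  define nh where "nh x = \<tau> *\<^sub>R fst (N x) - (k / 2) *\<^sub>R fst x" for x
  \<comment> \<open>The bilinear form of the constant transformation L, expanded in both frames. The
    factor 2 is 1 / h, as the spacelike frame vectors have squared length 1/2; the timelike pair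
    carries the minus sign.\<close>
  have const: "- lor y (snd x) * lor z (qh x) + 2 * lor y (snd (N x)) * lor z (nh x) - 2 * \<delta> * lor y (E3 x) * lor z (E2 x)
      = - lor y (snd x0) * lor z (qh x0) + 2 * lor y (snd (N x0)) * lor z (nh x0) - 2 * \<delta> * lor y (E3 x0) * lor z (E2 x0)"
    if x: "x \<in> M" for x y z
  proof (rule zero_derivative_in_charts_imp_constant[OF hyp conn _ x x0])
    fix \<phi> U W u assume ch: "is_chart M \<phi> U W" and u: "u \<in> U"
    obtain om be xi where
      D: "((\<lambda>v. fst (\<phi> v)) has_derivative (\<lambda>w. (om w / c) *\<^sub>R fst (N (\<phi> u)) + (be w / c) *\<^sub>R E2 (\<phi> u))) (at u)"
        "((\<lambda>v. snd (\<phi> v)) has_derivative (\<lambda>w. - (om w / h) *\<^sub>R snd (N (\<phi> u)) + (xi w / h) *\<^sub>R E3 (\<phi> u))) (at u)"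
        "((\<lambda>v. fst (N (\<phi> v))) has_derivative (\<lambda>w. om w *\<^sub>R fst (\<phi> u) - (a * be w / c + B * xi w) *\<^sub>R E2 (\<phi> u))) (at u)"
        "((\<lambda>v. snd (N (\<phi> v))) has_derivative (\<lambda>w. - om w *\<^sub>R snd (\<phi> u) - (B * be w + d * xi w / h) *\<^sub>R E3 (\<phi> u))) (at u)"
        "((\<lambda>v. E2 (\<phi> v)) has_derivative (\<lambda>w. be w *\<^sub>R fst (\<phi> u) + (a * be w / c + B * xi w) *\<^sub>R fst (N (\<phi> u)))) (at u)"
        "((\<lambda>v. E3 (\<phi> v)) has_derivative (\<lambda>w. xi w *\<^sub>R snd (\<phi> u) + (B * be w + d * xi w / h) *\<^sub>R snd (N (\<phi> u)))) (at u)"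
      using frame_equations[OF ch u] by blast
    have lorD: "((\<lambda>v. lor s (F v)) has_derivative (\<lambda>w. lor s (F' w))) (at u)" if "(F has_derivative F') (at u)" for s F F'
      using lor.FDERIV[OF has_derivative_const that, of s] by (simp add: lor_simps)
    let ?Y0 = "lor y (snd (\<phi> u))" and ?Y1 = "lor y (snd (N (\<phi> u)))" and ?Y2 = "lor y (E3 (\<phi> u))"
      and ?Z0 = "lor z (fst (\<phi> u))" and ?Z1 = "lor z (fst (N (\<phi> u)))" and ?Z2 = "lor z (E2 (\<phi> u))"
    let ?y0 = "\<lambda>w. - (2 * om w) * ?Y1 + 2 * xi w * ?Y2" and ?y1 = "\<lambda>w. - om w * ?Y0 - (B * be w + 2 * a * xi w) * ?Y2"
      and ?y2 = "\<lambda>w. xi w * ?Y0 + (B * be w + 2 * a * xi w) * ?Y1"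
      and ?z0 = "\<lambda>w. 2 * om w * ?Z1 + 2 * be w * ?Z2" and ?z1 = "\<lambda>w. om w * ?Z0 - (2 * a * be w + B * xi w) * ?Z2"
      and ?z2 = "\<lambda>w. be w * ?Z0 + (2 * a * be w + B * xi w) * ?Z1"
    have R: "((\<lambda>v. lor z (fst (\<phi> v))) has_derivative ?z0) (at u)" "((\<lambda>v. lor y (snd (\<phi> v))) has_derivative ?y0) (at u)"
      "((\<lambda>v. lor z (fst (N (\<phi> v)))) has_derivative ?z1) (at u)" "((\<lambda>v. lor y (snd (N (\<phi> v)))) has_derivative ?y1) (at u)"
      "((\<lambda>v. lor z (E2 (\<phi> v))) has_derivative ?z2) (at u)" "((\<lambda>v. lor y (E3 (\<phi> v))) has_derivative ?y2) (at u)"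
      using lorD[OF D(1), of z] lorD[OF D(2), of y] lorD[OF D(3), of z] lorD[OF D(4), of y] lorD[OF D(5), of z] lorD[OF D(6), of y]
      by (simp_all add: lor_simps c2 h2 da mult_ac)
    let ?QH = "\<lambda>v. k * lor z (fst (N (\<phi> v))) - \<tau> * lor z (fst (\<phi> v))" and ?NH = "\<lambda>v. \<tau> * lor z (fst (N (\<phi> v))) - (k / 2) * lor z (fst (\<phi> v))"
    have "((\<lambda>v. - (lor y (snd (\<phi> v)) * ?QH v) + 2 * (lor y (snd (N (\<phi> v))) * ?NH v) - 2 * \<delta> * (lor y (E3 (\<phi> v)) * lor z (E2 (\<phi> v))))
      has_derivative (\<lambda>w. - (?Y0 * (k * ?z1 w - \<tau> * ?z0 w) + ?y0 w * ?QH u) + 2 * (?Y1 * (\<tau> * ?z1 w - (k / 2) * ?z0 w) + ?y1 w * ?NH u)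
        - 2 * \<delta> * (?Y2 * ?z2 w + ?y2 w * ?Z2))) (at u)"
      by (intro has_derivative_add has_derivative_diff has_derivative_minus has_derivative_mult has_derivative_mult_right R)
    moreover have "- (?Y0 * (k * ?z1 w - \<tau> * ?z0 w) + ?y0 w * ?QH u) + 2 * (?Y1 * (\<tau> * ?z1 w - (k / 2) * ?z0 w) + ?y1 w * ?NH u)
        - 2 * \<delta> * (?Y2 * ?z2 w + ?y2 w * ?Z2) = 0" for w
    proof -
      \<comment> \<open>The terms in \<open>om\<close> cancel identically; each remaining
        coefficient is one of those shown to vanish in \<open>1\<close> to \<open>4\<close>.\<close>
      have expand: "- (Y0 * (k * (o' * Z0 - (2 * a * b + B * x) * Z2) - \<tau> * (2 * o' * Z1 + 2 * b * Z2))
            + (- (2 * o') * Y1 + 2 * x * Y2) * (k * Z1 - \<tau> * Z0))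
          + 2 * (Y1 * (\<tau> * (o' * Z0 - (2 * a * b + B * x) * Z2) - (k / 2) * (2 * o' * Z1 + 2 * b * Z2))
            + (- o' * Y0 - (B * b + 2 * a * x) * Y2) * (\<tau> * Z1 - (k / 2) * Z0))
          - 2 * \<delta> * (Y2 * (b * Z0 + (2 * a * b + B * x) * Z1) + (x * Y0 + (B * b + 2 * a * x) * Y1) * Z2)
        = (k * B - 2 * \<delta>) * x * Y0 * Z2 + 2 * (k * a + \<tau>) * b * Y0 * Z2
          + (- 4 * \<tau> * a - 2 * k - 2 * \<delta> * B) * b * Y1 * Z2 + (- 2 * \<tau> * B - 4 * \<delta> * a) * x * Y1 * Z2
          + (- 2 * k - 4 * a * \<tau> - 2 * \<delta> * B) * x * Y2 * Z1 + (2 * \<tau> + 2 * a * k) * x * Y2 * Z0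
          + (- 2 * B * \<tau> - 4 * \<delta> * a) * b * Y2 * Z1 + (B * k - 2 * \<delta>) * b * Y2 * Z0"
        for Y0 Y1 Y2 Z0 Z1 Z2 o' b x :: real
        by (simp add: algebra_simps)
      have 1: "- 4 * \<tau> * a - 2 * k - 2 * \<delta> * B = 0"
      proof -
        have "- 4 * \<tau> * a - 2 * k = k * (4 * (a * a) - 2)" by (simp add: \<tau>_def algebra_simps)
        also have "\<dots> = k * B * B" using BB by simp
        finally show ?thesis using kB by simp
      qed
      have 2: "- 2 * \<tau> * B - 4 * \<delta> * a = 0"
      proof -
        have "- 2 * \<tau> * B = 2 * a * (k * B)" by (simp add: \<tau>_def)
        then show ?thesis using kB by simp
      qed
      have 3: "- 2 * k - 4 * a * \<tau> - 2 * \<delta> * B = 0" "- 2 * B * \<tau> - 4 * \<delta> * a = 0"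
        using 1 2 by (simp_all add: mult_ac)
      have 4: "k * a + \<tau> = 0" "2 * \<tau> + 2 * a * k = 0" "k * B - 2 * \<delta> = 0" "B * k - 2 * \<delta> = 0"
        using kB by (simp_all add: \<tau>_def mult_ac)
      show ?thesis unfolding expand 1 2 3 4 by simp
    qed
    ultimately show "((\<lambda>u. - lor y (snd (\<phi> u)) * lor z (qh (\<phi> u)) + 2 * lor y (snd (N (\<phi> u))) * lor z (nh (\<phi> u))
        - 2 * \<delta> * lor y (E3 (\<phi> u)) * lor z (E2 (\<phi> u))) has_derivative (\<lambda>w. 0)) (at u)"
      by (simp add: qh_def nh_def lor_simps mult.assoc)
  qed
  note np = normal_products[OF x0, unfolded c2 h2]
  have qh0: "lor (qh x0) (qh x0) = -1" "lor (fst x0) (qh x0) = \<tau>" "lor (qh x0) (nh x0) = 0" "lor (nh x0) (nh x0) = 1/2"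
    unfolding qh_def nh_def lor_simps lor_commute[of "fst (N x0)" "fst x0"] np using k\<tau> by (simp_all add: field_simps)
  have qhH: "qh x0 \<in> H2" by (rule H2_if_lor_neg[OF in_H2(1)[OF x0]]) (use qh0 \<tau> in auto)
  have cr: "lcross (qh x0) (nh x0) = - E2 x0"
  proof -
    have z: "lcross v v = 0" for v by (simp add: lcross_def vec_eq_iff forall_3)
    have "lcross (qh x0) (nh x0) = (k * k / 2 - \<tau> * \<tau>) *\<^sub>R E2 x0"
      by (simp add: qh_def nh_def E2_def lcross.diff_left lcross.diff_right lcross.scaleR_left lcross.scaleR_right z
          lcross_commute[of "fst (N x0)" "fst x0"] scaleR_diff_left mult_ac)
    then show ?thesis using k\<tau> by simp
  qed
  \<comment> \<open>Normalised frames at \<open>x0\<close>. As \<open>lcross (qh x0) (nh x0)\<close>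
    is \<open>- E2 x0\<close>, the sign \<delta> in the first frame map produces the partner
    \<open>- \<delta> E2\<close> of \<open>E3\<close>.\<close>
  let ?m = "sqrt 2 *\<^sub>R nh x0" and ?n = "sqrt 2 *\<^sub>R snd (N x0)"
  define \<Phi> where "\<Phi> = map_prod (frame_map \<delta> (qh x0) ?m) (frame_map 1 (snd x0) ?n)"
  have fr: "lor (qh x0) ?m = 0" "lor ?m ?m = 1" "\<delta>\<^sup>2 = 1" "lor (snd x0) ?n = 0" "lor ?n ?n = 1"
    unfolding lor_simps qh0 np using \<delta> by (simp_all add: power2_eq_square)
  note iso = frame_map_product_isometry[OF qhH fr(1-3) in_H2(2)[OF x0] fr(4,5), folded \<Phi>_def]
  have "lor (fst (\<Phi> x)) (snd (\<Phi> x)) = \<tau>" if x: "x \<in> M" for x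
  proof -
    have s2: "sqrt 2 * s * (sqrt 2 * t) = 2 * (s * t)" for s t
      using real_sqrt_mult_self[of 2] by (simp add: mult_ac)
    have s3: "\<delta> * (sqrt 2 * s) * (sqrt 2 * t) = 2 * (\<delta> * (s * t))" for s t
      using s2[of "\<delta> * s" t] by (simp add: mult_ac)
    have lv: "lor (vec3 r s t) (vec3 r' s' t') = - (r * r') + s * s' + t * t'" for r s t r' s' t'
      by (simp add: lor_def)
    have "lor (fst (\<Phi> x)) (snd (\<Phi> x)) = - lor (snd x) (snd x0) * lor (fst x) (qh x0)
        + 2 * lor (snd x) (snd (N x0)) * lor (fst x) (nh x0) - 2 * \<delta> * lor (snd x) (E3 x0) * lor (fst x) (E2 x0)"
      unfolding \<Phi>_def fst_map_prod snd_map_prod frame_map_def lv lcross.scaleR_right cr E3_def[symmetric]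
      by (simp add: lor_simps lor_commute[of _ "fst x"] lor_commute[of _ "snd x"] s2 s3)
    \<comment> \<open>Both arguments of the form are the factors of \<open>x\<close> itself, so at
      \<open>x\<close> only the timelike pair survives, with value
      \<open>lor (fst x) (qh x) = \<tau>\<close>.\<close>
    also have "\<dots> = - lor (snd x) (snd x) * lor (fst x) (qh x) + 2 * lor (snd x) (snd (N x)) * lor (fst x) (nh x)
        - 2 * \<delta> * lor (snd x) (E3 x) * lor (fst x) (E2 x)"
      by (rule const[OF x, symmetric])
    also have "\<dots> = \<tau>" using normal_products[OF x] by (simp add: qh_def lor_simps E2_def E3_def)
    finally show ?thesis .
  qed
  then have sub: "\<Phi> ` M \<subseteq> Mtau \<tau>" using iso(4,5) by (auto simp: Mtau_def HH_def mem_Times_iff)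
  have "openin (top_of_set (Mtau \<tau>)) (\<Phi> ` M)"
    by (rule hypersurface_image_open_part[OF hyp iso(2,3) sub]) (metis Mtau_coordinates[OF _ \<tau>] prod.collapse)
  then show ?thesis using iso(1) sub \<tau> unfolding open_part_upto_isometry_def by blast
qed

end

theorem theorem1p4:
  fixes M :: "pt set" and N :: "pt \<Rightarrow> pt"
  assumes "hypersurface M" and "connected M" and "M \<noteq> {}"
    and "unit_normal M N"
    and "\<exists>k1 k2 k3. k1 \<noteq> k2 \<and> k1 \<noteq> k3 \<and> k2 \<noteq> k3 \<and>
           (\<forall>x\<in>M. principal_curvatures M N x = {k1, k2, k3})"
    and "\<forall>x\<in>M. \<exists>\<mu>. shape_op M N x (Vfield N x) = \<mu> *\<^sub>R Vfield N x"
  shows "(\<exists>c. (0 < c \<and> c < 1/2 \<or> 1/2 < c \<and> c < 1) \<and> open_part_upto_isometry M (M1m1 c))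
       \<or> (\<exists>c. 0 < c \<and> c < 1 \<and> open_part_upto_isometry M (M11 c))
       \<or> (\<exists>\<tau>. \<tau> < -1 \<and> open_part_upto_isometry M (Mtau \<tau>))"
proof -
  obtain k1 k2 k3 where k: "k1 \<noteq> k2" "k1 \<noteq> k3" "k2 \<noteq> k3"
    and curv: "\<forall>x\<in>M. principal_curvatures M N x = {k1, k2, k3}" using assms(5) by blast
  interpret three_curvatures M N k1 k2 k3
    by unfold_locales (use assms k curv in auto)
  obtain c h a B d where S: "0 < c" "0 < h" "c + h = 1"
    "\<forall>x\<in>M. fM x = c \<and> aM x = a \<and> BM x = B \<and> dM x = d"
    and alt: "B = 0 \<and> a\<^sup>2 = c \<and> d\<^sup>2 = h \<and> a \<noteq> d \<or> B \<noteq> 0 \<and> c = 1/2 \<and> d = a \<and> B\<^sup>2 = 4 * a\<^sup>2 - 2"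
    by (rule shape_constants)
  interpret constant_shape M N k1 k2 k3 c h a B d
    by unfold_locales (use S in auto)
  from alt show ?thesis using horospherical_case tube_case by blast
qed

end
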